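(* Let $1\le d<n$, $\mathrm{rch}_{\min}>0$, $0<f_{\min}\le f_{\max}/4$, $L\ge0$, $\tau>0$, $\alpha<1$, and $\varepsilon\le\mathrm{rch}_{\min}/(2^{34}d^2)$. Assume $2^{d+1}\sigma_d f_{\min}\mathrm{rch}_{\min}^d\le1$. Then any randomized SQ algorithm estimating $M=\mathrm{Supp}(D)$ over the fixed point model $\mathcal{D}^{n,d}_{\mathrm{rch}_{\min}}(f_{\min},f_{\max},L;0)$ with respect to $d_H$ with precision $\varepsilon$ and probability of success at least $1-\alpha$ must make at least $$q\ge\left(\frac{n}{\omega_d f_{\min}\mathrm{rch}_{\min}^d}\left(\frac{\mathrm{rch}_{\min}}{2^{21}\varepsilon}\right)^{d/2}+\log(1-\alpha)\right)\Big/\log(1+1/\tau)$$ queries to $\mathrm{STAT}(\tau)$.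
   Context: Notation: $\omega_d$ is the volume of the unit ball of $\mathbb{R}^d$ and $\sigma_d$ the $d$-dimensional volume of the unit sphere of $\mathbb{R}^{d+1}$. $\mathrm{d}(z,K)=\inf_{p\in K}\|p-z\|$. The medial axis of a closed $K\subseteq\mathbb{R}^n$ is the set of points having at least two distinct nearest points in $K$, and the reach $\mathrm{rch}_K$ is the infimum of $\mathrm{d}(z,K)$ over the medial axis. $\mathcal{M}^{n,d}_{\rho}$ is the set of compact connected $d$-dimensional $C^2$ submanifolds of $\mathbb{R}^n$ without boundary with reach $\ge\rho$. $\mathcal{D}^{n,d}_{\mathrm{rch}_{\min}}(f_{\min},f_{\max},L)$ is the set of Borel probability distributions $D$ on $\mathbb{R}^n$ with support $M\in\mathcal{M}^{n,d}_{\mathrm{rch}_{\min}}$ having a density $f$ w.r.t. the $d$-dimensional Hausdorff measure restricted to $M$ with $f_{\min}\le f\le f_{\max}$ on $M$ and $f$ $L$-Lipschitz on $M$; the fixed point model $\mathcal{D}^{n,d}_{\mathrm{rch}_{\min}}(f_{\min},f_{\max},L;0)$ consists of those with $0\in M$. $d_H(K,K')=\sup_x|\mathrm{d}(x,K)-\mathrm{d}(x,K')|$. SQ framework: a $\mathrm{STAT}(\tau)$ oracle for $D$ answers each query $r:\mathbb{R}^n\to[-1,1]$ (measurable) with an arbitrary adversarial real $a$ such that $|a-\mathbb{E}_{D}[r]|\le\tau$. A deterministic SQ algorithm chooses each query adaptively as a function of previous answers and outputs a function of all answers. A randomized SQ algorithm is a probability distribution over deterministic SQ algorithms; it estimates $\mathrm{Supp}(D)$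 over a model with precision $\varepsilon$ and probability of success $1-\alpha$ if for every $D$ in the model and every valid $\mathrm{STAT}(\tau)$ oracle for $D$, with probability at least $1-\alpha$ over the draw of the algorithm its output $\hat M$ satisfies $d_H(\mathrm{Supp}(D),\hat M)\le\varepsilon$. *)

theory Defs
  imports "HOL-Analysis.Analysis" "HOL-Probability.Probability"
begin

definition hausdorff_pre :: "nat \<Rightarrow> real \<Rightarrow> 'a::metric_space set \<Rightarrow> ennreal" where
  "hausdorff_pre d \<delta> A =
     (INF C \<in> {C :: nat \<Rightarrow> 'a set. A \<subseteq> (\<Union>i. C i) \<and> (\<forall>i. bounded (C i) \<and> diameter (C i) \<le> \<delta>)}.
        (\<Sum>i. ennreal (unit_ball_vol (real d) * (diameter (C i) / 2) ^ d)))"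

definition hausdorff_outer :: "nat \<Rightarrow> 'a::metric_space set \<Rightarrow> ennreal" where
  "hausdorff_outer d A = (SUP \<delta> \<in> {0<..}. hausdorff_pre d \<delta> A)"

definition hausdorff_measure :: "nat \<Rightarrow> 'a::metric_space measure" where
  "hausdorff_measure d = measure_of UNIV (sets borel) (hausdorff_outer d)"

definition ball_volume :: "'d::finite itself \<Rightarrow> real" where
  "ball_volume _ = measure lborel (ball (0 :: real^'d) 1)"

definition sphere_volume :: "'d::finite itself \<Rightarrow> real" where
  "sphere_volume _ = measure (hausdorff_measure CARD('d)) (sphere (0 :: (real^'d) \<times> real) 1)"

definition einfdist :: "'a::metric_space \<Rightarrow> 'a set \<Rightarrow> ereal" where
  "einfdist x K = (INF p \<in> K. ereal (dist p x))"

definition hausdorff_distance :: "'a::metric_space set \<Rightarrow> 'a set \<Rightarrow> ereal" where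
  "hausdorff_distance K K' = (SUP x. \<bar>einfdist x K - einfdist x K'\<bar>)"

definition medial_axis :: "'a::metric_space set \<Rightarrow> 'a set" where
  "medial_axis K = {z. \<exists>p\<in>K. \<exists>p'\<in>K. p \<noteq> p' \<and>
      ereal (dist p z) = einfdist z K \<and> ereal (dist p' z) = einfdist z K}"

definition reach :: "'a::metric_space set \<Rightarrow> ereal" where
  "reach K = (INF z \<in> medial_axis K. einfdist z K)"

definition C2_immersion_on :: "'a::euclidean_space set \<Rightarrow> ('a \<Rightarrow> 'b::euclidean_space) \<Rightarrow> bool" where
  "C2_immersion_on V \<phi> \<longleftrightarrow>
     (\<exists>D1 :: 'a \<Rightarrow> ('a \<Rightarrow>\<^sub>L 'b). \<exists>D2 :: 'a \<Rightarrow> ('a \<Rightarrow>\<^sub>L ('a \<Rightarrow>\<^sub>L 'b)).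
        (\<forall>x\<in>V. (\<phi> has_derivative blinfun_apply (D1 x)) (at x)) \<and>
        (\<forall>x\<in>V. (D1 has_derivative blinfun_apply (D2 x)) (at x)) \<and>
        continuous_on V D2 \<and>
        (\<forall>x\<in>V. inj (blinfun_apply (D1 x))))"

definition C2_submanifold :: "'d::finite itself \<Rightarrow> (real^'n::finite) set \<Rightarrow> bool" where
  "C2_submanifold _ M \<longleftrightarrow>
     (\<forall>p\<in>M. \<exists>U V. \<exists>\<phi> :: real^'d \<Rightarrow> real^'n. \<exists>\<psi>.
        open U \<and> p \<in> U \<and> open V \<and> C2_immersion_on V \<phi> \<and> homeomorphism V (M \<inter> U) \<phi> \<psi>)"

definition manifold_class :: "'d::finite itself \<Rightarrow> real \<Rightarrow> (real^'n::finite) set set" where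
  "manifold_class t \<rho> = {M. compact M \<and> connected M \<and> C2_submanifold t M \<and> reach M \<ge> ereal \<rho>}"

definition support :: "'a::metric_space measure \<Rightarrow> 'a set" where
  "support D = {x. \<forall>e>0. emeasure D (ball x e) > 0}"

definition fixed_point_model ::
  "'d::finite itself \<Rightarrow> real \<Rightarrow> real \<Rightarrow> real \<Rightarrow> real \<Rightarrow> (real^'n::finite) measure set" where
  "fixed_point_model t rchmin fmin fmax L =
     {D. prob_space D \<and> sets D = sets borel \<and>
        (\<exists>M f. M \<in> manifold_class t rchmin \<and> support D = M \<and>
           D = density (hausdorff_measure CARD('d)) (\<lambda>x. ennreal (f x) * indicator M x) \<and>
           (\<forall>x\<in>M. fmin \<le> f x \<and> f x \<le> fmax) \<and> L-lipschitz_on M f \<and> 0 \<in> M)}"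

definition sq_queries :: "(real^'n::finite \<Rightarrow> real) set" where
  "sq_queries = {r. r \<in> borel_measurable borel \<and> (\<forall>x. \<bar>r x\<bar> \<le> 1)}"

text \<open>A STAT(tau) oracle for D: an adversary that, given the history of queries (the last one
  being the current query), answers within tau of the expectation of the current query.\<close>
definition stat_oracle :: "real \<Rightarrow> (real^'n::finite) measure \<Rightarrow> ((real^'n \<Rightarrow> real) list \<Rightarrow> real) \<Rightarrow> bool" where
  "stat_oracle \<tau> D orc \<longleftrightarrow>
     (\<forall>hs r. r \<in> sq_queries \<longrightarrow> \<bar>orc (hs @ [r]) - integral\<^sup>L D r\<bar> \<le> \<tau>)"

fun sq_run :: "(nat \<Rightarrow> real list \<Rightarrow> 'q) \<Rightarrow> ('q list \<Rightarrow> real) \<Rightarrow> nat \<Rightarrow> 'q list \<times> real list" where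
  "sq_run Q orc 0 = ([], [])"
| "sq_run Q orc (Suc i) =
     (let (qs, as) = sq_run Q orc i; r = Q i as in (qs @ [r], as @ [orc (qs @ [r])]))"

end

theory Submission
  imports Defs
begin

text \<open>
  The base manifold is the round \<open>d\<close>-sphere of volume \<open>1/(2 fmin)\<close>; the volume hypothesis says
  exactly that its radius \<open>R\<close> is at least \<open>2 rchmin\<close>. At the points of a maximal \<open>2\<delta>\<close>-separated subset,
  \<open>\<delta> = 10 \<surd>(\<epsilon> rchmin)\<close>, the sphere is pushed by bumps of height \<open>4\<epsilon>\<close> along unit normal vectors taken
  from an exponentially large binary code in the \<open>(n-d)\<close>-dimensional normal space. The perturbation is
  \<open>C\<^sup>2\<close>-small enough to keep the reach above \<open>rchmin\<close> and to change volumes by a factor at most 2, so the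
  uniform distributions lie in the model, while two different choices of codewords give supports more
  than \<open>2\<epsilon>\<close> apart. One net point is left unperturbed and translated to the origin. There are
  \<open>exp (c n N)\<close> such supports with \<open>N\<close> of order \<open>1/(\<omega>\<^sub>d fmin \<delta>\<^sup>d)\<close>, whereas an oracle rounding its answers
  to \<open>1 + 1/\<tau>\<close> values lets \<open>q\<close> queries distinguish at most \<open>(1 + 1/\<tau>) ^ q\<close> of them.
\<close>

section \<open>Hausdorff measure\<close>

text \<open>All sizes are balanced against the reach budget in \<open>reach_sphere_image_ge\<close>,
  namely 2 r times the total curvature at most (1 - \<kappa>)^2. A sphere of radius at least 2
  \<open>rchmin\<close> spends about one half. Bumps of height h and width \<delta> spend 12 h
  \<open>rchmin\<close> / \<delta>^2, which is 12/25 for every \<epsilon> with the chosen h and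
  \<delta>; the last 1/50 absorbs the slope \<kappa> of the bumps. The height 4 \<epsilon> comes
  from the separation: codewords with inner product at most 3/4 then give surfaces 5/2 \<epsilon>
  apart. The sphere needs no continuous normal frame: the direction of a bump is constant on its
  support, so it has to be normal at the centre only. The Hausdorff measure is never computed
  exactly. Covers by pieces of balls cost a factor 9/4 per dimension, and this loss is hidden in the
  constant 2^21, whose square root exceeds 1440 = 32 * 45.\<close>

lemma hausdorff_pre_le_cover:
  assumes "A \<subseteq> (\<Union>i. C i)" "\<And>i. bounded (C i)" "\<And>i. diameter (C i) \<le> \<delta>"
  shows "hausdorff_pre d \<delta> A \<le> (\<Sum>i. ennreal (unit_ball_vol (real d) * (diameter (C i) / 2) ^ d))"
  unfolding hausdorff_pre_def using assms by (intro INF_lower) auto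

text \<open>The sequence of covering sets is filled up with empty ones; \<open>0 < d\<close> makes
  their weight \<open>0 ^ d\<close> vanish.\<close>

lemma hausdorff_pre_le_finite_cover:
  fixes C :: "'b \<Rightarrow> 'a::metric_space set"
  assumes "0 < d" "0 \<le> \<delta>" "finite P" "A \<subseteq> (\<Union>p\<in>P. C p)"
    and "\<And>p. p \<in> P \<Longrightarrow> bounded (C p)" "\<And>p. p \<in> P \<Longrightarrow> diameter (C p) \<le> \<delta>"
  shows "hausdorff_pre d \<delta> A \<le> (\<Sum>p\<in>P. ennreal (unit_ball_vol (real d) * (diameter (C p) / 2) ^ d))"
proof -
  obtain g where g: "bij_betw g {..<card P} P"
    using ex_bij_betw_nat_finite[OF \<open>finite P\<close>] by (auto simp: atLeast0LessThan)
  let ?C = "\<lambda>i. if i < card P then C (g i) else {}"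
  have gP: "g i \<in> P" if "i < card P" for i using g that by (auto simp: bij_betw_def)
  have "A \<subseteq> (\<Union>i. ?C i)"
  proof
    fix x assume "x \<in> A"
    then obtain p where p: "p \<in> P" "x \<in> C p" using assms(4) by auto
    then obtain i where "i < card P" "g i = p" using g by (force simp: bij_betw_def)
    then show "x \<in> (\<Union>i. ?C i)" using p by (auto intro!: exI[of _ i])
  qed
  then have "hausdorff_pre d \<delta> A \<le> (\<Sum>i. ennreal (unit_ball_vol (real d) * (diameter (?C i) / 2) ^ d))"
    using assms gP by (intro hausdorff_pre_le_cover) auto
  also have "\<dots> = (\<Sum>i<card P. ennreal (unit_ball_vol (real d) * (diameter (?C i) / 2) ^ d))"
    using \<open>0 < d\<close> by (intro suminf_finite) auto
  also have "\<dots> = (\<Sum>i<card P. ennreal (unit_ball_vol (real d) * (diameter (C (g i)) / 2) ^ d))"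
    by (intro sum.cong) auto
  also have "\<dots> = (\<Sum>p\<in>P. ennreal (unit_ball_vol (real d) * (diameter (C p) / 2) ^ d))"
    by (rule sum.reindex_bij_betw[OF g])
  finally show ?thesis .
qed

lemma hausdorff_pre_mono: "A \<subseteq> B \<Longrightarrow> hausdorff_pre d \<delta> A \<le> hausdorff_pre d \<delta> B"
  unfolding hausdorff_pre_def by (intro INF_superset_mono) auto

lemma hausdorff_pre_antimono: "\<delta> \<le> \<delta>' \<Longrightarrow> hausdorff_pre d \<delta>' A \<le> hausdorff_pre d \<delta> A"
  unfolding hausdorff_pre_def by (intro INF_superset_mono) (auto intro: order_trans)

lemma hausdorff_pre_empty: "0 < d \<Longrightarrow> 0 \<le> \<delta> \<Longrightarrow> hausdorff_pre d \<delta> {} = 0"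
  using hausdorff_pre_le_finite_cover[of d \<delta> "{}" "{}"] by simp

lemma hausdorff_pre_approx_cover:
  assumes "hausdorff_pre d \<delta> A < b"
  obtains C where "A \<subseteq> (\<Union>i. C i)" "\<And>i. bounded (C i)" "\<And>i. diameter (C i) \<le> \<delta>"
    "(\<Sum>i. ennreal (unit_ball_vol (real d) * (diameter (C i) / 2) ^ d)) < b"
  using assms unfolding hausdorff_pre_def INF_less_iff by auto

text \<open>Covers of the \<open>A n\<close>, each within e / 2^(n+1) of optimal, are merged into
  one sequence by \<open>prod_decode\<close>. Finiteness of the right-hand side provides the strict
  inequality from which such covers are obtained.\<close>

lemma hausdorff_pre_countably_subadditive:
  "hausdorff_pre d \<delta> (\<Union>n. A n) \<le> (\<Sum>n. hausdorff_pre d \<delta> (A n :: 'a::metric_space set))"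
proof (rule ennreal_le_epsilon)
  let ?w = "\<lambda>C. ennreal (unit_ball_vol (real d) * (diameter C / 2) ^ d)"
  fix e :: real
  assume fin: "(\<Sum>n. hausdorff_pre d \<delta> (A n)) < top" and e: "0 < e"
  have "\<exists>C. A n \<subseteq> (\<Union>i. C i) \<and> (\<forall>i. bounded (C i) \<and> diameter (C i) \<le> \<delta>) \<and>
     (\<Sum>i. ?w (C i)) \<le> hausdorff_pre d \<delta> (A n) + ennreal (e * (1/2)^Suc n)" for n
  proof -
    have "hausdorff_pre d \<delta> (A n) < top"
      using fin by (metis ennreal_suminf_lessD)
    then have "hausdorff_pre d \<delta> (A n) < hausdorff_pre d \<delta> (A n) + ennreal (e * (1/2)^Suc n)"
      using e by (simp add: ennreal_add_left_cancel_less[of _ 0, simplified] less_top)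
    from hausdorff_pre_approx_cover[OF this] show ?thesis
      by (metis order_less_imp_le)
  qed
  then obtain C where C: "\<And>n. A n \<subseteq> (\<Union>i. C n i)" "\<And>n i. bounded (C n i)" "\<And>n i. diameter (C n i) \<le> \<delta>"
     "\<And>n. (\<Sum>i. ?w (C n i)) \<le> hausdorff_pre d \<delta> (A n) + ennreal (e * (1/2)^Suc n)"
    by metis
  let ?D = "\<lambda>k. case prod_decode k of (n, i) \<Rightarrow> C n i"
  have "hausdorff_pre d \<delta> (\<Union>n. A n) \<le> (\<Sum>k. ?w (?D k))"
  proof (rule hausdorff_pre_le_cover)
    show "(\<Union>n. A n) \<subseteq> (\<Union>k. ?D k)"
    proof
      fix x assume "x \<in> (\<Union>n. A n)"
      then obtain n i where "x \<in> C n i" using C(1) by blast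
      then show "x \<in> (\<Union>k. ?D k)" by (auto intro!: exI[of _ "prod_encode (n, i)"])
    qed
  qed (auto simp: C split: prod.split)
  also have "\<dots> = (\<Sum>k. case prod_decode k of (n, i) \<Rightarrow> ?w (C n i))"
    by (auto intro!: suminf_cong split: prod.split)
  also have "\<dots> = (\<Sum>n i. ?w (C n i))"
    using suminf_ennreal_2dimen[of "\<lambda>n. \<Sum>i. ?w (C n i)" "\<lambda>(n,i). ?w (C n i)"]
    by (simp add: comp_def)
  also have "\<dots> \<le> (\<Sum>n. hausdorff_pre d \<delta> (A n) + ennreal (e * (1/2)^Suc n))"
    by (intro suminf_le C) auto
  also have "\<dots> = (\<Sum>n. hausdorff_pre d \<delta> (A n)) + (\<Sum>n. ennreal (e * (1/2)^Suc n))"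
    by (intro suminf_add[symmetric]) auto
  also have "(\<Sum>n. ennreal (e * (1/2)^Suc n)) = ennreal e"
  proof (rule suminf_ennreal_eq)
    show "(\<lambda>n. e * (1/2)^Suc n) sums e"
      using sums_mult[OF power_half_series, of e] by simp
  qed (use e in auto)
  finally show "hausdorff_pre d \<delta> (\<Union>n. A n) \<le> (\<Sum>n. hausdorff_pre d \<delta> (A n)) + ennreal e" .
qed

section \<open>From the pre-measures to a measure on the Borel sets\<close>

lemma hausdorff_outer_mono: "A \<subseteq> B \<Longrightarrow> hausdorff_outer d A \<le> hausdorff_outer d B"
  unfolding hausdorff_outer_def by (intro SUP_mono) (auto intro: hausdorff_pre_mono)

lemma hausdorff_outer_countably_subadditive:
  "hausdorff_outer d (\<Union>n. A n) \<le> (\<Sum>n. hausdorff_outer d (A n :: 'a::metric_space set))"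
  unfolding hausdorff_outer_def
proof (rule SUP_least)
  fix \<delta> :: real assume "\<delta> \<in> {0<..}"
  then have "(\<Sum>n. hausdorff_pre d \<delta> (A n)) \<le> (\<Sum>n. SUP \<delta>\<in>{0<..}. hausdorff_pre d \<delta> (A n))"
    by (intro suminf_le SUP_upper) auto
  then show "hausdorff_pre d \<delta> (\<Union>n. A n) \<le> (\<Sum>n. SUP \<delta>\<in>{0<..}. hausdorff_pre d \<delta> (A n))"
    using hausdorff_pre_countably_subadditive order_trans by blast
qed

lemma hausdorff_outer_empty: "0 < d \<Longrightarrow> hausdorff_outer d {} = 0"
  unfolding hausdorff_outer_def
  by (auto simp: hausdorff_pre_empty bot_ennreal intro!: SUP_eq_const antisym SUP_least)

lemma hausdorff_outer_measure_space:
  "0 < d \<Longrightarrow> outer_measure_space (Pow UNIV) (hausdorff_outer d :: 'a::metric_space set \<Rightarrow> ennreal)"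
  unfolding outer_measure_space_def positive_def increasing_def countably_subadditive_def
  using hausdorff_outer_empty hausdorff_outer_mono hausdorff_outer_countably_subadditive by auto

lemma hausdorff_outer_Un:
  fixes A B :: "'a::metric_space set"
  assumes "0 < d"
  shows "hausdorff_outer d (A \<union> B) \<le> hausdorff_outer d A + hausdorff_outer d B"
proof -
  interpret sigma_algebra "UNIV::'a set" "Pow UNIV" by (rule sigma_algebra_Pow)
  have "subadditive (Pow UNIV) (hausdorff_outer d :: 'a set \<Rightarrow> ennreal)"
    using countably_subadditive_subadditive hausdorff_outer_measure_space[OF assms]
    unfolding outer_measure_space_def by blast
  then have "hausdorff_outer d (A \<union> (B - A)) \<le> hausdorff_outer d A + hausdorff_outer d (B - A)"
    unfolding subadditive_def by blast
  also have "\<dots> \<le> hausdorff_outer d A + hausdorff_outer d B"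
    by (intro add_left_mono hausdorff_outer_mono) auto
  finally show ?thesis by simp
qed

text \<open>A cover by sets of diameter below the gap splits into covers of the two pieces.\<close>
lemma hausdorff_outer_separated:
  fixes A B :: "'a::metric_space set"
  assumes d: "0 < d" and g: "0 < g" and sep: "\<And>x y. x \<in> A \<Longrightarrow> y \<in> B \<Longrightarrow> g \<le> dist x y"
  shows "hausdorff_outer d A + hausdorff_outer d B \<le> hausdorff_outer d (A \<union> B)"
proof -
  let ?w = "\<lambda>C. ennreal (unit_ball_vol (real d) * (diameter C / 2) ^ d)"
  have small: "hausdorff_pre d \<delta> A + hausdorff_pre d \<delta> B \<le> hausdorff_pre d \<delta> (A \<union> B)"
    if \<delta>: "\<delta> < g" "0 < \<delta>" for \<delta>
    unfolding hausdorff_pre_def[of d \<delta> "A \<union> B"]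
  proof (rule INF_greatest, safe)
    fix C :: "nat \<Rightarrow> 'a set"
    assume C: "A \<union> B \<subseteq> \<Union> (range C)" "\<forall>i. bounded (C i) \<and> diameter (C i) \<le> \<delta>"
    have disj: "C i \<inter> A = {} \<or> C i \<inter> B = {}" for i
    proof (rule ccontr)
      assume "\<not> ?thesis"
      then obtain x y where "x \<in> C i" "x \<in> A" "y \<in> C i" "y \<in> B" by auto
      then have "dist x y \<le> \<delta>" "g \<le> dist x y"
        using diameter_bounded_bound[of "C i" x y] C(2) sep[of x y] by (auto intro: order_trans)
      then show False using \<delta> by simp
    qed
    \<comment> \<open>Emptying a set instead of dropping it keeps both covers indexed by the
      naturals; as \<open>0 < d\<close>, the emptied sets cost nothing, and each index is charged at
      most once.\<close>
    let ?CA = "\<lambda>i. if C i \<inter> A = {} then {} else C i"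
    let ?CB = "\<lambda>i. if C i \<inter> B = {} then {} else C i"
    have "A \<subseteq> (\<Union>i. ?CA i)" "B \<subseteq> (\<Union>i. ?CB i)" using C(1) by (fastforce split: if_splits)+
    then have "hausdorff_pre d \<delta> A + hausdorff_pre d \<delta> B \<le> (\<Sum>i. ?w (?CA i)) + (\<Sum>i. ?w (?CB i))"
      using C \<delta> by (intro add_mono hausdorff_pre_le_cover) auto
    also have "\<dots> = (\<Sum>i. ?w (?CA i) + ?w (?CB i))"
      by (intro suminf_add) auto
    also have "\<dots> \<le> (\<Sum>i. ?w (C i))"
      using disj d by (intro suminf_le) (auto simp: zero_power)
    finally show "hausdorff_pre d \<delta> A + hausdorff_pre d \<delta> B \<le> (\<Sum>i. ?w (C i))" .
  qed
  have "hausdorff_outer d A + hausdorff_outer d B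
      = (SUP \<delta>\<in>{0<..}. hausdorff_pre d \<delta> A + hausdorff_pre d \<delta> B)"
    unfolding hausdorff_outer_def
  proof (rule SUP_add_directed_ennreal[symmetric])
    fix i j :: real assume "i \<in> {0<..}" "j \<in> {0<..}"
    then show "\<exists>k\<in>{0<..}. hausdorff_pre d i A + hausdorff_pre d j B \<le> hausdorff_pre d k A + hausdorff_pre d k B"
      by (intro bexI[of _ "min i j"] add_mono hausdorff_pre_antimono) auto
  qed
  also have "\<dots> \<le> hausdorff_outer d (A \<union> B)"
  proof (rule SUP_least)
    fix \<delta> :: real assume "\<delta> \<in> {0<..}"
    then have "hausdorff_pre d \<delta> A + hausdorff_pre d \<delta> B
        \<le> hausdorff_pre d (min \<delta> (g/2)) A + hausdorff_pre d (min \<delta> (g/2)) B"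
      by (intro add_mono hausdorff_pre_antimono) auto
    also have "\<dots> \<le> hausdorff_pre d (min \<delta> (g/2)) (A \<union> B)"
      using g \<open>\<delta> \<in> {0<..}\<close> by (intro small) auto
    also have "\<dots> \<le> hausdorff_outer d (A \<union> B)"
      unfolding hausdorff_outer_def using g \<open>\<delta> \<in> {0<..}\<close> by (intro SUP_upper) auto
    finally show "hausdorff_pre d \<delta> A + hausdorff_pre d \<delta> B \<le> hausdorff_outer d (A \<union> B)" .
  qed
  finally show ?thesis .
qed

text \<open>Caratheodory's argument for metric outer measures. The points of \<open>A\<close> off
  \<open>F\<close> lie in \<open>An n\<close>, at distance at least 1/(n+1) from \<open>F\<close>,
  or in one of the shells \<open>R k\<close> with k at least n. Separation gives additivity for
  \<open>F\<close> and \<open>An n\<close>, and the shells beyond n contribute the tail of a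
  convergent series.\<close>

lemma closed_in_hausdorff_lambda_system:
  fixes F :: "'a::metric_space set"
  assumes d: "0 < d" and F: "closed F"
  shows "hausdorff_outer d (F \<inter> A) + hausdorff_outer d ((UNIV - F) \<inter> A) = hausdorff_outer d A"
proof (rule antisym)
  show "hausdorff_outer d A \<le> hausdorff_outer d (F \<inter> A) + hausdorff_outer d ((UNIV - F) \<inter> A)"
    using hausdorff_outer_Un[OF d, of "F \<inter> A" "(UNIV - F) \<inter> A"]
    by (simp add: Int_Un_distrib2[symmetric])
next
  show "hausdorff_outer d (F \<inter> A) + hausdorff_outer d ((UNIV - F) \<inter> A) \<le> hausdorff_outer d A"
  proof (cases "F = {}")
    case True
    then show ?thesis using d by (simp add: hausdorff_outer_empty)
  next
    case False
    let ?\<mu> = "hausdorff_outer d :: 'a set \<Rightarrow> ennreal"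
    define An where "An n = {x\<in>A. 1 / (real n + 1) \<le> infdist x F}" for n
    define R where "R n = {x\<in>A. 1 / (real n + 2) \<le> infdist x F \<and> infdist x F < 1 / (real n + 1)}" for n
    have An_sep: "?\<mu> (F \<inter> A) + ?\<mu> (An n) \<le> ?\<mu> A" for n
    proof -
      have "?\<mu> (F \<inter> A) + ?\<mu> (An n) \<le> ?\<mu> ((F \<inter> A) \<union> An n)"
      proof (rule hausdorff_outer_separated[OF d])
        show "0 < 1 / (real n + 1)" by simp
        fix x y assume "x \<in> F \<inter> A" "y \<in> An n"
        then show "1 / (real n + 1) \<le> dist x y"
          using infdist_le[of x F y] by (auto simp: An_def dist_commute)
      qed
      also have "\<dots> \<le> ?\<mu> A" by (intro hausdorff_outer_mono) (auto simp: An_def)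
      finally show ?thesis .
    qed
    have R_sep: "1 / (real m + 2) - 1 / (real m + 3) \<le> dist x y" if "x \<in> R m" "y \<in> R n" "m + 2 \<le> n" for x y m n
    proof -
      have "infdist x F \<le> infdist y F + dist x y" by (rule infdist_triangle)
      moreover have "infdist y F < 1 / (real n + 1)" "1 / (real m + 2) \<le> infdist x F"
        using that by (auto simp: R_def)
      moreover have "1 / (real n + 1) \<le> 1 / (real m + 3)"
        using that by (intro divide_left_mono) auto
      ultimately show ?thesis by linarith
    qed
    \<comment> \<open>Adjacent shells may touch, but shells of equal parity have a gap between them,
      so their measures add up. The gaps shrink with the index; the one belonging to the newest
      shell bounds all earlier ones from below.\<close>
    have parity: "(\<Sum>i<n. ?\<mu> (R (2 * i + c))) \<le> ?\<mu> (\<Union>i<n. R (2 * i + c))" for n c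
    proof (induction n)
      case (Suc n)
      have "(\<Sum>i<Suc n. ?\<mu> (R (2 * i + c))) \<le> ?\<mu> (\<Union>i<n. R (2 * i + c)) + ?\<mu> (R (2 * n + c))"
        using Suc by (simp add: add_right_mono)
      also have "\<dots> \<le> ?\<mu> ((\<Union>i<n. R (2 * i + c)) \<union> R (2 * n + c))"
      proof (rule hausdorff_outer_separated[OF d])
        show "0 < 1 / (real (2*n+c) + 2) - 1 / (real (2*n+c) + 3)"
          by (simp add: divide_strict_left_mono)
        fix x y assume "x \<in> (\<Union>i<n. R (2 * i + c))" "y \<in> R (2 * n + c)"
        then obtain i where i: "i < n" "x \<in> R (2 * i + c)" by auto
        then have "1 / (real (2*i+c) + 2) - 1 / (real (2*i+c) + 3) \<le> dist x y"
          using \<open>y \<in> _\<close> by (intro R_sep) auto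
        moreover have "1 / (real (2*n+c) + 2) - 1 / (real (2*n+c) + 3) = 1 / ((real (2*n+c) + 2) * (real (2*n+c) + 3))"
          "1 / (real (2*i+c) + 2) - 1 / (real (2*i+c) + 3) = 1 / ((real (2*i+c) + 2) * (real (2*i+c) + 3))"
          by (simp_all add: field_simps)
        moreover have "1 / ((real (2*n+c) + 2) * (real (2*n+c) + 3)) \<le> 1 / ((real (2*i+c) + 2) * (real (2*i+c) + 3))"
          using i by (intro divide_left_mono mult_mono mult_pos_pos) auto
        ultimately show "1 / (real (2*n+c) + 2) - 1 / (real (2*n+c) + 3) \<le> dist x y" by linarith
      qed
      also have "(\<Union>i<n. R (2 * i + c)) \<union> R (2 * n + c) = (\<Union>i<Suc n. R (2 * i + c))"
        by (auto simp: lessThan_Suc)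
      finally show ?case .
    qed (simp add: hausdorff_outer_empty[OF d])
    have parity': "(\<Sum>i<n. ?\<mu> (R (2 * i + c))) \<le> ?\<mu> A" for n c
      by (rule order_trans[OF parity]) (auto intro!: hausdorff_outer_mono simp: R_def)
    have partial: "(\<Sum>i<n. ?\<mu> (R i)) \<le> 2 * ?\<mu> A" for n
    proof -
      have "(\<Sum>i<n. ?\<mu> (R i)) \<le> (\<Sum>i<2*n. ?\<mu> (R i))" by (intro sum_mono2) auto
      also have "\<dots> = (\<Sum>i<n. ?\<mu> (R (2 * i))) + (\<Sum>i<n. ?\<mu> (R (2 * i + 1)))"
        by (induction n) (auto simp: algebra_simps)
      also have "\<dots> \<le> ?\<mu> A + ?\<mu> A" using parity'[where n=n and c=0] parity'[where n=n and c=1] by (intro add_mono) auto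
      finally show ?thesis by (simp add: mult_2)
    qed
    show ?thesis
    proof (rule ennreal_le_epsilon)
      fix e :: real assume fin: "?\<mu> A < top" and e: "0 < e"
      have "(\<Sum>i. ?\<mu> (R i)) \<le> 2 * ?\<mu> A"
        using partial by (intro suminf_le_const) auto
      then have sumfin: "(\<Sum>i. ?\<mu> (R i)) \<noteq> top" using fin by (auto simp: ennreal_mult_eq_top_iff top_unique)
      define r where "r i = enn2real (?\<mu> (R i))" for i
      have r: "?\<mu> (R i) = ennreal (r i)" for i
        using sumfin ennreal_suminf_lessD[of "\<lambda>i. ?\<mu> (R i)" top i] unfolding r_def
        by (simp add: less_top)
      have r0: "0 \<le> r i" for i by (simp add: r_def)
      have sr: "summable r" using sumfin r0 unfolding r by (rule_tac summable_suminf_not_top)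
      from suminf_exist_split[OF e this] obtain n where "norm (\<Sum>i. r (i + n)) < e" by blast
      moreover have "(\<Sum>i. ?\<mu> (R (i + n))) = ennreal (\<Sum>i. r (i + n))"
        unfolding r using sr r0 by (intro suminf_ennreal2) (auto simp: summable_iff_shift)
      ultimately have n: "(\<Sum>i. ?\<mu> (R (i + n))) \<le> ennreal e"
        by (auto intro: ennreal_leI)
      have "(UNIV - F) \<inter> A \<subseteq> An n \<union> (\<Union>i. R (i + n))"
      proof
        fix x assume x: "x \<in> (UNIV - F) \<inter> A"
        then have pos: "0 < infdist x F"
          using in_closed_iff_infdist_zero[OF F False, of x] infdist_nonneg[of x F] by auto
        show "x \<in> An n \<union> (\<Union>i. R (i + n))"
        proof (cases "x \<in> An n")
          case False
          then have lt: "infdist x F < 1 / (real n + 1)" using x by (auto simp: An_def)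
          define t where "t = 1 / infdist x F"
          have t: "real n + 1 < t" using lt pos by (simp add: t_def field_simps)
          \<comment> \<open>Membership in \<open>R k\<close> means k + 1 < t \<le> k + 2 for t = 1 /
            \<open>infdist x F\<close>, which fixes k.\<close>
          define k where "k = nat (\<lceil>t\<rceil> - 2)"
          have "\<lceil>t\<rceil> \<ge> int n + 2" using t by linarith
          then have k: "real k = of_int \<lceil>t\<rceil> - 2" "n \<le> k" by (auto simp: k_def)
          have "t \<le> real k + 2" "real k + 1 < t" using k(1) by linarith+
          then have "1 / (real k + 2) \<le> infdist x F" "infdist x F < 1 / (real k + 1)"
            using pos by (auto simp: t_def field_simps)
          then have "x \<in> R (k - n + n)" using x k(2) by (auto simp: R_def)
          then show ?thesis by blast
        qed auto
      qed
      then have "?\<mu> ((UNIV - F) \<inter> A) \<le> ?\<mu> (An n \<union> (\<Union>i. R (i + n)))"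
        by (rule hausdorff_outer_mono)
      also have "\<dots> \<le> ?\<mu> (An n) + ?\<mu> (\<Union>i. R (i + n))" by (rule hausdorff_outer_Un[OF d])
      also have "\<dots> \<le> ?\<mu> (An n) + ennreal e"
        using hausdorff_outer_countably_subadditive[of d "\<lambda>i. R (i + n)"] n by (intro add_left_mono) auto
      finally have "?\<mu> (F \<inter> A) + ?\<mu> ((UNIV - F) \<inter> A) \<le> ?\<mu> (F \<inter> A) + ?\<mu> (An n) + ennreal e"
        by (simp add: add_left_mono add.assoc)
      also have "\<dots> \<le> ?\<mu> A + ennreal e" using An_sep by (intro add_right_mono)
      finally show "?\<mu> (F \<inter> A) + ?\<mu> ((UNIV - F) \<inter> A) \<le> ?\<mu> A + ennreal e" .
    qed
  qed
qed

text \<open>This is what makes \<open>hausdorff_measure\<close> agree with the outer measure on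
  Borel sets: \<open>measure_of\<close> falls back to the zero measure when it is not given a
  measure.\<close>

lemma hausdorff_measure_space:
  assumes "0 < d"
  shows "measure_space UNIV (sets borel) (hausdorff_outer d :: 'a::metric_space set \<Rightarrow> ennreal)"
proof -
  interpret sigma_algebra "UNIV::'a set" "Pow UNIV" by (rule sigma_algebra_Pow)
  let ?L = "lambda_system UNIV (Pow UNIV) (hausdorff_outer d :: 'a set \<Rightarrow> ennreal)"
  have ms: "measure_space UNIV ?L (hausdorff_outer d)"
    by (rule caratheodory_lemma[OF hausdorff_outer_measure_space[OF assms]])
  then interpret L: sigma_algebra UNIV ?L by (simp add: measure_space_def)
  have "sets (borel :: 'a measure) = sigma_sets UNIV (Collect closed)"
    by (simp add: borel_eq_closed)
  also have "\<dots> \<subseteq> ?L"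
    using closed_in_hausdorff_lambda_system[OF assms]
    by (intro L.sigma_sets_subset) (auto simp: lambda_system_def)
  finally have sub: "sets (borel :: 'a measure) \<subseteq> ?L" .
  show ?thesis
    using ms sub sets.sigma_algebra_axioms[of "borel :: 'a measure"]
    unfolding measure_space_def positive_def countably_additive_def
    by (auto dest: subset_trans[OF _ sub])
qed

lemma sets_hausdorff_measure [simp, measurable_cong]:
  "sets (hausdorff_measure d :: 'a::metric_space measure) = sets borel"
  unfolding hausdorff_measure_def
  using sets.sigma_sets_eq[of "borel :: 'a measure"] by simp

lemma emeasure_hausdorff_measure:
  fixes A :: "'a::metric_space set"
  assumes "0 < d" "A \<in> sets borel"
  shows "emeasure (hausdorff_measure d) A = hausdorff_outer d A"
  using hausdorff_measure_space[OF assms(1), where 'a='a] assms(2)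
  unfolding hausdorff_measure_def measure_space_def
  by (intro emeasure_measure_of_sigma) auto

section \<open>Lipschitz images and comparison with Lebesgue measure\<close>

lemma diameter_leI:
  fixes S :: "'a::metric_space set"
  assumes "0 \<le> t" "\<And>x y. x \<in> S \<Longrightarrow> y \<in> S \<Longrightarrow> dist x y \<le> t"
  shows "bounded S" "diameter S \<le> t"
proof -
  show "bounded S" using assms(2) unfolding bounded_two_points by blast
  show "diameter S \<le> t"
    using assms by (cases "S = {}") (auto simp: diameter_def intro!: cSUP_least)
qed

lemma hausdorff_outer_lipschitz_image:
  fixes f :: "'a::metric_space \<Rightarrow> 'b::metric_space"
  assumes d: "0 < d" and L: "0 < L" and f: "L-lipschitz_on A f"
  shows "hausdorff_outer d (f ` A) \<le> ennreal (L ^ d) * hausdorff_outer d A"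
  unfolding hausdorff_outer_def[of d "f ` A"]
proof (rule SUP_least)
  fix \<delta> :: real assume \<delta>: "\<delta> \<in> {0<..}"
  let ?c = "L ^ d"
  have c: "0 < ?c" using L by simp
  \<comment> \<open>The factor \<open>L ^ d\<close> is divided out first, so that the infimum over
    covers of \<open>A\<close> stands alone on the right and can be bounded cover by cover.\<close>
  have "ennreal (1 / ?c) * hausdorff_pre d \<delta> (f ` A) \<le> hausdorff_pre d (\<delta> / L) A"
    unfolding hausdorff_pre_def[of d "\<delta> / L"]
  proof (rule INF_greatest, safe)
    fix C :: "nat \<Rightarrow> 'a set"
    assume C: "A \<subseteq> \<Union> (range C)" "\<forall>i. bounded (C i) \<and> diameter (C i) \<le> \<delta> / L"
    have bd: "bounded (f ` (C i \<inter> A))" and diam: "diameter (f ` (C i \<inter> A)) \<le> L * diameter (C i)" for i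
    proof -
      have *: "dist (f x) (f y) \<le> L * diameter (C i)" if "x \<in> C i \<inter> A" "y \<in> C i \<inter> A" for x y
        using lipschitz_onD[OF f, of x y] that diameter_bounded_bound[of "C i" x y] C(2) L
        by (auto intro: order_trans mult_left_mono)
      have "0 \<le> L * diameter (C i)" using C(2) diameter_ge_0[of "C i"] L by simp
      from diameter_leI[OF this, of "f ` (C i \<inter> A)"] *
      show "bounded (f ` (C i \<inter> A))" "diameter (f ` (C i \<inter> A)) \<le> L * diameter (C i)" by auto
    qed
    have "hausdorff_pre d \<delta> (f ` A) \<le> (\<Sum>i. ennreal (unit_ball_vol (real d) * (diameter (f ` (C i \<inter> A)) / 2) ^ d))"
    proof (rule hausdorff_pre_le_cover)
      show "f ` A \<subseteq> (\<Union>i. f ` (C i \<inter> A))" using C(1) by fastforce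
      show "diameter (f ` (C i \<inter> A)) \<le> \<delta>" for i
      proof -
        have "L * diameter (C i) \<le> \<delta>" using C(2) L by (simp add: field_simps)
        then show ?thesis using diam[of i] by linarith
      qed
    qed (rule bd)
    also have "\<dots> \<le> (\<Sum>i. ennreal ?c * ennreal (unit_ball_vol (real d) * (diameter (C i) / 2) ^ d))"
    proof (rule suminf_le)
      fix i
      have "(diameter (f ` (C i \<inter> A)) / 2) ^ d \<le> (L * (diameter (C i) / 2)) ^ d"
        using diam[of i] diameter_ge_0[OF bd, of i] by (intro power_mono) auto
      then have "unit_ball_vol (real d) * (diameter (f ` (C i \<inter> A)) / 2) ^ d
          \<le> ?c * (unit_ball_vol (real d) * (diameter (C i) / 2) ^ d)"
        unfolding power_mult_distrib by (simp only: mult.left_commute[of "L ^ d"]) (rule mult_left_mono, auto)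
      then show "ennreal (unit_ball_vol (real d) * (diameter (f ` (C i \<inter> A)) / 2) ^ d)
          \<le> ennreal ?c * ennreal (unit_ball_vol (real d) * (diameter (C i) / 2) ^ d)"
        using c by (subst ennreal_mult'[symmetric]) (auto intro: ennreal_leI)
    qed auto
    also have "\<dots> = ennreal ?c * (\<Sum>i. ennreal (unit_ball_vol (real d) * (diameter (C i) / 2) ^ d))"
      by simp
    finally have "ennreal (1 / ?c) * hausdorff_pre d \<delta> (f ` A)
        \<le> ennreal (1 / ?c) * (ennreal ?c * (\<Sum>i. ennreal (unit_ball_vol (real d) * (diameter (C i) / 2) ^ d)))"
      by (rule mult_left_mono) simp
    also have "\<dots> = (\<Sum>i. ennreal (unit_ball_vol (real d) * (diameter (C i) / 2) ^ d))"
      using c L by (simp add: mult.assoc[symmetric] ennreal_mult'[symmetric])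
    finally show "ennreal (1 / ?c) * hausdorff_pre d \<delta> (f ` A)
        \<le> (\<Sum>i. ennreal (unit_ball_vol (real d) * (diameter (C i) / 2) ^ d))" .
  qed
  also have "\<dots> \<le> hausdorff_outer d A"
    unfolding hausdorff_outer_def using \<delta> L by (intro SUP_upper) auto
  finally have "ennreal ?c * (ennreal (1 / ?c) * hausdorff_pre d \<delta> (f ` A)) \<le> ennreal ?c * hausdorff_outer d A"
    by (rule mult_left_mono) simp
  then show "hausdorff_pre d \<delta> (f ` A) \<le> ennreal ?c * hausdorff_outer d A"
    using c L by (simp add: mult.assoc[symmetric] ennreal_mult'[symmetric])
qed

text \<open>A set of diameter \<open>t\<close> lies in a ball of radius \<open>t\<close>; the factor \<open>2 ^ d\<close> avoids the isodiametric inequality.\<close>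
lemma lborel_le_hausdorff_outer:
  fixes A :: "'a::euclidean_space set"
  assumes A: "A \<in> sets borel"
  shows "emeasure lborel A \<le> ennreal (2 ^ DIM('a)) * hausdorff_outer (DIM('a)) A"
proof -
  let ?d = "DIM('a)"
  \<comment> \<open>Any single scale bounds the supremum from below, so the scale 1 is
    enough.\<close>
  have "ennreal (1 / 2 ^ ?d) * emeasure lborel A \<le> hausdorff_pre ?d 1 A"
    unfolding hausdorff_pre_def
  proof (rule INF_greatest, safe)
    fix C :: "nat \<Rightarrow> 'a set"
    assume C: "A \<subseteq> \<Union> (range C)" "\<forall>i. bounded (C i) \<and> diameter (C i) \<le> 1"
    have "\<exists>B. closed B \<and> C i \<subseteq> B \<and>
        emeasure lborel B \<le> ennreal (2 ^ ?d) * ennreal (unit_ball_vol (real ?d) * (diameter (C i) / 2) ^ ?d)" for i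
    proof (cases "C i = {}")
      case True
      then show ?thesis by (intro exI[of _ "{}"]) auto
    next
      case False
      then obtain x where x: "x \<in> C i" by auto
      have "0 \<le> diameter (C i)" using C(2) by (simp add: diameter_ge_0)
      moreover have "C i \<subseteq> cball x (diameter (C i))"
        using diameter_bounded_bound[of "C i" x] x C(2) by auto
      ultimately show ?thesis
        by (intro exI[of _ "cball x (diameter (C i))"])
          (simp add: emeasure_cball power_divide ennreal_mult'[symmetric])
    qed
    then obtain B where B: "\<And>i. closed (B i)" "\<And>i. C i \<subseteq> B i"
      "\<And>i. emeasure lborel (B i) \<le> ennreal (2 ^ ?d) * ennreal (unit_ball_vol (real ?d) * (diameter (C i) / 2) ^ ?d)"
      by metis
    have "emeasure lborel A \<le> emeasure lborel (\<Union>i. B i)"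
      using C(1) B(1,2) by (intro emeasure_mono) (force intro: borel_closed)+
    also have "\<dots> \<le> (\<Sum>i. emeasure lborel (B i))"
      using B(1) by (intro emeasure_subadditive_countably) (auto intro: borel_closed)
    also have "\<dots> \<le> (\<Sum>i. ennreal (2 ^ ?d) * ennreal (unit_ball_vol (real ?d) * (diameter (C i) / 2) ^ ?d))"
      by (intro suminf_le B(3)) auto
    also have "\<dots> = ennreal (2 ^ ?d) * (\<Sum>i. ennreal (unit_ball_vol (real ?d) * (diameter (C i) / 2) ^ ?d))"
      by simp
    finally have "ennreal (1 / 2 ^ ?d) * emeasure lborel A
        \<le> ennreal (1 / 2 ^ ?d) * (ennreal (2 ^ ?d) * (\<Sum>i. ennreal (unit_ball_vol (real ?d) * (diameter (C i) / 2) ^ ?d)))"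
      by (rule mult_left_mono) simp
    then show "ennreal (1 / 2 ^ ?d) * emeasure lborel A
        \<le> (\<Sum>i. ennreal (unit_ball_vol (real ?d) * (diameter (C i) / 2) ^ ?d))"
      by (simp add: mult.assoc[symmetric] ennreal_mult'[symmetric])
  qed
  also have "\<dots> \<le> hausdorff_outer ?d A"
    unfolding hausdorff_outer_def by (intro SUP_upper) auto
  finally have "ennreal (2 ^ ?d) * (ennreal (1 / 2 ^ ?d) * emeasure lborel A) \<le> ennreal (2 ^ ?d) * hausdorff_outer ?d A"
    by (rule mult_left_mono) simp
  then show ?thesis by (simp add: mult.assoc[symmetric] ennreal_mult'[symmetric])
qed

section \<open>Maximal separated sets and nets\<close>

lemma maximal_pairwise_subset:
  fixes far :: "'a \<Rightarrow> 'a \<Rightarrow> bool"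
  assumes sym: "\<And>x y. far x y \<Longrightarrow> far y x"
    and bound: "\<And>P. finite P \<Longrightarrow> P \<subseteq> S \<Longrightarrow> pairwise far P \<Longrightarrow> card P \<le> B"
  obtains P where "finite P" "P \<subseteq> S" "pairwise far P" "\<And>x. x \<in> S \<Longrightarrow> x \<in> P \<or> (\<exists>p\<in>P. \<not> far p x)"
proof -
  let ?Q = "\<lambda>P. finite P \<and> P \<subseteq> S \<and> pairwise far P"
  \<comment> \<open>The uniform bound yields a set of greatest cardinality, and such a set cannot be
    extended. Balls, spheres and binary codes all obtain their nets in this way.\<close>
  have "\<exists>P. ?Q P \<and> (\<forall>P'. ?Q P' \<longrightarrow> card P' \<le> card P)"
    using bound by (intro ex_has_greatest_nat[of ?Q "{}" card "Suc B"]) (auto simp: less_Suc_eq_le)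
  then obtain P where P: "?Q P" and max: "\<And>P'. ?Q P' \<Longrightarrow> card P' \<le> card P" by blast
  have "x \<in> P \<or> (\<exists>p\<in>P. \<not> far p x)" if "x \<in> S" for x
  proof (rule ccontr)
    assume c: "\<not> ?thesis"
    then have "?Q (insert x P)" using P that sym by (auto simp: pairwise_insert)
    then have "card (insert x P) \<le> card P" by (rule max)
    then show False using c P by simp
  qed
  then show ?thesis using that P by blast
qed

lemma compact_separated_card_bound:
  fixes S :: "'a::metric_space set"
  assumes "compact S" "0 < r"
  obtains B where "\<And>P. finite P \<Longrightarrow> P \<subseteq> S \<Longrightarrow> pairwise (\<lambda>x y. r \<le> dist x y) P \<Longrightarrow> card P \<le> B"
proof -
  obtain K where K: "finite K" "S \<subseteq> (\<Union>x\<in>K. ball x (r/2))"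
    using compactE_image[OF assms(1), of S "\<lambda>x. ball x (r/2)"] assms(2) by (metis UN_I centre_in_ball half_gt_zero open_ball subsetI)
  have "card P \<le> card K" if P: "P \<subseteq> S" "pairwise (\<lambda>x y. r \<le> dist x y) P" for P
  proof -
    have "\<forall>p\<in>P. \<exists>k\<in>K. dist k p < r/2" using P(1) K(2) by fastforce
    then obtain g where g: "\<And>p. p \<in> P \<Longrightarrow> g p \<in> K \<and> dist (g p) p < r/2" by metis
    have "inj_on g P"
    proof (rule inj_onI, rule ccontr)
      fix p q assume pq: "p \<in> P" "q \<in> P" "g p = g q" "p \<noteq> q"
      then have "dist p q < r" using g[of p] g[of q] dist_triangle_half_r[of "g p" p r q]
        by (simp add: dist_commute)
      moreover have "r \<le> dist p q" using P(2) pq unfolding pairwise_def by blast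
      ultimately show False by simp
    qed
    then show ?thesis using g K(1) by (intro card_inj_on_le) auto
  qed
  then show ?thesis using that by blast
qed

text \<open>Volume packing: balls of radius h/2 about the points of a separated set are disjoint and
  lie in the ball of radius s + h/2.\<close>

lemma cball_net:
  fixes s h :: real
  assumes "0 < s" "0 < h"
  obtains P :: "'a::euclidean_space set" where "finite P" "P \<subseteq> cball 0 s" "cball 0 s \<subseteq> (\<Union>p\<in>P. ball p h)"
    "real (card P) * h ^ DIM('a) \<le> (2 * s + h) ^ DIM('a)"
proof -
  let ?d = "DIM('a)"
  have vol: "real (card P) * h ^ ?d \<le> (2 * s + h) ^ ?d"
    if P: "finite P" "P \<subseteq> cball 0 s" "pairwise (\<lambda>x y. h \<le> dist x y) P" for P :: "'a set"
  proof -
    have "(\<Sum>p\<in>P. measure lborel (ball p (h/2))) = measure lborel (\<Union>p\<in>P. ball p (h/2))"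
    proof (rule measure_finite_Union[symmetric])
      show "disjoint_family_on (\<lambda>p. ball p (h / 2)) P"
        unfolding disjoint_family_on_def
      proof (intro ballI impI)
        fix p q assume "p \<in> P" "q \<in> P" "p \<noteq> q"
        then have "h \<le> dist p q" using P(3) by (auto simp: pairwise_def)
        then show "ball p (h/2) \<inter> ball q (h/2) = {}" by (intro disjoint_ballI) auto
      qed
    qed (use P in \<open>auto simp: emeasure_ball assms(2) less_imp_le\<close>)
    also have "\<dots> \<le> measure lborel (ball (0::'a) (s + h/2))"
    proof (rule measure_mono_fmeasurable)
      show "(\<Union>p\<in>P. ball p (h/2)) \<subseteq> ball 0 (s + h/2)"
      proof
        fix x assume "x \<in> (\<Union>p\<in>P. ball p (h/2))"
        then obtain p where "p \<in> P" "dist p x < h/2" by auto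
        moreover have "dist 0 p \<le> s" using P(2) \<open>p \<in> P\<close> by auto
        ultimately show "x \<in> ball 0 (s + h/2)" using dist_triangle[of 0 x p] by simp
      qed
    qed (use P in \<open>auto simp: fmeasurable_def emeasure_ball assms less_imp_le add_nonneg_nonneg\<close>)
    finally have "real (card P) * (unit_ball_vol (real ?d) * (h/2) ^ ?d) \<le> unit_ball_vol (real ?d) * (s + h/2) ^ ?d"
      using assms by (simp add: content_ball)
    then have "unit_ball_vol (real ?d) * (real (card P) * (h/2) ^ ?d) \<le> unit_ball_vol (real ?d) * (s + h/2) ^ ?d"
      by (simp add: mult.left_commute)
    then have "real (card P) * (h/2) ^ ?d \<le> (s + h/2) ^ ?d"
      by (subst (asm) mult_le_cancel_left_pos) auto
    moreover have "(s + h/2) ^ ?d = (2 * s + h) ^ ?d / 2 ^ ?d" by (simp add: power_divide[symmetric] add_divide_distrib)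
    ultimately show ?thesis by (simp add: power_divide field_simps)
  qed
  obtain B where B: "\<And>P. finite P \<Longrightarrow> P \<subseteq> cball (0::'a) s \<Longrightarrow> pairwise (\<lambda>x y. h \<le> dist x y) P \<Longrightarrow> card P \<le> B"
    using compact_separated_card_bound[OF compact_cball assms(2)] by metis
  obtain P where "finite P" "P \<subseteq> cball (0::'a) s" "pairwise (\<lambda>x y. h \<le> dist x y) P"
    "\<And>x. x \<in> cball 0 s \<Longrightarrow> x \<in> P \<or> (\<exists>p\<in>P. \<not> h \<le> dist p x)"
    by (rule maximal_pairwise_subset[of "\<lambda>x y. h \<le> dist x y", OF _ B]) (auto simp: dist_commute)
  then show ?thesis using that[of P] vol[of P] assms(2) by (force simp: not_le)
qed

text \<open>A net of mesh h has at most ((2 s + h) / h)^d points, and the image of each of its balls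
  weighs at most \<omega> (L h)^d, so h cancels. The constant is not sharp: counting balls of a net
  costs the factor 2 + \<eta> per dimension.\<close>

lemma hausdorff_outer_lipschitz_cball:
  fixes f :: "'a::euclidean_space \<Rightarrow> 'b::metric_space"
  assumes s: "0 < s" and L: "0 < L" and \<eta>: "0 < \<eta>" and f: "L-lipschitz_on (cball 0 s) f"
  shows "hausdorff_outer (DIM('a)) (f ` cball 0 s) \<le> ennreal (unit_ball_vol (DIM('a)) * (L * (2 + \<eta>) * s) ^ DIM('a))"
  unfolding hausdorff_outer_def
proof (rule SUP_least)
  fix \<delta> :: real assume \<delta>: "\<delta> \<in> {0<..}"
  let ?d = "DIM('a)"
  \<comment> \<open>The first bound turns 2 s + h into at most (2 + \<eta>) s, the second keeps the
    image pieces below diameter \<delta>.\<close>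
  define h where "h = min (\<eta> * s) (\<delta> / (2 * L))"
  have h: "0 < h" "h \<le> \<eta> * s" "L * (2 * h) \<le> \<delta>"
    using s L \<eta> \<delta> by (auto simp: h_def min_def field_simps)
  obtain P :: "'a set" where P: "finite P" "cball 0 s \<subseteq> (\<Union>p\<in>P. ball p h)"
    "real (card P) * h ^ ?d \<le> (2 * s + h) ^ ?d"
    using cball_net[OF s h(1)] by metis
  let ?C = "\<lambda>p. f ` (ball p h \<inter> cball 0 s)"
  have *: "dist (f x) (f y) \<le> L * (2 * h)" if "x \<in> ball p h \<inter> cball 0 s" "y \<in> ball p h \<inter> cball 0 s" for x y p
  proof -
    have "dist x y \<le> 2 * h" using that dist_triangle_half_r[of p x "2*h" y] by auto
    then show ?thesis using lipschitz_onD[OF f, of x y] that L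
      by (auto intro: order_trans mult_left_mono)
  qed
  have "0 \<le> L * (2 * h)" using L h by simp
  have bd: "bounded (?C p)" and diam: "diameter (?C p) \<le> L * (2 * h)" for p
    by (rule diameter_leI[OF \<open>0 \<le> L * (2 * h)\<close>], blast intro: *)+
  have "hausdorff_pre ?d \<delta> (f ` cball 0 s) \<le> (\<Sum>p\<in>P. ennreal (unit_ball_vol (real ?d) * (diameter (?C p) / 2) ^ ?d))"
  proof (rule hausdorff_pre_le_finite_cover)
    show "f ` cball 0 s \<subseteq> (\<Union>p\<in>P. ?C p)" using P(2) by blast
    show "diameter (?C p) \<le> \<delta>" for p using diam[of p] h by linarith
  qed (use \<delta> P bd in auto)
  also have "\<dots> \<le> (\<Sum>p\<in>P. ennreal (unit_ball_vol (real ?d) * (L * h) ^ ?d))"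
  proof (intro sum_mono ennreal_leI mult_left_mono power_mono)
    show "diameter (?C p) / 2 \<le> L * h" for p using diam[of p] by simp
    show "0 \<le> diameter (?C p) / 2" for p using diameter_ge_0[OF bd] by simp
  qed auto
  also have "\<dots> = ennreal (real (card P) * (unit_ball_vol (real ?d) * (L * h) ^ ?d))"
    using L h by (simp add: ennreal_mult ennreal_of_nat_eq_real_of_nat)
  also have "real (card P) * (unit_ball_vol (real ?d) * (L * h) ^ ?d)
      = unit_ball_vol (real ?d) * L ^ ?d * (real (card P) * h ^ ?d)"
    by (simp add: power_mult_distrib)
  also have "ennreal \<dots> \<le> ennreal (unit_ball_vol (real ?d) * (L * (2 + \<eta>) * s) ^ ?d)"
  proof (rule ennreal_leI)
    have "real (card P) * h ^ ?d \<le> ((2 + \<eta>) * s) ^ ?d"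
      using P(3) h s by (rule_tac order_trans[OF P(3) power_mono]) (auto simp: algebra_simps)
    then have "unit_ball_vol (real ?d) * L ^ ?d * (real (card P) * h ^ ?d)
        \<le> unit_ball_vol (real ?d) * L ^ ?d * ((2 + \<eta>) * s) ^ ?d"
      using L by (intro mult_left_mono) auto
    also have "\<dots> = unit_ball_vol (real ?d) * (L * (2 + \<eta>) * s) ^ ?d"
      by (simp add: power_mult_distrib)
    finally show "unit_ball_vol (real ?d) * L ^ ?d * (real (card P) * h ^ ?d)
        \<le> unit_ball_vol (real ?d) * (L * (2 + \<eta>) * s) ^ ?d" .
  qed
  finally show "hausdorff_pre ?d \<delta> (f ` cball 0 s) \<le> ennreal (unit_ball_vol (real ?d) * (L * (2 + \<eta>) * s) ^ ?d)" .
qed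

section \<open>Round spheres\<close>

text \<open>The reflection in the hyperplane orthogonal to a - b. It carries any point of a sphere
  to the pole, where a neighbourhood is an explicit graph, and it is its own inverse.\<close>

lemma householder_reflection_exists:
  fixes a b :: "'a::real_inner"
  assumes "norm a = norm b"
  obtains f where "linear f" "\<And>x. norm (f x) = norm x" "\<And>x. f (f x) = x" "f a = b"
proof (cases "a = b")
  case True
  then show ?thesis using that[of "\<lambda>x. x"] by (simp add: linear_ident)
next
  case False
  define u where "u = a - b"
  have u: "u \<bullet> u \<noteq> 0" using False by (simp add: u_def)
  define f where "f x = x - (2 * (x \<bullet> u) / (u \<bullet> u)) *\<^sub>R u" for x
  have "linear f"
    by (rule linearI) (auto simp: f_def inner_left_distrib algebra_simps add_divide_distrib)
  moreover have "norm (f x) = norm x" for x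
  proof -
    have "f x \<bullet> f x = x \<bullet> x"
      using u by (simp add: f_def inner_diff_left inner_diff_right inner_commute[of u x] field_simps power2_eq_square)
    then show ?thesis by (simp add: norm_eq_sqrt_inner)
  qed
  moreover have "f (f x) = x" for x
    using u by (simp add: f_def inner_diff_left algebra_simps add_divide_distrib[symmetric] scaleR_add_left[symmetric])
  moreover have "f a = b"
  proof -
    have "a \<bullet> a = b \<bullet> b" using assms by (metis dot_square_norm)
    then have "2 * (a \<bullet> u) = u \<bullet> u" by (simp add: u_def inner_diff_left inner_diff_right inner_commute)
    then show ?thesis using u by (simp add: f_def) (simp add: u_def)
  qed
  ultimately show ?thesis using that by blast
qed

lemma linear_norm_preserving_dist:
  assumes "linear f" "\<And>x. norm (f x) = norm x"
  shows "dist (f x) (f y) = dist x y"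
  using assms by (metis dist_norm linear_diff)

definition hemisphere_graph :: "real \<Rightarrow> 'a::real_normed_vector \<Rightarrow> 'a \<times> real" where
  "hemisphere_graph R x = (x, sqrt (R\<^sup>2 - (norm x)\<^sup>2))"

lemma norm_hemisphere_graph:
  assumes "norm x \<le> R"
  shows "norm (hemisphere_graph R x) = R"
proof -
  have "(norm x)\<^sup>2 \<le> R\<^sup>2" "0 \<le> R" using assms norm_ge_zero[of x] by (auto intro!: power_mono simp del: norm_ge_zero)
  then show ?thesis by (simp add: hemisphere_graph_def norm_Pair)
qed

lemma hemisphere_graph_fst:
  assumes "norm p = R" "0 \<le> snd p"
  shows "hemisphere_graph R (fst p) = p"
proof -
  have "R\<^sup>2 = (norm (fst p))\<^sup>2 + (snd p)\<^sup>2"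
    using assms(1) by (cases p) (auto simp: norm_Pair)
  then show ?thesis using assms(2) by (simp add: hemisphere_graph_def prod_eq_iff)
qed

lemma hemisphere_graph_near_pole:
  assumes "norm x \<le> R"
  shows "dist (0, R) (hemisphere_graph R x) \<le> 2 * norm x"
proof -
  have R: "0 \<le> R" using assms norm_ge_zero[of x] by linarith
  have "R - norm x \<le> sqrt (R\<^sup>2 - (norm x)\<^sup>2)"
    using assms by (intro real_le_rsqrt) (auto simp: power2_eq_square algebra_simps mult_right_mono)
  moreover have "sqrt (R\<^sup>2 - (norm x)\<^sup>2) \<le> R" using R by (intro real_le_lsqrt) auto
  ultimately have "\<bar>R - sqrt (R\<^sup>2 - (norm x)\<^sup>2)\<bar> \<le> norm x" by linarith
  then show ?thesis
    using norm_Pair_le[of "0 - x" "R - sqrt (R\<^sup>2 - (norm x)\<^sup>2)"]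
    by (simp add: hemisphere_graph_def dist_norm)
qed

text \<open>For the height g, |g x - g y| (g x + g y) equals the difference of the squared norms. On
  the small disc the sum of heights is at least R and the sum of norms at most R/10, so g has slope
  at most 1/10.\<close>

lemma hemisphere_graph_lipschitz:
  fixes R s :: real
  assumes "0 < R" "s \<le> R / 20"
  shows "(11/10)-lipschitz_on (cball (0::'a::real_normed_vector) s) (hemisphere_graph R)"
proof (rule lipschitz_onI)
  fix x y :: 'a assume xy: "x \<in> cball 0 s" "y \<in> cball 0 s"
  let ?g = "\<lambda>x::'a. sqrt (R\<^sup>2 - (norm x)\<^sup>2)"
  have big: "R / 2 \<le> ?g x" "(?g x)\<^sup>2 = R\<^sup>2 - (norm x)\<^sup>2" if "x \<in> cball 0 s" for x
  proof -
    have "norm x \<le> R / 2" using that assms by auto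
    then have "(norm x)\<^sup>2 \<le> (R/2)\<^sup>2" by (intro power_mono) auto
    moreover have "(R/2)\<^sup>2 + (R/2)\<^sup>2 \<le> R\<^sup>2" by (simp add: power_divide)
    ultimately have *: "(R/2)\<^sup>2 \<le> R\<^sup>2 - (norm x)\<^sup>2" by linarith
    then show "R / 2 \<le> ?g x" by (intro real_le_rsqrt)
    show "(?g x)\<^sup>2 = R\<^sup>2 - (norm x)\<^sup>2" using * order_trans[OF zero_le_power2[of "R/2"] *] by simp
  qed
  have sum: "R \<le> ?g x + ?g y" using big(1)[OF xy(1)] big(1)[OF xy(2)] by linarith
  have "\<bar>(?g x - ?g y) * (?g x + ?g y)\<bar> = \<bar>(norm y - norm x) * (norm y + norm x)\<bar>"
    using big(2)[OF xy(1)] big(2)[OF xy(2)] by (simp add: algebra_simps power2_eq_square)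
  moreover have "\<bar>?g x + ?g y\<bar> = ?g x + ?g y" using sum assms by linarith
  ultimately have "\<bar>?g x - ?g y\<bar> * (?g x + ?g y) = \<bar>norm y - norm x\<bar> * (norm y + norm x)"
    by (simp only: abs_mult) simp
  moreover have "\<bar>norm y - norm x\<bar> * (norm y + norm x) \<le> norm (x - y) * (R / 10)"
    using xy assms norm_triangle_ineq3[of y x] by (intro mult_mono) (auto simp: norm_minus_commute)
  moreover have "\<bar>?g x - ?g y\<bar> * R \<le> \<bar>?g x - ?g y\<bar> * (?g x + ?g y)"
    using sum by (intro mult_left_mono) auto
  ultimately have "\<bar>?g x - ?g y\<bar> * R \<le> (norm (x - y) / 10) * R" by (simp add: mult.commute)
  then have "\<bar>?g x - ?g y\<bar> \<le> norm (x - y) / 10" using assms by simp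
  then show "dist (hemisphere_graph R x) (hemisphere_graph R y) \<le> 11 / 10 * dist x y"
    using norm_Pair_le[of "x - y" "?g x - ?g y"] by (simp add: hemisphere_graph_def dist_norm)
qed simp

lemma hausdorff_outer_cap_le:
  fixes x :: "'a::euclidean_space \<times> real"
  assumes R: "0 < R" and s: "0 < s" "s \<le> R / 20" and x: "x \<in> sphere 0 R"
  shows "hausdorff_outer (DIM('a)) (sphere 0 R \<inter> ball x s) \<le> ennreal (unit_ball_vol (DIM('a)) * (9 / 4 * s) ^ DIM('a))"
proof -
  have "norm (0::'a, R) = norm x" using x R by (simp add: norm_Pair)
  then obtain f where f: "linear f" "\<And>y. norm (f y) = norm y" "\<And>y. f (f y) = y" "f (0::'a, R) = x"
    using householder_reflection_exists by metis
  have fd: "dist (f y) (f z) = dist y z" for y z by (rule linear_norm_preserving_dist[OF f(1,2)])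
  have sub: "sphere 0 R \<inter> ball x s \<subseteq> (\<lambda>a. f (hemisphere_graph R a)) ` cball 0 s"
  proof
    fix y assume y: "y \<in> sphere 0 R \<inter> ball x s"
    have d: "dist (0, R) (f y) < s" using y fd[of "(0,R)" "f y"] by (simp add: f)
    obtain a b where ab: "f y = (a, b)" by (cases "f y")
    have "norm a < s" "\<bar>R - b\<bar> < s"
      using d norm_fst_le[of "0 - a" "R - b"] norm_snd_le[of "R - b" "0 - a"] by (auto simp: ab dist_norm)
    then have "hemisphere_graph R (fst (f y)) = f y"
      using y s R f(2)[of y] by (intro hemisphere_graph_fst) (auto simp: ab)
    then have "y = f (hemisphere_graph R a)" using ab f(3)[of y] by simp
    then show "y \<in> (\<lambda>a. f (hemisphere_graph R a)) ` cball 0 s" using \<open>norm a < s\<close> by auto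
  qed
  have "(11/10)-lipschitz_on (cball 0 s) (\<lambda>a::'a. f (hemisphere_graph R a))"
    using hemisphere_graph_lipschitz[OF R s(2), where 'a='a] by (simp add: lipschitz_on_def fd)
  \<comment> \<open>With \<eta> = 1/25 the constant is 11/10 * (2 + 1/25) = 2.244, just below
    9/4.\<close>
  then have "hausdorff_outer (DIM('a)) ((\<lambda>a::'a. f (hemisphere_graph R a)) ` cball 0 s)
      \<le> ennreal (unit_ball_vol (DIM('a)) * (11/10 * (2 + 1/25) * s) ^ DIM('a))"
    using s by (intro hausdorff_outer_lipschitz_cball) auto
  also have "\<dots> \<le> ennreal (unit_ball_vol (DIM('a)) * (9 / 4 * s) ^ DIM('a))"
    using s by (intro ennreal_leI mult_left_mono power_mono mult_right_mono) auto
  finally show ?thesis using hausdorff_outer_mono[OF sub] order_trans by blast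
qed

text \<open>Forgetting the component along x is 1-Lipschitz and maps the cap onto a set containing a
  ball of dimension d, whose Lebesgue measure is positive. This later shows that every point of the
  surface belongs to the support.\<close>

lemma hausdorff_outer_sphere_cap_pos:
  fixes x :: "'a::euclidean_space \<times> real"
  assumes R: "0 < R" and e: "0 < e" and x: "x \<in> sphere 0 R"
  shows "0 < hausdorff_outer (DIM('a)) (sphere 0 R \<inter> ball x e)"
proof -
  have "norm (0::'a, R) = norm x" using x R by (simp add: norm_Pair)
  then obtain f where f: "linear f" "\<And>y. norm (f y) = norm y" "\<And>y. f (f y) = y" "f (0::'a, R) = x"
    using householder_reflection_exists by metis
  have fd: "dist (f y) (f z) = dist y z" for y z by (rule linear_norm_preserving_dist[OF f(1,2)])
  define r where "r = min (e / 2) R"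
  have r: "0 < r" using e R by (simp add: r_def)
  have "ball 0 r \<subseteq> (fst \<circ> f) ` (sphere 0 R \<inter> ball x e)"
  proof
    fix a :: 'a assume a: "a \<in> ball 0 r"
    let ?y = "f (hemisphere_graph R a)"
    have "norm a \<le> R" "2 * norm a < e" using a by (auto simp: r_def)
    then have "?y \<in> sphere 0 R" "dist x ?y < e"
      using fd[of "(0,R)" "hemisphere_graph R a"] hemisphere_graph_near_pole[of a R]
      by (auto simp: f norm_hemisphere_graph)
    moreover have "(fst \<circ> f) ?y = a" by (simp add: f hemisphere_graph_def)
    ultimately show "a \<in> (fst \<circ> f) ` (sphere 0 R \<inter> ball x e)" by (metis IntI imageI mem_ball)
  qed
  then have "hausdorff_outer (DIM('a)) (ball (0::'a) r) \<le> hausdorff_outer (DIM('a)) ((fst \<circ> f) ` (sphere 0 R \<inter> ball x e))"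
    by (rule hausdorff_outer_mono)
  also have "\<dots> \<le> ennreal (1 ^ DIM('a)) * hausdorff_outer (DIM('a)) (sphere 0 R \<inter> ball x e)"
  proof (rule hausdorff_outer_lipschitz_image)
    show "1-lipschitz_on (sphere 0 R \<inter> ball x e) (fst \<circ> f)"
      by (rule lipschitz_onI) (auto simp: fd intro: order_trans[OF dist_fst_le])
  qed auto
  finally have "hausdorff_outer (DIM('a)) (ball (0::'a) r) \<le> hausdorff_outer (DIM('a)) (sphere 0 R \<inter> ball x e)" by simp
  moreover have "0 < hausdorff_outer (DIM('a)) (ball (0::'a) r)"
  proof (rule ccontr)
    assume "\<not> ?thesis"
    then have "emeasure lborel (ball (0::'a) r) \<le> 0"
      using lborel_le_hausdorff_outer[of "ball (0::'a) r"] by (simp add: not_less)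
    then show False using r unit_ball_vol_pos[of "real DIM('a)"] by (simp add: emeasure_ball)
  qed
  ultimately show ?thesis by (rule less_le_trans[rotated])
qed

lemma hausdorff_outer_sphere_scale_le:
  fixes r s :: real
  assumes "0 < d" "0 < r" "0 < s"
  shows "hausdorff_outer d (sphere (0::'a::real_normed_vector) r) \<le> ennreal ((r / s) ^ d) * hausdorff_outer d (sphere (0::'a) s)"
proof -
  have "sphere (0::'a) r = (\<lambda>x. (r / s) *\<^sub>R x) ` sphere 0 s"
  proof (intro equalityI subsetI)
    fix x :: 'a assume "x \<in> sphere 0 r"
    then have "x = (r / s) *\<^sub>R ((s / r) *\<^sub>R x)" "(s / r) *\<^sub>R x \<in> sphere 0 s" using assms by auto
    then show "x \<in> (\<lambda>x. (r / s) *\<^sub>R x) ` sphere 0 s" by blast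
  qed (use assms in auto)
  moreover have "(r / s)-lipschitz_on (sphere (0::'a) s) (\<lambda>x. (r / s) *\<^sub>R x)"
    using assms by (intro lipschitz_onI) (auto simp: dist_norm simp flip: scaleR_diff_right)
  ultimately show ?thesis
    using hausdorff_outer_lipschitz_image[of d "r / s"] assms by (metis divide_pos_pos)
qed

lemma hausdorff_outer_sphere_scale:
  fixes r :: real
  assumes "0 < d" "0 < r"
  shows "hausdorff_outer d (sphere (0::'a::real_normed_vector) r) = ennreal (r ^ d) * hausdorff_outer d (sphere (0::'a) 1)"
proof (rule antisym)
  show "hausdorff_outer d (sphere (0::'a) r) \<le> ennreal (r ^ d) * hausdorff_outer d (sphere (0::'a) 1)"
    using hausdorff_outer_sphere_scale_le[of d r 1, where 'a='a] assms by simp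
  have "ennreal (r ^ d) * hausdorff_outer d (sphere (0::'a) 1)
      \<le> ennreal (r ^ d) * (ennreal ((1 / r) ^ d) * hausdorff_outer d (sphere (0::'a) r))"
    using assms by (intro mult_left_mono hausdorff_outer_sphere_scale_le) auto
  also have "\<dots> = hausdorff_outer d (sphere (0::'a) r)"
    using assms by (simp add: mult.assoc[symmetric] ennreal_mult'[symmetric] power_divide)
  finally show "ennreal (r ^ d) * hausdorff_outer d (sphere (0::'a) 1) \<le> hausdorff_outer d (sphere (0::'a) r)" .
qed

text \<open>The caps about a maximal separated set cover the sphere, so the volume of the sphere
  becomes a lower bound for the number of possible bump sites.\<close>

lemma sphere_net:
  fixes R s :: real
  assumes R: "0 < R" and s: "0 < s" "s \<le> R / 20"
  obtains P :: "('a::euclidean_space \<times> real) set" where "finite P" "P \<subseteq> sphere 0 R" "2 \<le> card P"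
    "pairwise (\<lambda>x y. s \<le> dist x y) P"
    "hausdorff_outer (DIM('a)) (sphere (0::'a \<times> real) R)
       \<le> ennreal (real (card P) * (unit_ball_vol (DIM('a)) * (9 / 4 * s) ^ DIM('a)))"
proof -
  let ?S = "sphere (0::'a \<times> real) R"
  obtain B where B: "\<And>P. finite P \<Longrightarrow> P \<subseteq> ?S \<Longrightarrow> pairwise (\<lambda>x y. s \<le> dist x y) P \<Longrightarrow> card P \<le> B"
    using compact_separated_card_bound[OF compact_sphere s(1)] by metis
  obtain P where P: "finite P" "P \<subseteq> ?S" "pairwise (\<lambda>x y. s \<le> dist x y) P"
    and max: "\<And>x. x \<in> ?S \<Longrightarrow> x \<in> P \<or> (\<exists>p\<in>P. \<not> s \<le> dist p x)"
    by (rule maximal_pairwise_subset[of "\<lambda>x y. s \<le> dist x y", OF _ B]) (auto simp: dist_commute)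
  have cover: "\<exists>p\<in>P. x \<in> ball p s" if "x \<in> ?S" for x
    using max[OF that] s by (force simp: not_le)
  have "hausdorff_outer (DIM('a)) ?S \<le> hausdorff_outer (DIM('a)) (\<Union>p\<in>P. ?S \<inter> ball p s)"
    using cover by (intro hausdorff_outer_mono) auto
  also have "\<dots> \<le> (\<Sum>p\<in>P. hausdorff_outer (DIM('a)) (?S \<inter> ball p s))"
    using P(1)
  proof induction
    case (insert p P)
    then show ?case
      using hausdorff_outer_Un[of "DIM('a)" "?S \<inter> ball p s" "\<Union>p\<in>P. ?S \<inter> ball p s"]
      by (auto intro: order_trans add_left_mono)
  qed (simp add: hausdorff_outer_empty)
  also have "\<dots> \<le> (\<Sum>p\<in>P. ennreal (unit_ball_vol (DIM('a)) * (9 / 4 * s) ^ DIM('a)))"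
    using P(2) by (intro sum_mono hausdorff_outer_cap_le R s) auto
  also have "\<dots> = ennreal (real (card P) * (unit_ball_vol (DIM('a)) * (9 / 4 * s) ^ DIM('a)))"
    using s by (simp add: ennreal_mult ennreal_of_nat_eq_real_of_nat)
  finally have H: "hausdorff_outer (DIM('a)) ?S \<le> ennreal (real (card P) * (unit_ball_vol (DIM('a)) * (9 / 4 * s) ^ DIM('a)))" .
  \<comment> \<open>Opposite poles are 2 R apart, too far to be close to the same site. Hence there
    are two sites, and one can be set aside for the origin.\<close>
  let ?n = "(0::'a, R)"
  have n: "?n \<in> ?S" "- ?n \<in> ?S" using R by (auto simp: norm_Pair)
  obtain p q where pq: "p \<in> P" "dist p ?n < s" "q \<in> P" "dist q (- ?n) < s" using cover[OF n(1)] cover[OF n(2)] by auto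
  have "p \<noteq> q"
  proof
    assume "p = q"
    then have "dist ?n (- ?n) < 2 * s" using pq dist_triangle_half_r[of p ?n "2 * s" "- ?n"] by simp
    moreover have "dist ?n (- ?n) = 2 * R" using R by (simp add: dist_norm norm_Pair real_sqrt_mult)
    ultimately show False using s R by simp
  qed
  then have "card {p, q} \<le> card P" using P(1) pq by (intro card_mono) auto
  then have "2 \<le> card P" using \<open>p \<noteq> q\<close> by simp
  then show ?thesis using that P H by blast
qed

section \<open>Twice continuously differentiable maps\<close>

text \<open>\<open>C2_immersion_on\<close> without injectivity of the derivative, which sums and
  general compositions do not preserve; \<open>C2_immersion_onI\<close> restores it at the
  end.\<close>

definition C2_on :: "'a::euclidean_space set \<Rightarrow> ('a \<Rightarrow> 'b::euclidean_space) \<Rightarrow> bool" where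
  "C2_on V f \<longleftrightarrow>
     (\<exists>D1 :: 'a \<Rightarrow> ('a \<Rightarrow>\<^sub>L 'b). \<exists>D2 :: 'a \<Rightarrow> ('a \<Rightarrow>\<^sub>L ('a \<Rightarrow>\<^sub>L 'b)).
        (\<forall>x\<in>V. (f has_derivative blinfun_apply (D1 x)) (at x)) \<and>
        (\<forall>x\<in>V. (D1 has_derivative blinfun_apply (D2 x)) (at x)) \<and>
        continuous_on V D2)"

text \<open>In finite dimension, continuity of an operator-valued map can be tested on basis
  vectors; this allows \<open>D2\<close> to be given as a plain function instead of a nested
  \<open>blinfun\<close>.\<close>

lemma C2_onI:
  fixes D1 :: "'a::euclidean_space \<Rightarrow> ('a \<Rightarrow>\<^sub>L 'b::euclidean_space)"
  assumes "\<And>x. x \<in> V \<Longrightarrow> (f has_derivative blinfun_apply (D1 x)) (at x)"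
    and "\<And>x. x \<in> V \<Longrightarrow> (D1 has_derivative D2 x) (at x)"
    and "\<And>i. i \<in> Basis \<Longrightarrow> continuous_on V (\<lambda>x. D2 x i)"
  shows "C2_on V f"
proof -
  have app: "blinfun_apply (Blinfun (D2 x)) = D2 x" if "x \<in> V" for x
    using assms(2)[OF that] has_derivative_bounded_linear bounded_linear_Blinfun_apply by blast
  have "continuous_on V (\<lambda>x. Blinfun (D2 x))"
  proof (rule continuous_on_blinfun_componentwise)
    fix i :: 'a assume "i \<in> Basis"
    from assms(3)[OF this] show "continuous_on V (\<lambda>x. blinfun_apply (Blinfun (D2 x)) i)"
      by (rule continuous_on_eq) (simp add: app)
  qed
  then show ?thesis
    unfolding C2_on_def using assms(1,2) app
    by (intro exI[of _ D1] exI[of _ "\<lambda>x. Blinfun (D2 x)"]) auto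
qed

lemma C2_on_bounded_linear: "bounded_linear f \<Longrightarrow> C2_on V f"
  by (rule C2_onI[of _ _ "\<lambda>x. Blinfun f" "\<lambda>x w. 0"])
    (auto simp: bounded_linear_Blinfun_apply bounded_linear_imp_has_derivative)

lemma C2_on_const: "C2_on V (\<lambda>x. c)"
  by (rule C2_onI[of _ _ "\<lambda>x. 0" "\<lambda>x w. 0"])
    (auto intro: has_derivative_eq_rhs[OF has_derivative_const] simp: fun_eq_iff)

lemma C2_on_add:
  assumes "C2_on V f" "C2_on V g"
  shows "C2_on V (\<lambda>x. f x + g x)"
proof -
  obtain F1 F2 where F: "\<And>x. x \<in> V \<Longrightarrow> (f has_derivative blinfun_apply (F1 x)) (at x)"
    "\<And>x. x \<in> V \<Longrightarrow> (F1 has_derivative blinfun_apply (F2 x)) (at x)" "continuous_on V F2"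
    using assms(1) unfolding C2_on_def by blast
  obtain G1 G2 where G: "\<And>x. x \<in> V \<Longrightarrow> (g has_derivative blinfun_apply (G1 x)) (at x)"
    "\<And>x. x \<in> V \<Longrightarrow> (G1 has_derivative blinfun_apply (G2 x)) (at x)" "continuous_on V G2"
    using assms(2) unfolding C2_on_def by blast
  show ?thesis
  proof (rule C2_onI)
    show "((\<lambda>x. f x + g x) has_derivative blinfun_apply (F1 x + G1 x)) (at x)" if "x \<in> V" for x
      using has_derivative_add[OF F(1)[OF that] G(1)[OF that]]
      by (rule has_derivative_eq_rhs) (simp add: fun_eq_iff blinfun.add_left)
    show "((\<lambda>x. F1 x + G1 x) has_derivative (\<lambda>w. F2 x w + G2 x w)) (at x)" if "x \<in> V" for x
      using has_derivative_add[OF F(2)[OF that] G(2)[OF that]] .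
    show "continuous_on V (\<lambda>x. F2 x i + G2 x i)" for i
      by (intro continuous_intros F G)
  qed
qed

lemma C2_on_sum: "(\<And>i. i \<in> I \<Longrightarrow> C2_on V (f i)) \<Longrightarrow> C2_on V (\<lambda>x. \<Sum>i\<in>I. f i x)"
  by (induction I rule: infinite_finite_induct) (auto intro: C2_on_const C2_on_add)

lemma C2_on_compose:
  assumes "C2_on W f" "C2_on V g" "g ` V \<subseteq> W"
  shows "C2_on V (\<lambda>x. f (g x))"
proof -
  obtain F1 F2 where F: "\<And>x. x \<in> W \<Longrightarrow> (f has_derivative blinfun_apply (F1 x)) (at x)"
    "\<And>x. x \<in> W \<Longrightarrow> (F1 has_derivative blinfun_apply (F2 x)) (at x)" "continuous_on W F2"
    using assms(1) unfolding C2_on_def by blast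
  obtain G1 G2 where G: "\<And>x. x \<in> V \<Longrightarrow> (g has_derivative blinfun_apply (G1 x)) (at x)"
    "\<And>x. x \<in> V \<Longrightarrow> (G1 has_derivative blinfun_apply (G2 x)) (at x)" "continuous_on V G2"
    using assms(2) unfolding C2_on_def by blast
  have W: "g x \<in> W" if "x \<in> V" for x using assms(3) that by auto
  have FG: "((\<lambda>x. F1 (g x)) has_derivative (\<lambda>w. F2 (g x) (G1 x w))) (at x)" if "x \<in> V" for x
    using has_derivative_compose[OF G(1)[OF that] F(2)[OF W[OF that]]] by simp
  have cg: "continuous_on V g" "continuous_on V G1" "continuous_on V (\<lambda>x. F1 (g x))"
    using G(1,2) FG by (auto intro!: continuous_at_imp_continuous_on has_derivative_continuous)
  have cF: "continuous_on V (\<lambda>x. F2 (g x))"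
    using continuous_on_compose2[OF F(3) cg(1) assms(3)] .
  show ?thesis
  proof (rule C2_onI)
    show "((\<lambda>x. f (g x)) has_derivative blinfun_apply (F1 (g x) o\<^sub>L G1 x)) (at x)" if "x \<in> V" for x
      using has_derivative_compose[OF G(1)[OF that] F(1)[OF W[OF that]]]
      by (rule has_derivative_eq_rhs) (simp add: fun_eq_iff)
    show "((\<lambda>x. F1 (g x) o\<^sub>L G1 x) has_derivative
        (\<lambda>w. (F1 (g x) o\<^sub>L G2 x w) + (F2 (g x) (G1 x w) o\<^sub>L G1 x))) (at x)" if "x \<in> V" for x
      using bounded_bilinear.FDERIV[OF bounded_bilinear_blinfun_compose FG[OF that] G(2)[OF that]] .
    show "continuous_on V (\<lambda>x. (F1 (g x) o\<^sub>L G2 x i) + (F2 (g x) (G1 x i) o\<^sub>L G1 x))" for i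
      by (intro continuous_intros bounded_bilinear.continuous_on[OF bounded_bilinear_blinfun_compose] cg cF G(3))
  qed
qed

lemma C2_on_inner_self: "C2_on V (\<lambda>x. x \<bullet> x)"
proof (rule C2_onI)
  fix x :: 'a
  show "((\<lambda>x. x \<bullet> x) has_derivative blinfun_apply (2 *\<^sub>R blinfun_inner_left x)) (at x)"
    by (auto intro!: derivative_eq_intros simp: fun_eq_iff blinfun.scaleR_left inner_commute)
  have "bounded_linear (\<lambda>x::'a. 2 *\<^sub>R blinfun_inner_left x)"
    by (intro bounded_linear_intros)
  then show "((\<lambda>x. 2 *\<^sub>R blinfun_inner_left x) has_derivative (\<lambda>w. 2 *\<^sub>R blinfun_inner_left w)) (at x)"
    by (rule bounded_linear_imp_has_derivative)
qed auto

lemma C2_on_real: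
  fixes g :: "real \<Rightarrow> real"
  assumes "\<And>t. t \<in> V \<Longrightarrow> (g has_field_derivative g' t) (at t)"
    "\<And>t. t \<in> V \<Longrightarrow> (g' has_field_derivative g'' t) (at t)" "continuous_on V g''"
  shows "C2_on V g"
proof (rule C2_onI)
  fix t assume t: "t \<in> V"
  show "(g has_derivative blinfun_apply (g' t *\<^sub>R id_blinfun)) (at t)"
    using assms(1)[OF t] unfolding has_field_derivative_def
    by (rule has_derivative_eq_rhs) (simp add: fun_eq_iff blinfun.scaleR_left)
  show "((\<lambda>t. g' t *\<^sub>R id_blinfun) has_derivative (\<lambda>h. (g'' t * h) *\<^sub>R id_blinfun)) (at t)"
    using assms(2)[OF t] unfolding has_field_derivative_def by (intro derivative_eq_intros) auto
next
  show "continuous_on V (\<lambda>t. (g'' t * i) *\<^sub>R id_blinfun)" for i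
    by (intro continuous_intros assms)
qed

text \<open>Along a vector in the kernel of the derivative, f would move only by o(t), against the
  expansion bound c t. Injectivity thus follows from a metric estimate, without computing the
  derivative of a chart.\<close>

lemma C2_immersion_onI:
  assumes V: "open V" and f: "C2_on V f" and c: "0 < c"
    and exp: "\<And>x y. x \<in> V \<Longrightarrow> y \<in> V \<Longrightarrow> c * dist x y \<le> dist (f x) (f y)"
  shows "C2_immersion_on V f"
proof -
  obtain D1 D2 where D: "\<And>x. x \<in> V \<Longrightarrow> (f has_derivative blinfun_apply (D1 x)) (at x)"
    "\<And>x. x \<in> V \<Longrightarrow> (D1 has_derivative blinfun_apply (D2 x)) (at x)" "continuous_on V D2"
    using f unfolding C2_on_def by blast
  have "inj (blinfun_apply (D1 x))" if x: "x \<in> V" for x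
  proof -
    have "w = 0" if w: "D1 x w = 0" for w
    proof (rule ccontr)
      assume "w \<noteq> 0"
      obtain r where r: "0 < r" "\<And>y. norm (y - x) < r \<Longrightarrow> norm (f y - f x - D1 x (y - x)) \<le> c / 2 * norm (y - x)"
        using D(1)[OF x] c unfolding has_derivative_at_alt by (metis half_gt_zero)
      obtain s where s: "0 < s" "ball x s \<subseteq> V" using V x openE by blast
      \<comment> \<open>Small enough both to stay inside \<open>V\<close> and to be in the range
        where the first-order error is below c/2.\<close>
      define t where "t = min r s / (2 * norm w)"
      have t: "0 < t" "t * norm w < r" "t * norm w < s"
        using r s \<open>w \<noteq> 0\<close> by (auto simp: t_def min_def)
      then have "x + t *\<^sub>R w \<in> V" using s by (auto simp: dist_norm)
      then have "c * (t * norm w) \<le> norm (f (x + t *\<^sub>R w) - f x)"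
        using exp[of "x + t *\<^sub>R w" x] x t by (simp add: dist_norm)
      moreover have "norm (f (x + t *\<^sub>R w) - f x) \<le> c / 2 * (t * norm w)"
        using r(2)[of "x + t *\<^sub>R w"] t w by (simp add: blinfun.scaleR_right)
      moreover have "0 < c * (t * norm w)" using c t \<open>w \<noteq> 0\<close> by simp
      ultimately show False by linarith
    qed
    then show ?thesis by (simp add: linear_injective_0 bounded_linear.linear blinfun.bounded_linear_right)
  qed
  then show ?thesis unfolding C2_immersion_on_def using D by blast
qed

lemma C2_on_hemisphere_graph:
  assumes "0 < R"
  shows "C2_on (ball (0::'a::euclidean_space) R) (hemisphere_graph R)"
proof -
  have "C2_on {0<..} sqrt"
  proof (rule C2_on_real)
    fix t :: real assume "t \<in> {0<..}"
    then have t: "0 < t" by simp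
    show "(sqrt has_field_derivative inverse (sqrt t) / 2) (at t)" using t by (rule DERIV_real_sqrt)
    show "((\<lambda>t. inverse (sqrt t) / 2) has_field_derivative - (inverse (sqrt t) * (inverse (sqrt t) / 2) * inverse (sqrt t)) / 2) (at t)"
      using t by (auto intro!: derivative_eq_intros)
  qed (auto intro!: continuous_intros)
  moreover have "C2_on (ball (0::'a) R) (\<lambda>x. R\<^sup>2 + (-1) *\<^sub>R (x \<bullet> x))"
    by (intro C2_on_add C2_on_const C2_on_compose[OF C2_on_bounded_linear C2_on_inner_self, where W=UNIV and f="\<lambda>x. (-1) *\<^sub>R x"]
        bounded_linear_scaleR_right) auto
  moreover have "(\<lambda>x::'a. R\<^sup>2 + (-1) *\<^sub>R (x \<bullet> x)) ` ball 0 R \<subseteq> {0<..}"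
    using assms by (auto simp: dot_square_norm power_strict_mono)
  ultimately have "C2_on (ball (0::'a) R) (\<lambda>x. sqrt (R\<^sup>2 + (-1) *\<^sub>R (x \<bullet> x)))"
    by (rule C2_on_compose)
  then have "C2_on (ball (0::'a) R) (\<lambda>x. (0::'a, sqrt (R\<^sup>2 + (-1) *\<^sub>R (x \<bullet> x))))"
    by (rule C2_on_compose[rotated, where f="\<lambda>t. (0::'a, t)" and W=UNIV])
      (auto intro!: C2_on_bounded_linear bounded_linear_Pair)
  moreover have "C2_on (ball (0::'a) R) (\<lambda>x. (x, 0::real))"
    by (intro C2_on_bounded_linear bounded_linear_Pair bounded_linear_ident bounded_linear_zero)
  ultimately have "C2_on (ball (0::'a) R) (\<lambda>x. (x, 0) + (0, sqrt (R\<^sup>2 + (-1) *\<^sub>R (x \<bullet> x))))"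
    by (rule C2_on_add[rotated])
  then show ?thesis
    by (simp add: hemisphere_graph_def[abs_def] dot_square_norm)
qed

section \<open>Reach of a perturbed sphere\<close>

text \<open>Let z have two nearest points \<open>\<Psi> p\<close> and \<open>\<Psi> q\<close>. Then
  \<nu> = z - \<open>\<Psi> p\<close> is normal to the surface, and equality of the distances gives
  2 \<nu> . (\<open>\<Psi> q - \<Psi> p\<close>) = |\<open>\<Psi> q - \<Psi> p\<close>|^2. The
  left-hand side is of second order in q - p: the sphere contributes (1 + \<kappa>) / (2 R), the
  Taylor remainder K, both multiplied by |\<nu>|. The right-hand side is at least (1 - \<kappa>)^2
  |q - p|^2, so |\<nu>| cannot be below r.\<close>

lemma reach_sphere_image_ge:
  fixes \<Psi> :: "'a::real_inner \<Rightarrow> 'b::real_inner"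
  assumes R: "0 < R" and \<kappa>: "0 \<le> \<kappa>" "\<kappa> < 1" and K: "0 \<le> K"
    and D: "\<And>x. (\<Psi> has_derivative D x) (at x)"
    and normD: "\<And>x w. norm (D x w) \<le> (1 + \<kappa>) * norm w"
    and rem: "\<And>x y. norm (\<Psi> y - \<Psi> x - D x (y - x)) \<le> K * (norm (y - x))\<^sup>2"
    and exp: "\<And>x y. (1 - \<kappa>) * dist x y \<le> dist (\<Psi> x) (\<Psi> y)"
    and num: "2 * r * ((1 + \<kappa>) / (2 * R) + K) \<le> (1 - \<kappa>)\<^sup>2"
  shows "ereal r \<le> reach (\<Psi> ` sphere 0 R)"
  unfolding reach_def
proof (rule INF_greatest, rule ccontr)
  fix z assume "z \<in> medial_axis (\<Psi> ` sphere 0 R)" and small: "\<not> ereal r \<le> einfdist z (\<Psi> ` sphere 0 R)"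
  then obtain p q where p: "norm p = R" and q: "norm q = R" and ne: "\<Psi> p \<noteq> \<Psi> q"
    and dp: "ereal (dist (\<Psi> p) z) = einfdist z (\<Psi> ` sphere 0 R)"
    and dq: "ereal (dist (\<Psi> q) z) = einfdist z (\<Psi> ` sphere 0 R)"
    by (auto simp: medial_axis_def)
  define \<nu> where "\<nu> = z - \<Psi> p"
  have \<nu>: "norm \<nu> < r" using small dp by (metis \<nu>_def dist_norm ereal_less_eq(3) norm_minus_commute not_le)
  have nearest: "norm (z - \<Psi> p) \<le> norm (z - \<Psi> y)" if "norm y = R" for y
  proof -
    have "ereal (dist (\<Psi> p) z) \<le> ereal (dist (\<Psi> y) z)"
      unfolding dp einfdist_def using that by (intro INF_lower) auto
    then show ?thesis by (simp add: dist_norm norm_minus_commute)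
  qed
  have bl: "bounded_linear (D x)" for x by (rule has_derivative_bounded_linear[OF D])
  have orth: "\<nu> \<bullet> D p w = 0" if w: "w \<bullet> p = 0" for w
  proof (cases "w = 0")
    case True
    then show ?thesis using bounded_linear.linear[OF bl] by (simp add: linear_0)
  next
    case False
    \<comment> \<open>Along the great circle \<gamma> through p in direction w, the squared distance
      from z to the surface is least at \<theta> = 0. Its derivative there is a nonzero multiple of
      \<nu> . \<open>D p w\<close>, which must vanish.\<close>
    define c where "c = R / norm w"
    define \<gamma> where "\<gamma> \<theta> = cos \<theta> *\<^sub>R p + sin \<theta> *\<^sub>R (c *\<^sub>R w)" for \<theta>
    have \<gamma>R: "norm (\<gamma> \<theta>) = R" for \<theta>
    proof -
      have cw: "(c *\<^sub>R w) \<bullet> (c *\<^sub>R w) = R\<^sup>2" "p \<bullet> p = R\<^sup>2"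
        using False R p by (auto simp: c_def dot_square_norm power_divide power2_eq_square[symmetric])
      have "\<gamma> \<theta> \<bullet> \<gamma> \<theta> = (cos \<theta>)\<^sup>2 * (p \<bullet> p) + (sin \<theta>)\<^sup>2 * ((c *\<^sub>R w) \<bullet> (c *\<^sub>R w))"
        using w by (simp add: \<gamma>_def inner_add_left inner_add_right inner_commute power2_eq_square)
      also have "\<dots> = R\<^sup>2 * ((cos \<theta>)\<^sup>2 + (sin \<theta>)\<^sup>2)" unfolding cw by (simp only: distrib_left mult.commute[of "R\<^sup>2"])
      finally show ?thesis using R by (simp add: norm_eq_sqrt_inner)
    qed
    have "(\<gamma> has_derivative (\<lambda>s. s *\<^sub>R (c *\<^sub>R w))) (at 0)"
      unfolding \<gamma>_def by (auto intro!: derivative_eq_intros)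
    moreover have "\<gamma> 0 = p" by (simp add: \<gamma>_def)
    ultimately have "((\<lambda>\<theta>. \<Psi> (\<gamma> \<theta>)) has_derivative (\<lambda>s. D p (s *\<^sub>R (c *\<^sub>R w)))) (at 0)"
      using has_derivative_compose[of \<gamma> _ 0 UNIV \<Psi>] D[of p] by simp
    then have "((\<lambda>\<theta>. (z - \<Psi> (\<gamma> \<theta>)) \<bullet> (z - \<Psi> (\<gamma> \<theta>))) has_derivative (\<lambda>s. - 2 * (\<nu> \<bullet> D p (s *\<^sub>R (c *\<^sub>R w))))) (at 0)"
      by (auto intro!: derivative_eq_intros simp: \<open>\<gamma> 0 = p\<close> \<nu>_def inner_commute)
    then have "((\<lambda>\<theta>. (z - \<Psi> (\<gamma> \<theta>)) \<bullet> (z - \<Psi> (\<gamma> \<theta>))) has_real_derivative - 2 * c * (\<nu> \<bullet> D p w)) (at 0)"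
      unfolding has_field_derivative_def
      by (rule has_derivative_eq_rhs) (auto simp: fun_eq_iff linear_cmul[OF bounded_linear.linear[OF bl]])
    then have "- 2 * c * (\<nu> \<bullet> D p w) = 0"
      using nearest[OF \<gamma>R] by (rule_tac DERIV_local_min[of _ _ 0 1]) (auto simp: dot_square_norm \<open>\<gamma> 0 = p\<close> intro: power_mono)
    then show ?thesis using R False by (simp add: c_def)
  qed
  \<comment> \<open>The chord splits into a tangential part, invisible to \<nu>, and the radial part
    \<open>c *\<^sub>R p\<close>, which is quadratic in its length.\<close>
  define c where "c = ((q - p) \<bullet> p) / R\<^sup>2"
  have c: "c = - (norm (q - p))\<^sup>2 / (2 * R\<^sup>2)"
  proof -
    have "(norm (q - p))\<^sup>2 = R\<^sup>2 + R\<^sup>2 - 2 * (q \<bullet> p)"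
      using p q dot_square_norm[of p] dot_square_norm[of q] dot_square_norm[of "q - p"]
      by (simp add: inner_diff_left inner_diff_right inner_commute)
    moreover have "(q - p) \<bullet> p = q \<bullet> p - R\<^sup>2" using p by (simp add: inner_diff_left dot_square_norm)
    ultimately have "(q - p) \<bullet> p = - (norm (q - p))\<^sup>2 / 2" by linarith
    then show ?thesis by (simp add: c_def)
  qed
  have "\<nu> \<bullet> D p (q - p) = \<nu> \<bullet> D p ((q - p - c *\<^sub>R p) + c *\<^sub>R p)" by simp
  also have "\<dots> = \<nu> \<bullet> D p (q - p - c *\<^sub>R p) + c * (\<nu> \<bullet> D p p)"
    by (simp only: linear_add[OF bounded_linear.linear[OF bl]] linear_cmul[OF bounded_linear.linear[OF bl]] inner_add_right inner_scaleR_right)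
  also have "\<nu> \<bullet> D p (q - p - c *\<^sub>R p) = 0"
    using R p by (intro orth) (simp add: c_def inner_diff_left dot_square_norm)
  finally have "\<bar>\<nu> \<bullet> D p (q - p)\<bar> = (norm (q - p))\<^sup>2 / (2 * R\<^sup>2) * \<bar>\<nu> \<bullet> D p p\<bar>"
    by (simp add: c abs_mult)
  also have "\<dots> \<le> (norm (q - p))\<^sup>2 / (2 * R\<^sup>2) * (norm \<nu> * ((1 + \<kappa>) * R))"
    using normD[of p p] p by (intro mult_left_mono order_trans[OF Cauchy_Schwarz_ineq2]) (auto intro: mult_left_mono)
  also have "\<dots> = norm \<nu> * ((1 + \<kappa>) / (2 * R)) * (norm (q - p))\<^sup>2"
    using R by (simp add: field_simps power2_eq_square)
  finally have t1: "\<bar>\<nu> \<bullet> D p (q - p)\<bar> \<le> norm \<nu> * ((1 + \<kappa>) / (2 * R)) * (norm (q - p))\<^sup>2" .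
  have "\<bar>\<nu> \<bullet> (\<Psi> q - \<Psi> p - D p (q - p))\<bar> \<le> norm \<nu> * (K * (norm (q - p))\<^sup>2)"
    using rem[of q p] by (intro order_trans[OF Cauchy_Schwarz_ineq2] mult_left_mono) auto
  then have "\<nu> \<bullet> (\<Psi> q - \<Psi> p) \<le> norm \<nu> * ((1 + \<kappa>) / (2 * R) + K) * (norm (q - p))\<^sup>2"
    using t1 by (simp add: inner_diff_right algebra_simps)
  moreover have "2 * (\<nu> \<bullet> (\<Psi> q - \<Psi> p)) = (norm (\<Psi> q - \<Psi> p))\<^sup>2"
  proof -
    have "norm (z - \<Psi> p) = norm (z - \<Psi> q)" using dp dq by (metis dist_commute dist_norm ereal.inject)
    then have "(z - \<Psi> p) \<bullet> (z - \<Psi> p) = (z - \<Psi> q) \<bullet> (z - \<Psi> q)" by (simp add: dot_square_norm)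
    then show ?thesis
      by (simp add: \<nu>_def dot_square_norm[symmetric] inner_diff_left inner_diff_right inner_commute)
  qed
  moreover have "(1 - \<kappa>)\<^sup>2 * (norm (q - p))\<^sup>2 \<le> (norm (\<Psi> q - \<Psi> p))\<^sup>2"
    using exp[of q p] \<kappa> unfolding dist_norm power_mult_distrib[symmetric] by (intro power_mono) auto
  ultimately have "(1 - \<kappa>)\<^sup>2 * (norm (q - p))\<^sup>2 \<le> 2 * (norm \<nu> * ((1 + \<kappa>) / (2 * R) + K) * (norm (q - p))\<^sup>2)"
    by linarith
  then have "(1 - \<kappa>)\<^sup>2 * (norm (q - p))\<^sup>2 \<le> 2 * (norm \<nu> * ((1 + \<kappa>) / (2 * R) + K)) * (norm (q - p))\<^sup>2"
    by (simp only: mult.assoc)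
  then have "(1 - \<kappa>)\<^sup>2 \<le> 2 * (norm \<nu> * ((1 + \<kappa>) / (2 * R) + K))"
    using ne by (subst (asm) mult_le_cancel_right_pos) auto
  also have "\<dots> < 2 * (r * ((1 + \<kappa>) / (2 * R) + K))"
    using \<nu> R \<kappa> K by (intro mult_strict_left_mono mult_strict_right_mono add_pos_nonneg) auto
  finally show False using num by simp
qed

section \<open>Bumps\<close>

text \<open>The exponent k + 2 leaves a positive power in the derivative, so that the formula
  survives at the corner x = 0.\<close>

lemma DERIV_max_0_power:
  fixes x :: real
  shows "((\<lambda>x. max 0 x ^ (k + 2)) has_real_derivative real (k + 2) * max 0 x ^ (k + 1)) (at x)"
proof (cases x "0::real" rule: linorder_cases)
  case less
  have "((\<lambda>x. 0) has_real_derivative 0) (at x)" by simp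
  then have "((\<lambda>x. max 0 x ^ (k + 2)) has_real_derivative 0) (at x)"
    by (rule has_field_derivative_transform_within_open[where S="{..<0}"]) (use less in auto)
  then show ?thesis using less by simp
next
  case greater
  have "((\<lambda>x. x ^ (k + 2)) has_real_derivative real (k + 2) * x ^ (k + 1)) (at x)"
    using DERIV_pow[of "k + 2" x] by simp
  then have "((\<lambda>x. max 0 x ^ (k + 2)) has_real_derivative real (k + 2) * x ^ (k + 1)) (at x)"
    by (rule has_field_derivative_transform_within_open[where S="{0<..}"]) (use greater in auto)
  then show ?thesis using greater by simp
next
  case equal
  have "((\<lambda>h::real. max 0 h ^ (k + 2) / h) \<longlongrightarrow> 0) (at 0)"
  proof (rule Lim_null_comparison)
    have "norm (max 0 h ^ (k + 2) / h) \<le> \<bar>h\<bar> ^ (k + 1)" for h :: real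
    proof (cases "0 < h")
      case False
      then have "norm (max 0 h ^ (k + 2) / h) = 0" by (simp add: max_absorb1)
      then show ?thesis using zero_le_power[OF abs_ge_zero, of h "k + 1"] by linarith
    qed simp
    then show "\<forall>\<^sub>F h in at 0. norm (max 0 h ^ (k + 2) / h) \<le> \<bar>h\<bar> ^ (k + 1)"
      by (intro always_eventually allI)
    show "((\<lambda>h::real. \<bar>h\<bar> ^ (k + 1)) \<longlongrightarrow> 0) (at 0)"
      by (auto intro!: tendsto_eq_intros)
  qed
  then show ?thesis using equal by (simp add: has_field_derivative_iff)
qed

text \<open>The exponent 3 is the least integer for which the cut-off is twice continuously
  differentiable across the unit sphere.\<close>

definition bump :: "'a::real_inner \<Rightarrow> real" where
  "bump u = max 0 (1 - u \<bullet> u) ^ 3"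

definition bump_deriv :: "'a::real_inner \<Rightarrow> 'a \<Rightarrow> real" where
  "bump_deriv u w = - 6 * (max 0 (1 - u \<bullet> u))\<^sup>2 * (u \<bullet> w)"

lemma bump_0 [simp]: "bump 0 = 1"
  by (simp add: bump_def)

lemma bump_range: "0 \<le> bump u" "bump u \<le> 1"
  by (auto simp: bump_def intro: power_le_one)

lemma bump_support:
  assumes "1 \<le> norm u"
  shows "bump u = 0" "bump_deriv u w = 0"
proof -
  have "1 \<le> u \<bullet> u" using assms power_mono[of 1 "norm u" 2] by (simp add: dot_square_norm)
  then show "bump u = 0" "bump_deriv u w = 0" by (auto simp: bump_def bump_deriv_def)
qed

lemma bump_deriv_scaleR: "bump_deriv u (c *\<^sub>R w) = c * bump_deriv u w"
  by (simp add: bump_deriv_def)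

lemma DERIV_cut_power:
  fixes t :: real
  shows "((\<lambda>t. max 0 (1 - t) ^ 3) has_real_derivative - 3 * (max 0 (1 - t))\<^sup>2) (at t)"
    and "((\<lambda>t. (max 0 (1 - t))\<^sup>2) has_real_derivative - 2 * max 0 (1 - t)) (at t)"
proof -
  have g: "((\<lambda>t. 1 - t) has_real_derivative - 1) (at t)" by (auto intro!: derivative_eq_intros)
  show "((\<lambda>t. max 0 (1 - t) ^ 3) has_real_derivative - 3 * (max 0 (1 - t))\<^sup>2) (at t)"
    using DERIV_chain2[where f="\<lambda>x. max 0 x ^ (1 + 2)" and g="\<lambda>t. 1 - t", OF DERIV_max_0_power g] by (simp add: numeral_3_eq_3 numeral_2_eq_2)
  show "((\<lambda>t. (max 0 (1 - t))\<^sup>2) has_real_derivative - 2 * max 0 (1 - t)) (at t)"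
    using DERIV_chain2[where f="\<lambda>x. max 0 x ^ (0 + 2)" and g="\<lambda>t. 1 - t", OF DERIV_max_0_power g] by (simp add: numeral_2_eq_2)
qed

lemma has_derivative_bump: "(bump has_derivative bump_deriv u) (at u)"
proof -
  have "((\<lambda>u. u \<bullet> u) has_derivative (\<lambda>w. 2 * (u \<bullet> w))) (at u)"
    by (auto intro!: derivative_eq_intros simp: inner_commute)
  from has_derivative_compose[OF this DERIV_cut_power(1)[of "u \<bullet> u", unfolded has_field_derivative_def]]
  show ?thesis
    unfolding bump_def[abs_def]
    by (rule has_derivative_eq_rhs) (simp add: fun_eq_iff bump_deriv_def)
qed

lemma C2_on_bump: "C2_on V (bump :: 'a::euclidean_space \<Rightarrow> real)"
proof -
  have "C2_on UNIV (\<lambda>t::real. max 0 (1 - t) ^ 3)"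
  proof (rule C2_on_real[OF DERIV_cut_power(1)])
    show "((\<lambda>t. - 3 * (max 0 (1 - t))\<^sup>2) has_real_derivative 6 * max 0 (1 - t)) (at t)" for t :: real
      using DERIV_cmult[OF DERIV_cut_power(2)[of t], of "-3"] by simp
  qed (intro continuous_intros)
  from C2_on_compose[OF this C2_on_inner_self] show ?thesis by (simp add: bump_def[abs_def])
qed

text \<open>The Lipschitz and Taylor estimates need derivatives along one segment only, so the
  second derivative is computed in one variable rather than as a bilinear map.\<close>

lemma bump_along_line:
  fixes u w :: "'a::real_inner"
  defines "m \<equiv> \<lambda>\<tau>. max 0 (1 - (u + \<tau> *\<^sub>R w) \<bullet> (u + \<tau> *\<^sub>R w))"
  shows "((\<lambda>\<tau>. bump (u + \<tau> *\<^sub>R w)) has_real_derivative bump_deriv (u + \<tau> *\<^sub>R w) w) (at \<tau>)"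
    and "((\<lambda>\<tau>. bump_deriv (u + \<tau> *\<^sub>R w) w) has_real_derivative
        24 * m \<tau> * ((u + \<tau> *\<^sub>R w) \<bullet> w)\<^sup>2 - 6 * (m \<tau>)\<^sup>2 * (w \<bullet> w)) (at \<tau>)"
proof -
  let ?x = "\<lambda>\<tau>. u + \<tau> *\<^sub>R w"
  have x: "(?x has_derivative (\<lambda>s. s *\<^sub>R w)) (at \<tau>)" for \<tau> by (auto intro!: derivative_eq_intros)
  show "((\<lambda>\<tau>. bump (?x \<tau>)) has_real_derivative bump_deriv (?x \<tau>) w) (at \<tau>)"
    using has_derivative_compose[OF x has_derivative_bump]
    by (simp add: has_field_derivative_def bump_deriv_scaleR mult.commute[of _ "bump_deriv _ _"])
  have sq: "((\<lambda>\<tau>. ?x \<tau> \<bullet> ?x \<tau>) has_real_derivative 2 * (?x \<tau> \<bullet> w)) (at \<tau>)"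
    unfolding has_field_derivative_def
    by (rule has_derivative_eq_rhs) (auto intro!: derivative_eq_intros simp: inner_commute)
  have lin: "((\<lambda>\<tau>. ?x \<tau> \<bullet> w) has_real_derivative w \<bullet> w) (at \<tau>)"
    unfolding has_field_derivative_def
    by (rule has_derivative_eq_rhs) (auto intro!: derivative_eq_intros)
  have m2: "((\<lambda>\<tau>. (m \<tau>)\<^sup>2) has_real_derivative - 2 * m \<tau> * (2 * (?x \<tau> \<bullet> w))) (at \<tau>)"
    using DERIV_chain2[OF DERIV_cut_power(2) sq] by (simp add: m_def)
  show "((\<lambda>\<tau>. bump_deriv (?x \<tau>) w) has_real_derivative
        24 * m \<tau> * (?x \<tau> \<bullet> w)\<^sup>2 - 6 * (m \<tau>)\<^sup>2 * (w \<bullet> w)) (at \<tau>)"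
    using DERIV_cmult[OF DERIV_mult[OF m2 lin], of "-6"]
    by (simp add: bump_deriv_def m_def algebra_simps power2_eq_square)
qed

lemma bump_deriv_bound: "\<bar>bump_deriv u w\<bar> \<le> 6 * norm w"
proof (cases "1 \<le> norm u")
  case True
  then show ?thesis by (simp add: bump_support)
next
  case False
  have "(max 0 (1 - u \<bullet> u))\<^sup>2 \<le> 1" by (intro power_le_one) auto
  then have "(max 0 (1 - u \<bullet> u))\<^sup>2 * \<bar>u \<bullet> w\<bar> \<le> norm u * norm w"
    using Cauchy_Schwarz_ineq2[of u w] mult_mono[of "(max 0 (1 - u \<bullet> u))\<^sup>2" 1 "\<bar>u \<bullet> w\<bar>" "norm u * norm w"]
    by simp
  also have "\<dots> \<le> norm w" using False mult_right_mono[of "norm u" 1 "norm w"] by simp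
  finally show ?thesis by (simp add: bump_deriv_def abs_mult)
qed

lemma bump_lipschitz: "\<bar>bump y - bump x\<bar> \<le> 6 * norm (y - x)"
proof -
  obtain \<tau> :: real where "bump (x + 1 *\<^sub>R (y - x)) - bump (x + 0 *\<^sub>R (y - x)) = (1 - 0) * bump_deriv (x + \<tau> *\<^sub>R (y - x)) (y - x)"
    using MVT2[of 0 1 "\<lambda>\<tau>. bump (x + \<tau> *\<^sub>R (y - x))" "\<lambda>\<tau>. bump_deriv (x + \<tau> *\<^sub>R (y - x)) (y - x)"]
      bump_along_line(1)[of x "y - x"] by auto
  then show ?thesis using bump_deriv_bound[of "x + \<tau> *\<^sub>R (y - x)" "y - x"] by simp
qed

text \<open>The second derivative is a difference of two nonnegative terms, each at most 6 |w|^2;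
  hence its absolute value is bounded by 6 |w|^2 and not by the sum. The first term uses a (1 - a)
  \<le> 1/4.\<close>

lemma bump_taylor: "\<bar>bump y - bump x - bump_deriv x (y - x)\<bar> \<le> 3 * (norm (y - x))\<^sup>2"
proof -
  define w where "w = y - x"
  define m where "m \<tau> = max 0 (1 - (x + \<tau> *\<^sub>R w) \<bullet> (x + \<tau> *\<^sub>R w))" for \<tau>
  define D2 where "D2 \<tau> = 24 * m \<tau> * ((x + \<tau> *\<^sub>R w) \<bullet> w)\<^sup>2 - 6 * (m \<tau>)\<^sup>2 * (w \<bullet> w)" for \<tau>
  \<comment> \<open>\<open>Maclaurin\<close> takes a whole sequence of derivatives but looks at
    orders 0, 1, 2 only; \<open>D2\<close> is a filler for the higher ones.\<close>
  define diff where "diff n \<tau> = (if n = 0 then bump (x + \<tau> *\<^sub>R w)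
      else if n = 1 then bump_deriv (x + \<tau> *\<^sub>R w) w else D2 \<tau>)" for n :: nat and \<tau>
  have "(diff n has_real_derivative diff (Suc n) t) (at t)" if "n < 2" for n t
    using that bump_along_line[of x w t] unfolding diff_def D2_def m_def
    by (cases "n = 0") (auto simp: less_2_cases_iff)
  moreover have "diff 0 = (\<lambda>\<tau>. bump (x + \<tau> *\<^sub>R w))" by (simp add: diff_def fun_eq_iff)
  ultimately obtain t where t: "bump (x + 1 *\<^sub>R w) = (\<Sum>n<2. diff n 0 / fact n * 1 ^ n) + diff 2 t / fact 2 * 1\<^sup>2"
    using Maclaurin[of 1 2 diff "\<lambda>\<tau>. bump (x + \<tau> *\<^sub>R w)"] by auto
  then have eq: "bump y - bump x - bump_deriv x w = D2 t / 2"
    by (simp add: numeral_2_eq_2 diff_def w_def)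
  have m01: "0 \<le> m t" "m t \<le> 1" by (auto simp: m_def)
  have "m t * ((x + t *\<^sub>R w) \<bullet> w)\<^sup>2 \<le> (1/4) * (w \<bullet> w)"
  proof -
    have "((x + t *\<^sub>R w) \<bullet> w)\<^sup>2 \<le> ((x + t *\<^sub>R w) \<bullet> (x + t *\<^sub>R w)) * (w \<bullet> w)" by (rule Cauchy_Schwarz_ineq)
    then have "m t * ((x + t *\<^sub>R w) \<bullet> w)\<^sup>2 \<le> (m t * ((x + t *\<^sub>R w) \<bullet> (x + t *\<^sub>R w))) * (w \<bullet> w)"
      using m01 by (simp add: mult.assoc mult_left_mono)
    also have "m t * ((x + t *\<^sub>R w) \<bullet> (x + t *\<^sub>R w)) \<le> 1/4"
    proof -
      have "a * (1 - a) \<le> 1/4" for a :: real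
        using zero_le_power2[of "a - 1/2"] by (simp add: power2_eq_square algebra_simps)
      from this[of "1 - (x + t *\<^sub>R w) \<bullet> (x + t *\<^sub>R w)"] show ?thesis by (auto simp: m_def max_def)
    qed
    finally show ?thesis by (simp add: mult_right_mono)
  qed
  moreover have "0 \<le> m t * ((x + t *\<^sub>R w) \<bullet> w)\<^sup>2" using m01 by simp
  moreover have "0 \<le> (m t)\<^sup>2 * (w \<bullet> w)" "(m t)\<^sup>2 * (w \<bullet> w) \<le> 1 * (w \<bullet> w)"
    using m01 by (simp, intro mult_right_mono power_le_one) auto
  ultimately have "\<bar>D2 t\<bar> \<le> 6 * (w \<bullet> w)" 
    unfolding D2_def mult.assoc abs_le_iff by (intro conjI; linarith)
  then show ?thesis using eq by (simp add: w_def dot_square_norm)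
qed

definition bump_field :: "real \<Rightarrow> real \<Rightarrow> 'a::real_inner set \<Rightarrow> ('a \<Rightarrow> 'b::real_vector) \<Rightarrow> 'a \<Rightarrow> 'b" where
  "bump_field h \<delta> X v x = (\<Sum>i\<in>X. (h * bump ((x - i) /\<^sub>R \<delta>)) *\<^sub>R v i)"

definition bump_field_deriv :: "real \<Rightarrow> real \<Rightarrow> 'a::real_inner set \<Rightarrow> ('a \<Rightarrow> 'b::real_vector) \<Rightarrow> 'a \<Rightarrow> 'a \<Rightarrow> 'b" where
  "bump_field_deriv h \<delta> X v x w = (\<Sum>i\<in>X. (h * bump_deriv ((x - i) /\<^sub>R \<delta>) (w /\<^sub>R \<delta>)) *\<^sub>R v i)"

text \<open>When a field is compared at two points, only the site near each of them can contribute.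
  The bound is therefore independent of the number of bumps.\<close>

lemma norm_sum_two_terms_le:
  fixes F :: "'i \<Rightarrow> 'b::real_normed_vector"
  assumes "finite X" "\<And>i. i \<in> X \<Longrightarrow> i \<noteq> a \<Longrightarrow> i \<noteq> b \<Longrightarrow> F i = 0"
    and "\<And>i. i \<in> X \<Longrightarrow> norm (F i) \<le> c" "0 \<le> c"
  shows "norm (\<Sum>i\<in>X. F i) \<le> 2 * c"
proof -
  have "(\<Sum>i\<in>X. F i) = (\<Sum>i\<in>X \<inter> {a, b}. F i)"
    using assms(1,2) by (intro sum.mono_neutral_right) auto
  also have "norm \<dots> \<le> of_nat (card (X \<inter> {a, b})) * c"
    using assms(3) by (intro sum_norm_bound) auto
  also have "\<dots> \<le> 2 * c"
  proof (rule mult_right_mono)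
    have "card (X \<inter> {a, b}) \<le> card {a, b}" by (intro card_mono) auto
    also have "\<dots> \<le> 2" by (simp add: card_insert_if)
    finally show "real (card (X \<inter> {a, b})) \<le> 2" by simp
  qed (rule assms)
  finally show ?thesis .
qed

locale separated_bumps =
  fixes h \<delta> :: real and X :: "'a::euclidean_space set" and v :: "'a \<Rightarrow> 'b::euclidean_space"
  assumes h: "0 < h" and \<delta>: "0 < \<delta>" and X: "finite X"
    and sep: "\<And>x y. x \<in> X \<Longrightarrow> y \<in> X \<Longrightarrow> x \<noteq> y \<Longrightarrow> 2 * \<delta> \<le> dist x y"
    and v: "\<And>i. i \<in> X \<Longrightarrow> norm (v i) \<le> 1"
begin

lemma far_bump:
  assumes "\<delta> \<le> dist x i"
  shows "bump ((x - i) /\<^sub>R \<delta>) = 0" "bump_deriv ((x - i) /\<^sub>R \<delta>) w = 0"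
proof -
  have "1 \<le> norm ((x - i) /\<^sub>R \<delta>)" using assms \<delta> by (simp add: dist_norm) (simp add: field_simps)
  then show "bump ((x - i) /\<^sub>R \<delta>) = 0" "bump_deriv ((x - i) /\<^sub>R \<delta>) w = 0" by (simp_all only: bump_support)
qed

lemma active_unique: obtains a where "\<And>i. i \<in> X \<Longrightarrow> i \<noteq> a \<Longrightarrow> \<delta> \<le> dist x i"
proof (cases "\<exists>a\<in>X. dist x a < \<delta>")
  case True
  then obtain a where a: "a \<in> X" "dist x a < \<delta>" by auto
  have "\<delta> \<le> dist x i" if "i \<in> X" "i \<noteq> a" for i
    using sep[of a i] a that dist_triangle[of a i x] by (simp add: dist_commute)
  then show ?thesis using that by blast
next
  case False
  \<comment> \<open>With no site within \<delta>, any exceptional index will do.\<close>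
  then show ?thesis using that[of undefined] by force
qed

lemma norm_term_le: "i \<in> X \<Longrightarrow> \<bar>t\<bar> \<le> c \<Longrightarrow> norm ((h * t) *\<^sub>R v i) \<le> h * c"
  using v[of i] h mult_mono[of "\<bar>h * t\<bar>" "h * c" "norm (v i)" 1] by (auto simp: abs_mult)

lemma norm_bump_field_le: "norm (bump_field h \<delta> X v x) \<le> 2 * h"
proof -
  obtain a where a: "\<And>i. i \<in> X \<Longrightarrow> i \<noteq> a \<Longrightarrow> \<delta> \<le> dist x i" using active_unique[of x] by blast
  show ?thesis
    unfolding bump_field_def
    using X a h bump_range by (intro norm_sum_two_terms_le[of _ a a]) 
      (auto simp: far_bump abs_of_nonneg[OF bump_range(1)] intro!: norm_term_le[of _ _ 1, simplified])
qed

lemma bump_field_lipschitz: "norm (bump_field h \<delta> X v y - bump_field h \<delta> X v x) \<le> 12 * h / \<delta> * norm (y - x)"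
proof -
  obtain a where a: "\<And>i. i \<in> X \<Longrightarrow> i \<noteq> a \<Longrightarrow> \<delta> \<le> dist x i" using active_unique[of x] by blast
  obtain b where b: "\<And>i. i \<in> X \<Longrightarrow> i \<noteq> b \<Longrightarrow> \<delta> \<le> dist y i" using active_unique[of y] by blast
  have "norm (\<Sum>i\<in>X. (h * (bump ((y - i) /\<^sub>R \<delta>) - bump ((x - i) /\<^sub>R \<delta>))) *\<^sub>R v i) \<le> 2 * (h * (6 * (norm (y - x) / \<delta>)))"
  proof (rule norm_sum_two_terms_le[of _ a b])
    fix i assume "i \<in> X"
    moreover have "\<bar>bump ((y - i) /\<^sub>R \<delta>) - bump ((x - i) /\<^sub>R \<delta>)\<bar> \<le> 6 * (norm (y - x) / \<delta>)"
      using bump_lipschitz[of "(y - i) /\<^sub>R \<delta>" "(x - i) /\<^sub>R \<delta>"] \<delta>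
      by (simp add: scaleR_diff_right[symmetric] divide_inverse mult.commute)
    ultimately show "norm ((h * (bump ((y - i) /\<^sub>R \<delta>) - bump ((x - i) /\<^sub>R \<delta>))) *\<^sub>R v i) \<le> h * (6 * (norm (y - x) / \<delta>))"
      by (rule norm_term_le)
  qed (use X a b h \<delta> in \<open>auto simp: far_bump\<close>)
  then show ?thesis
    by (simp add: bump_field_def sum_subtractf[symmetric] scaleR_left_diff_distrib[symmetric] right_diff_distrib[symmetric])
qed

lemma bump_field_taylor:
  "norm (bump_field h \<delta> X v y - bump_field h \<delta> X v x - bump_field_deriv h \<delta> X v x (y - x)) \<le> 6 * h / \<delta>\<^sup>2 * (norm (y - x))\<^sup>2"
proof -
  obtain a where a: "\<And>i. i \<in> X \<Longrightarrow> i \<noteq> a \<Longrightarrow> \<delta> \<le> dist x i" using active_unique[of x] by blast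
  obtain b where b: "\<And>i. i \<in> X \<Longrightarrow> i \<noteq> b \<Longrightarrow> \<delta> \<le> dist y i" using active_unique[of y] by blast
  let ?r = "\<lambda>i. bump ((y - i) /\<^sub>R \<delta>) - bump ((x - i) /\<^sub>R \<delta>) - bump_deriv ((x - i) /\<^sub>R \<delta>) ((y - x) /\<^sub>R \<delta>)"
  have "norm (\<Sum>i\<in>X. (h * ?r i) *\<^sub>R v i) \<le> 2 * (h * (3 * (norm (y - x) / \<delta>)\<^sup>2))"
  proof (rule norm_sum_two_terms_le[of _ a b])
    fix i assume "i \<in> X"
    moreover have "\<bar>?r i\<bar> \<le> 3 * (norm (y - x) / \<delta>)\<^sup>2"
      using bump_taylor[of "(y - i) /\<^sub>R \<delta>" "(x - i) /\<^sub>R \<delta>"] \<delta>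
      by (simp add: scaleR_diff_right[symmetric] divide_inverse mult.commute)
    ultimately show "norm ((h * ?r i) *\<^sub>R v i) \<le> h * (3 * (norm (y - x) / \<delta>)\<^sup>2)"
      by (rule norm_term_le)
  qed (use X a b h \<delta> in \<open>auto simp: far_bump\<close>)
  then show ?thesis
    by (simp add: bump_field_def bump_field_deriv_def sum_subtractf[symmetric] scaleR_left_diff_distrib[symmetric]
        right_diff_distrib[symmetric] power_divide)
qed

lemma bump_field_deriv_bound: "norm (bump_field_deriv h \<delta> X v x w) \<le> 12 * h / \<delta> * norm w"
proof -
  obtain a where a: "\<And>i. i \<in> X \<Longrightarrow> i \<noteq> a \<Longrightarrow> \<delta> \<le> dist x i" using active_unique[of x] by blast
  have "norm (\<Sum>i\<in>X. (h * bump_deriv ((x - i) /\<^sub>R \<delta>) (w /\<^sub>R \<delta>)) *\<^sub>R v i) \<le> 2 * (h * (6 * (norm w / \<delta>)))"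
  proof (rule norm_sum_two_terms_le[of _ a a])
    fix i assume "i \<in> X"
    moreover have "\<bar>bump_deriv ((x - i) /\<^sub>R \<delta>) (w /\<^sub>R \<delta>)\<bar> \<le> 6 * (norm w / \<delta>)"
      using bump_deriv_bound[of "(x - i) /\<^sub>R \<delta>" "w /\<^sub>R \<delta>"] \<delta> by (simp add: divide_inverse mult.commute)
    ultimately show "norm ((h * bump_deriv ((x - i) /\<^sub>R \<delta>) (w /\<^sub>R \<delta>)) *\<^sub>R v i) \<le> h * (6 * (norm w / \<delta>))"
      by (rule norm_term_le)
  qed (use X a h \<delta> in \<open>auto simp: far_bump\<close>)
  then show ?thesis by (simp add: bump_field_deriv_def)
qed

lemma has_derivative_bump_field: "(bump_field h \<delta> X v has_derivative bump_field_deriv h \<delta> X v x) (at x)"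
proof -
  have "((\<lambda>x. bump ((x - i) /\<^sub>R \<delta>)) has_derivative (\<lambda>w. bump_deriv ((x - i) /\<^sub>R \<delta>) (w /\<^sub>R \<delta>))) (at x)" for i
    by (rule has_derivative_compose[OF _ has_derivative_bump]) (auto intro!: derivative_eq_intros)
  then show ?thesis
    unfolding bump_field_def[abs_def] bump_field_deriv_def[abs_def]
    by (intro has_derivative_sum has_derivative_scaleR_left has_derivative_mult_right)
qed

lemma C2_on_bump_field: "C2_on V (bump_field h \<delta> X v)"
proof -
  have "C2_on V (\<lambda>x. (h * bump ((x - i) /\<^sub>R \<delta>)) *\<^sub>R v i)" for i
  proof -
    have "C2_on V (\<lambda>x. x /\<^sub>R \<delta> + - (i /\<^sub>R \<delta>))"
      by (intro C2_on_add C2_on_const C2_on_bounded_linear bounded_linear_scaleR_right)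
    from C2_on_compose[OF C2_on_bump this, of UNIV]
    have "C2_on V (\<lambda>x. bump ((x - i) /\<^sub>R \<delta>))" by (simp add: scaleR_diff_right)
    from C2_on_compose[OF C2_on_bounded_linear this, of "\<lambda>t. (h * t) *\<^sub>R v i" UNIV]
    show ?thesis by (auto intro: bounded_linear_scaleR_const bounded_linear_mult_right)
  qed
  then show ?thesis unfolding bump_field_def[abs_def] by (intro C2_on_sum)
qed

lemma bump_field_at_site:
  assumes "i \<in> X" "dist z i < \<delta>"
  shows "bump_field h \<delta> X v z = (h * bump ((z - i) /\<^sub>R \<delta>)) *\<^sub>R v i"
proof -
  have "\<delta> \<le> dist z j" if "j \<in> X" "j \<noteq> i" for j
    using sep[of i j] assms that dist_triangle[of i j z] by (simp add: dist_commute)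
  then have "bump_field h \<delta> X v z = (\<Sum>j\<in>{i}. (h * bump ((z - j) /\<^sub>R \<delta>)) *\<^sub>R v j)"
    unfolding bump_field_def using X assms by (intro sum.mono_neutral_right) (auto simp: far_bump)
  then show ?thesis by simp
qed

lemma bump_field_far: "(\<And>i. i \<in> X \<Longrightarrow> \<delta> \<le> dist x i) \<Longrightarrow> bump_field h \<delta> X v x = 0"
  unfolding bump_field_def by (intro sum.neutral) (auto simp: far_bump)

end

section \<open>The bumped sphere as a submanifold of controlled reach\<close>

locale bumped_sphere = separated_bumps h \<delta> X v
  for h \<delta> :: real and X :: "((real^'d::finite) \<times> real) set" and v :: "(real^'d) \<times> real \<Rightarrow> real^'n::finite" +
  fixes A :: "(real^'d) \<times> real \<Rightarrow> real^'n" and R :: real and p0 :: "(real^'d) \<times> real"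
  assumes A: "linear A" "\<And>x. norm (A x) = norm x" and R: "0 < R"
    and p0: "norm p0 = R" "\<And>i. i \<in> X \<Longrightarrow> \<delta> \<le> dist p0 i"
    and slope: "real CARD('d) * (12 * h / \<delta>) \<le> 1 / 2"
begin

definition \<kappa> :: real where "\<kappa> = 12 * h / \<delta>"

text \<open>Defined on the whole linear space and not only on the sphere, so that estimates along
  straight segments apply. No bump reaches \<open>p0\<close>, which is therefore sent to the
  origin.\<close>

definition \<Psi> :: "(real^'d) \<times> real \<Rightarrow> real^'n" where "\<Psi> x = A (x - p0) + bump_field h \<delta> X v x"

abbreviation S :: "((real^'d) \<times> real) set" where "S \<equiv> sphere 0 R"

definition M :: "(real^'n) set" where "M = \<Psi> ` S"

lemma \<kappa>: "0 \<le> \<kappa>" "\<kappa> \<le> 1 / 2"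
proof -
  show "0 \<le> \<kappa>" using h \<delta> by (simp add: \<kappa>_def)
  have "1 * \<kappa> \<le> real CARD('d) * \<kappa>"
    using \<open>0 \<le> \<kappa>\<close> one_le_card_finite[where 'a='d] by (intro mult_right_mono) auto
  then show "\<kappa> \<le> 1 / 2" using slope by (simp add: \<kappa>_def)
qed

lemma \<Psi>_close: "norm (\<Psi> y - \<Psi> x - A (y - x)) \<le> \<kappa> * norm (y - x)"
proof -
  have "\<Psi> y - \<Psi> x - A (y - x) = bump_field h \<delta> X v y - bump_field h \<delta> X v x"
    by (simp add: \<Psi>_def linear_diff[OF A(1)])
  then show ?thesis using bump_field_lipschitz by (simp add: \<kappa>_def)
qed

lemma \<Psi>_expands: "(1 - \<kappa>) * dist x y \<le> dist (\<Psi> x) (\<Psi> y)"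
  using \<Psi>_close[of x y] A(2)[of "x - y"] norm_triangle_ineq2[of "A (x - y)" "A (x - y) - (\<Psi> x - \<Psi> y)"]
  by (simp add: dist_norm algebra_simps norm_minus_commute)

lemma \<Psi>_dist_le: "dist (\<Psi> x) (\<Psi> y) \<le> (1 + \<kappa>) * dist x y"
  using \<Psi>_close[of x y] A(2)[of "x - y"] norm_triangle_ineq[of "A (x - y)" "\<Psi> x - \<Psi> y - A (x - y)"]
  by (simp add: dist_norm algebra_simps)

lemma \<Psi>_inj: "inj \<Psi>"
proof (rule injI)
  fix x y assume "\<Psi> x = \<Psi> y"
  then have "(1 - \<kappa>) * dist x y \<le> 0" using \<Psi>_expands[of x y] by simp
  then show "x = y" using \<kappa> zero_le_dist[of x y] by (simp add: mult_le_0_iff)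
qed

lemma has_derivative_\<Psi>: "(\<Psi> has_derivative (\<lambda>w. A w + bump_field_deriv h \<delta> X v x w)) (at x)"
proof -
  have "((\<lambda>x. A (x - p0)) has_derivative A) (at x)"
    using linear_imp_has_derivative[OF A(1)]
    by (auto simp: linear_diff[OF A(1)] intro!: derivative_eq_intros)
  then show ?thesis
    unfolding \<Psi>_def[abs_def] by (intro has_derivative_add has_derivative_bump_field)
qed

lemma C2_on_\<Psi>: "C2_on V \<Psi>"
proof -
  have "C2_on V (\<lambda>x. A x + - A p0)"
    using A(1) by (intro C2_on_add C2_on_const C2_on_bounded_linear) (simp add: linear_conv_bounded_linear)
  then show ?thesis
    unfolding \<Psi>_def[abs_def] by (intro C2_on_add C2_on_bump_field) (simp add: linear_diff[OF A(1)])
qed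

lemma continuous_on_\<Psi>: "continuous_on V \<Psi>"
  using has_derivative_\<Psi> by (meson continuous_at_imp_continuous_on has_derivative_continuous)

lemma reach_M:
  assumes "2 * r * ((1 + \<kappa>) / (2 * R) + 6 * h / \<delta>\<^sup>2) \<le> (1 - \<kappa>)\<^sup>2"
  shows "ereal r \<le> reach M"
  unfolding M_def
proof (rule reach_sphere_image_ge[OF R \<kappa>(1) _ _ has_derivative_\<Psi> _ _ \<Psi>_expands assms])
  show "\<kappa> < 1" using \<kappa> by simp
  show "0 \<le> 6 * h / \<delta>\<^sup>2" using h by simp
  show "norm (A w + bump_field_deriv h \<delta> X v x w) \<le> (1 + \<kappa>) * norm w" for x w
    using norm_triangle_ineq[of "A w" "bump_field_deriv h \<delta> X v x w"] bump_field_deriv_bound[of x w] A(2)[of w]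
    by (simp add: \<kappa>_def algebra_simps)
  show "norm (\<Psi> y - \<Psi> x - (A (y - x) + bump_field_deriv h \<delta> X v x (y - x))) \<le> 6 * h / \<delta>\<^sup>2 * (norm (y - x))\<^sup>2" for x y
  proof -
    have "\<Psi> y - \<Psi> x - (A (y - x) + bump_field_deriv h \<delta> X v x (y - x))
        = bump_field h \<delta> X v y - bump_field h \<delta> X v x - bump_field_deriv h \<delta> X v x (y - x)"
      by (simp add: \<Psi>_def linear_diff[OF A(1)])
    then show ?thesis using bump_field_taylor[of y x] by (simp only:)
  qed
qed

lemma zero_in_M: "0 \<in> M"
proof -
  have "\<Psi> p0 = 0" using bump_field_far[OF p0(2)] by (simp add: \<Psi>_def linear_0[OF A(1)])
  then show ?thesis unfolding M_def using p0(1) by (metis image_eqI mem_sphere_0)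
qed

lemma compact_M: "compact M"
  unfolding M_def by (intro compact_continuous_image continuous_on_\<Psi> compact_sphere)

lemma connected_M: "connected M"
proof -
  have "2 \<le> DIM((real^'d) \<times> real)" using one_le_card_finite[where 'a='d] by simp
  then show ?thesis
    unfolding M_def by (intro connected_continuous_image continuous_on_\<Psi> connected_sphere)
qed

text \<open>The chart at \<open>\<Psi> x\<close> is the hemisphere graph, reflected so that its pole
  is x, followed by \<open>\<Psi>\<close>. By compactness \<open>\<Psi>\<close> is a homeomorphism
  of the sphere onto \<open>M\<close>, so the image of the open hemisphere \<open>T\<close> about x
  is relatively open in \<open>M\<close>; this produces the set \<open>U\<close>.\<close>

lemma C2_submanifold_M: "C2_submanifold TYPE('d) M"
  unfolding C2_submanifold_def
proof
  fix p assume "p \<in> M"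
  then obtain x where x: "norm x = R" "p = \<Psi> x" by (auto simp: M_def)
  have nx: "norm (0::real^'d, R) = norm x" using x R by (simp add: norm_Pair)
  obtain f where f: "linear f" "\<And>y. norm (f y) = norm y" "\<And>y. f (f y) = y" "f (0::real^'d, R) = x"
    using householder_reflection_exists[OF nx] by blast
  have fd: "dist (f y) (f z) = dist y z" for y z by (rule linear_norm_preserving_dist[OF f(1,2)])
  have fi: "f y \<bullet> f z = y \<bullet> z" for y z
  proof -
    have "orthogonal_transformation f" unfolding orthogonal_transformation using f(1,2) by blast
    then show ?thesis unfolding orthogonal_transformation_def by blast
  qed
  define T where "T = {y \<in> S. 0 < y \<bullet> x}"
  define V :: "(real^'d) set" where "V = ball 0 R"
  define \<phi> where "\<phi> a = \<Psi> (f (hemisphere_graph R a))" for a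
  obtain g where g: "homeomorphism S M \<Psi> g"
    using homeomorphism_compact[OF compact_sphere continuous_on_\<Psi>, of 0 R M] \<Psi>_inj
    unfolding M_def by (metis inj_on_subset subset_UNIV)
  have "openin (top_of_set S) T"
    unfolding T_def using openin_open_Int[of "{y. 0 < y \<bullet> x}" S] open_halfspace_gt[of 0 x]
    by (simp add: inner_commute Int_def conj_commute)
  then have "openin (top_of_set M) (\<Psi> ` T)"
    using homeomorphism_imp_open_map[OF g] by blast
  then obtain U where U: "open U" "\<Psi> ` T = M \<inter> U" by (auto simp: openin_open)
  have graph_T: "f (hemisphere_graph R a) \<in> T" if "a \<in> V" for a
  proof -
    have "(norm a)\<^sup>2 < R\<^sup>2" using that R by (auto simp: V_def intro: power_strict_mono)
    then have "0 < hemisphere_graph R a \<bullet> (0, R)" using R by (simp add: hemisphere_graph_def)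
    then have "0 < f (hemisphere_graph R a) \<bullet> x" using fi[of "hemisphere_graph R a" "(0, R)"] by (simp add: f(4))
    then show ?thesis using that by (simp add: T_def f(2) norm_hemisphere_graph V_def)
  qed
  have T_graph: "\<exists>a\<in>V. y = f (hemisphere_graph R a)" if "y \<in> T" for y
  proof -
    have y: "norm (f y) = R" "0 < y \<bullet> x" using that by (auto simp: T_def f(2))
    have "f y \<bullet> (0, R) = y \<bullet> x" using fi[of "f y" "(0, R)"] by (simp add: f(3,4))
    then have "0 < f y \<bullet> (0, R)" using y by simp
    then have s: "0 < snd (f y)" using R by (cases "f y") (simp add: zero_less_mult_iff)
    have "(norm (f y))\<^sup>2 = (norm (fst (f y)))\<^sup>2 + (snd (f y))\<^sup>2" by (cases "f y") (simp add: norm_Pair)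
    then have "(norm (fst (f y)))\<^sup>2 < R\<^sup>2" using s y(1) by simp
    then have "fst (f y) \<in> V" using R by (auto simp: V_def intro: power_less_imp_less_base)
    moreover have "f (hemisphere_graph R (fst (f y))) = y"
      using hemisphere_graph_fst[OF y(1)] s f(3) by simp
    ultimately show ?thesis by metis
  qed
  have im: "\<phi> ` V = M \<inter> U"
  proof -
    have "T = (\<lambda>a. f (hemisphere_graph R a)) ` V" using graph_T T_graph by blast
    then show ?thesis unfolding U(2)[symmetric] \<phi>_def[abs_def] by (simp add: image_image)
  qed
  have g\<Psi>: "g (\<Psi> y) = y" if "y \<in> T" for y using g that by (auto simp: homeomorphism_def T_def)
  have C2: "C2_on V \<phi>"
  proof -
    have "C2_on V (\<lambda>a. f (hemisphere_graph R a))"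
      by (rule C2_on_compose[where W=UNIV and f=f])
        (use f R C2_on_hemisphere_graph in \<open>auto simp: V_def linear_conv_bounded_linear intro: C2_on_bounded_linear\<close>)
    from C2_on_compose[OF C2_on_\<Psi>[of UNIV] this] show ?thesis by (simp add: \<phi>_def[abs_def])
  qed
  have "C2_immersion_on V \<phi>"
  proof (rule C2_immersion_onI[OF _ C2])
    show "0 < 1 - \<kappa>" using \<kappa> by simp
    show "(1 - \<kappa>) * dist a b \<le> dist (\<phi> a) (\<phi> b)" for a b
    proof -
      have "dist a b \<le> dist (hemisphere_graph R a) (hemisphere_graph R b)"
        using dist_fst_le[of "hemisphere_graph R a" "hemisphere_graph R b"] by (simp add: hemisphere_graph_def)
      then have "(1 - \<kappa>) * dist a b \<le> (1 - \<kappa>) * dist (f (hemisphere_graph R a)) (f (hemisphere_graph R b))"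
        using \<kappa> by (intro mult_left_mono) (auto simp: fd)
      then show ?thesis using \<Psi>_expands order_trans unfolding \<phi>_def by blast
    qed
  qed (simp add: V_def)
  moreover have "homeomorphism V (M \<inter> U) \<phi> (\<lambda>y. fst (f (g y)))"
  proof (rule homeomorphismI)
    show "continuous_on V \<phi>"
      using C2 unfolding C2_on_def by (meson continuous_at_imp_continuous_on has_derivative_continuous)
    have "continuous_on (M \<inter> U) g" using g by (auto simp: homeomorphism_def intro: continuous_on_subset)
    then show "continuous_on (M \<inter> U) (\<lambda>y. fst (f (g y)))"
      using f(1) by (rule continuous_on_fst[OF linear_continuous_on_compose])
    show "\<phi> ` V \<subseteq> M \<inter> U" using im by simp
    show inv: "fst (f (g (\<phi> a))) = a" if "a \<in> V" for a
      unfolding \<phi>_def g\<Psi>[OF graph_T[OF that]] f(3) by (simp add: hemisphere_graph_def)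
    show "(\<lambda>y. fst (f (g y))) ` (M \<inter> U) \<subseteq> V" unfolding im[symmetric] image_image using inv by simp
    show "\<phi> (fst (f (g y))) = y" if "y \<in> M \<inter> U" for y
    proof -
      obtain a where "a \<in> V" "y = \<phi> a" using \<open>y \<in> M \<inter> U\<close> unfolding im[symmetric] by blast
      then show ?thesis using inv by simp
    qed
  qed
  moreover have "p \<in> U"
  proof -
    have "x \<in> T" using x R by (simp add: T_def dot_square_norm)
    then show ?thesis using U(2) x(2) by blast
  qed
  ultimately show "\<exists>U V. \<exists>\<phi> :: real^'d \<Rightarrow> real^'n. \<exists>\<psi>. open U \<and> p \<in> U \<and> open V \<and> C2_immersion_on V \<phi> \<and> homeomorphism V (M \<inter> U) \<phi> \<psi>"
    using U(1) by (intro exI[of _ U] exI[of _ V] exI[of _ \<phi>] exI[of _ "\<lambda>y. fst (f (g y))"]) (simp add: V_def)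
qed

lemma M_in_manifold_class:
  assumes "2 * r * ((1 + \<kappa>) / (2 * R) + 6 * h / \<delta>\<^sup>2) \<le> (1 - \<kappa>)\<^sup>2"
  shows "M \<in> manifold_class TYPE('d) r"
  unfolding manifold_class_def using compact_M connected_M C2_submanifold_M reach_M[OF assms] by simp

text \<open>Bernoulli's inequality turns d \<kappa> \<le> 1/2 into (1 - \<kappa>)^d \<ge> 1/2. The
  slope of the bumps must therefore decrease with the dimension, which accounts for the d^2 in the
  bound on \<epsilon>.\<close>

lemma distortion: "(1 + \<kappa>) ^ CARD('d) \<le> 2" "(1 / (1 - \<kappa>)) ^ CARD('d) \<le> 2"
proof -
  have half: "1 / 2 \<le> (1 - \<kappa>) ^ CARD('d)"
    using Bernoulli_inequality[of "- \<kappa>" "CARD('d)"] \<kappa> slope by (simp add: \<kappa>_def[symmetric])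
  then show *: "(1 / (1 - \<kappa>)) ^ CARD('d) \<le> 2" by (simp add: power_divide field_simps)
  have "1 + \<kappa> \<le> 1 / (1 - \<kappa>)" using \<kappa> by (simp add: field_simps)
  then have "(1 + \<kappa>) ^ CARD('d) \<le> (1 / (1 - \<kappa>)) ^ CARD('d)" using \<kappa> by (intro power_mono) auto
  then show "(1 + \<kappa>) ^ CARD('d) \<le> 2" using * by linarith
qed

lemma hausdorff_outer_\<Psi>_image:
  "hausdorff_outer CARD('d) (\<Psi> ` B) \<le> 2 * hausdorff_outer CARD('d) B"
  "hausdorff_outer CARD('d) B \<le> 2 * hausdorff_outer CARD('d) (\<Psi> ` B)"
proof -
  have "hausdorff_outer CARD('d) (\<Psi> ` B) \<le> ennreal ((1 + \<kappa>) ^ CARD('d)) * hausdorff_outer CARD('d) B"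
    using \<kappa> \<Psi>_dist_le by (intro hausdorff_outer_lipschitz_image lipschitz_onI) auto
  also have "\<dots> \<le> ennreal 2 * hausdorff_outer CARD('d) B"
    using distortion by (intro mult_right_mono ennreal_leI) auto
  finally show "hausdorff_outer CARD('d) (\<Psi> ` B) \<le> 2 * hausdorff_outer CARD('d) B" by simp
  have "hausdorff_outer CARD('d) (inv \<Psi> ` \<Psi> ` B) \<le> ennreal ((1 / (1 - \<kappa>)) ^ CARD('d)) * hausdorff_outer CARD('d) (\<Psi> ` B)"
  proof (intro hausdorff_outer_lipschitz_image lipschitz_onI)
    fix y z assume "y \<in> \<Psi> ` B" "z \<in> \<Psi> ` B"
    then show "dist (inv \<Psi> y) (inv \<Psi> z) \<le> 1 / (1 - \<kappa>) * dist y z"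
      using \<Psi>_expands \<kappa> by (auto simp: inv_f_f[OF \<Psi>_inj] field_simps)
  qed (use \<kappa> in auto)
  also have "\<dots> \<le> ennreal 2 * hausdorff_outer CARD('d) (\<Psi> ` B)"
    using distortion by (intro mult_right_mono ennreal_leI) auto
  finally show "hausdorff_outer CARD('d) B \<le> 2 * hausdorff_outer CARD('d) (\<Psi> ` B)"
    by (simp add: image_image inv_f_f[OF \<Psi>_inj])
qed

end

section \<open>Uniform distributions on bumped spheres\<close>

context bumped_sphere
begin

text \<open>Starting from volume 1/(2 \<open>fmin\<close>), a distortion by at most 2 in either
  direction leaves a volume m between 1/(4 \<open>fmin\<close>) and 1/\<open>fmin\<close>. The
  constant density 1/m then lies in [\<open>fmin\<close>, 4 \<open>fmin\<close>], which is where the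
  gap between \<open>fmin\<close> and \<open>fmax\<close> enters.\<close>

lemma uniform_distribution_in_model:
  assumes num: "2 * r * ((1 + \<kappa>) / (2 * R) + 6 * h / \<delta>\<^sup>2) \<le> (1 - \<kappa>)\<^sup>2"
    and f: "0 < fmin" "fmin \<le> fmax / 4" and L: "0 \<le> L"
    and vol: "hausdorff_outer CARD('d) S = ennreal (1 / (2 * fmin))"
  obtains D where "D \<in> fixed_point_model TYPE('d) r fmin fmax L" "support D = M"
proof -
  let ?H = "hausdorff_measure CARD('d) :: (real^'n) measure"
  have Mb: "M \<in> sets borel" using compact_M by (intro borel_closed compact_imp_closed)
  have emM: "emeasure ?H B = hausdorff_outer CARD('d) B" if "B \<in> sets borel" for B
    using that by (intro emeasure_hausdorff_measure) auto
  have "hausdorff_outer CARD('d) M \<le> 2 * ennreal (1 / (2 * fmin))" "ennreal (1 / (2 * fmin)) \<le> 2 * hausdorff_outer CARD('d) M"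
    using hausdorff_outer_\<Psi>_image[of S] unfolding M_def vol by auto
  moreover have "2 * ennreal (1 / (2 * fmin)) = ennreal (1 / fmin)"
    using f by (subst ennreal_numeral[symmetric], subst ennreal_mult'[symmetric]) auto
  ultimately obtain m where m: "hausdorff_outer CARD('d) M = ennreal m" "0 \<le> m" "m \<le> 1 / fmin"
    by (cases "hausdorff_outer CARD('d) M") (auto simp: top_unique f less_imp_le)
  have "ennreal (1 / (2 * fmin)) \<le> ennreal (2 * m)"
    using \<open>_ \<le> 2 * hausdorff_outer CARD('d) M\<close> m by (simp add: ennreal_mult)
  then have m': "1 / (4 * fmin) \<le> m" using f m(2) by (subst (asm) ennreal_le_iff) (auto simp: field_simps)
  moreover have "0 < 1 / (4 * fmin)" using f by simp
  ultimately have m0: "0 < m" by linarith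
  have c: "fmin \<le> 1 / m" "1 / m \<le> fmax"
  proof -
    show "fmin \<le> 1 / m" using m(3) m0 f by (simp add: field_simps)
    have "1 / m \<le> 4 * fmin" using m' m0 f by (simp add: field_simps)
    then show "1 / m \<le> fmax" using f by simp
  qed
  define D where "D = density ?H (\<lambda>x. ennreal (1 / m) * indicator M x)"
  have setsD: "sets D = sets borel" by (simp add: D_def)
  have emD: "emeasure D B = ennreal (1 / m) * hausdorff_outer CARD('d) (M \<inter> B)" if B: "B \<in> sets borel" for B
  proof -
    have "emeasure D B = (\<integral>\<^sup>+x. ennreal (1 / m) * indicator M x * indicator B x \<partial>?H)"
      unfolding D_def using Mb B by (intro emeasure_density) auto
    also have "\<dots> = (\<integral>\<^sup>+x. ennreal (1 / m) * indicator (M \<inter> B) x \<partial>?H)"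
      by (intro nn_integral_cong) (auto split: split_indicator)
    also have "\<dots> = ennreal (1 / m) * emeasure ?H (M \<inter> B)"
      using Mb B by (intro nn_integral_cmult_indicator) auto
    finally show ?thesis using Mb B by (simp add: emM)
  qed
  have "prob_space D"
  proof
    have "emeasure D UNIV = ennreal (1 / m) * ennreal m" by (simp add: emD m(1))
    also have "\<dots> = 1" using m0 by (simp add: ennreal_mult'[symmetric])
    finally show "emeasure D (space D) = 1" using sets_eq_imp_space_eq[OF setsD] by simp
  qed
  moreover have supp: "support D = M"
  proof (intro equalityI subsetI)
    fix x assume "x \<in> support D"
    show "x \<in> M"
    proof (rule ccontr)
      assume "x \<notin> M"
      then have "x \<in> - M" "open (- M)" using compact_imp_closed[OF compact_M] by auto
      then obtain e where e: "0 < e" "ball x e \<subseteq> - M" using openE by blast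
      then have "M \<inter> ball x e = {}" by auto
      then have "emeasure D (ball x e) = 0" by (simp add: emD hausdorff_outer_empty)
      then show False using \<open>x \<in> support D\<close> e(1) by (auto simp: support_def)
    qed
  next
    fix x assume "x \<in> M"
    then obtain y where y: "y \<in> S" "x = \<Psi> y" by (auto simp: M_def)
    show "x \<in> support D"
      unfolding support_def
    proof (intro CollectI allI impI)
      fix e :: real assume e: "0 < e"
      \<comment> \<open>The radius is reduced by the Lipschitz constant of \<open>\<Psi>\<close>, so
        that the cap is mapped into the ball of radius e.\<close>
      define B where "B = S \<inter> ball y (e / (1 + \<kappa>))"
      have "0 < hausdorff_outer CARD('d) B"
        using hausdorff_outer_sphere_cap_pos[OF R _ y(1), of "e / (1 + \<kappa>)"] e \<kappa> by (simp add: B_def)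
      also have "\<dots> \<le> 2 * hausdorff_outer CARD('d) (\<Psi> ` B)" by (rule hausdorff_outer_\<Psi>_image)
      also have "\<dots> \<le> 2 * hausdorff_outer CARD('d) (M \<inter> ball x e)"
      proof (intro mult_left_mono hausdorff_outer_mono subsetI)
        fix z assume "z \<in> \<Psi> ` B"
        then obtain w where w: "w \<in> S" "dist y w < e / (1 + \<kappa>)" "z = \<Psi> w" by (auto simp: B_def)
        have "dist x z \<le> (1 + \<kappa>) * dist y w" using \<Psi>_dist_le w(3) y(2) by simp
        also have "\<dots> < e" using w(2) \<kappa> by (simp add: field_simps)
        finally show "z \<in> M \<inter> ball x e" using w by (auto simp: M_def)
      qed simp
      finally have "0 < hausdorff_outer CARD('d) (M \<inter> ball x e)" by (auto simp: zero_less_iff_neq_zero)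
      then show "0 < emeasure D (ball x e)" using m0 by (simp add: emD ennreal_zero_less_mult_iff)
    qed
  qed
  moreover have "L-lipschitz_on M (\<lambda>x. 1 / m)" using L by (intro lipschitz_onI) auto
  ultimately have "D \<in> fixed_point_model TYPE('d) r fmin fmax L"
    unfolding fixed_point_model_def using setsD M_in_manifold_class[OF num] c zero_in_M
    by (intro CollectI conjI exI[of _ M] exI[of _ "\<lambda>x. 1 / m"]) (auto simp: D_def)
  then show ?thesis using that supp by blast
qed

end

section \<open>Distance between two bumped spheres\<close>

lemma unit_vectors_apart:
  fixes v v' :: "'a::real_inner"
  assumes "norm v = 1" "norm v' = 1" "v \<bullet> v' \<le> 3 / 4" "0 \<le> b"
  shows "13 / 20 \<le> norm (v - b *\<^sub>R v')"
proof -
  have "(norm (v - b *\<^sub>R v'))\<^sup>2 = 1 + b\<^sup>2 - 2 * (b * (v \<bullet> v'))"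
    using assms(1,2) dot_square_norm[of "v - b *\<^sub>R v'"] dot_square_norm[of v] dot_square_norm[of v']
    by (simp add: inner_diff_left inner_diff_right inner_commute power2_eq_square)
  moreover have "b * (v \<bullet> v') \<le> b * (3 / 4)" using assms by (intro mult_left_mono) auto
  \<comment> \<open>The lower bound 1 + b^2 - 3 b / 2 is least at b = 3/4, with value 7/16 >
    (13/20)^2. The factor b is left free because it will be the unknown height of the second surface
    at a nearby point.\<close>
  moreover have "0 \<le> (b - 3 / 4)\<^sup>2" by simp
  ultimately have "(13 / 20)\<^sup>2 \<le> (norm (v - b *\<^sub>R v'))\<^sup>2"
    by (simp add: power2_eq_square algebra_simps)
  then show ?thesis by (rule power2_le_imp_le) simp
qed

text \<open>Near the site, the displacement between the two surfaces splits into a tangential part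
  and a part along the bump directions; the curvature of the sphere contributes only \<open>O(\<epsilon>\<^sup>2)\<close>.\<close>
lemma bumped_spheres_apart:
  fixes A :: "'a::euclidean_space \<Rightarrow> 'b::euclidean_space"
  assumes sb: "separated_bumps h \<delta> X v" "separated_bumps h \<delta> X v'"
    and A: "linear A" "\<And>x. norm (A x) = norm x"
    and i: "i \<in> X" "norm i = R" and z: "norm z = R" and R: "0 < R"
    and unit: "norm (v i) = 1" "norm (v' i) = 1" "v i \<bullet> v' i \<le> 3 / 4"
    and orth: "\<And>w. w \<bullet> i = 0 \<Longrightarrow> A w \<bullet> v i = 0" "\<And>w. w \<bullet> i = 0 \<Longrightarrow> A w \<bullet> v' i = 0"
    and \<epsilon>: "0 < \<epsilon>" "h = 4 * \<epsilon>" "16 * \<epsilon> \<le> \<delta>" "1280 * \<epsilon> \<le> R"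
  shows "5 / 2 * \<epsilon> \<le> dist (A (i - p0) + bump_field h \<delta> X v i) (A (z - p0) + bump_field h \<delta> X v' z)"
proof -
  interpret v: separated_bumps h \<delta> X v by (rule sb)
  interpret v': separated_bumps h \<delta> X v' by (rule sb)
  have vi: "bump_field h \<delta> X v i = h *\<^sub>R v i" using v.bump_field_at_site[of i i] i v.\<delta> by simp
  let ?diff = "A (i - p0) + bump_field h \<delta> X v i - (A (z - p0) + bump_field h \<delta> X v' z)"
  have diff: "?diff = A (i - z) + (h *\<^sub>R v i - bump_field h \<delta> X v' z)"
    by (simp add: vi linear_diff[OF A(1)])
  show ?thesis
  \<comment> \<open>Far from the site, the base points alone are 16 \<epsilon> apart and the two
    fields change this by at most h + 2 h = 12 \<epsilon>. Near it, z is within \<delta> of i, so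
    both fields come from this one site.\<close>
  proof (cases "16 * \<epsilon> \<le> dist i z")
    case True
    have "norm (h *\<^sub>R v i - bump_field h \<delta> X v' z) \<le> h + 2 * h"
      using norm_triangle_ineq4[of "h *\<^sub>R v i" "bump_field h \<delta> X v' z"] v'.norm_bump_field_le[of z] unit \<epsilon> by simp
    then have "16 * \<epsilon> - 12 * \<epsilon> \<le> norm ?diff"
      unfolding diff using norm_diff_ineq[of "A (i - z)" "h *\<^sub>R v i - bump_field h \<delta> X v' z"] True A(2)[of "i - z"] \<epsilon>(2)
      by (simp add: dist_norm)
    then show ?thesis using \<epsilon> by (simp add: dist_norm)
  next
    case False
    define b where "b = bump ((z - i) /\<^sub>R \<delta>)"
    have b: "bump_field h \<delta> X v' z = (h * b) *\<^sub>R v' i"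
      unfolding b_def using False \<epsilon> by (intro v'.bump_field_at_site[OF i(1)]) (simp add: dist_commute)
    define c where "c = ((i - z) \<bullet> i) / R\<^sup>2"
    define u where "u = c *\<^sub>R A i + h *\<^sub>R (v i - b *\<^sub>R v' i)"
    define t where "t = i - z - c *\<^sub>R i"
    have t: "t \<bullet> i = 0" using R i by (simp add: t_def c_def inner_diff_left dot_square_norm)
    have inner_A: "A x \<bullet> A y = x \<bullet> y" for x y
      using A(2)[of "x + y"] A(2)[of "x"] A(2)[of y]
      by (simp add: linear_add[OF A(1)] norm_eq_sqrt_inner inner_add_left inner_add_right inner_commute)
    have "A (i - z) = A t + c *\<^sub>R A i"
      unfolding t_def by (simp only: linear_diff[OF A(1)] linear_cmul[OF A(1)] diff_add_cancel)
    then have "A (i - z) + (h *\<^sub>R v i - bump_field h \<delta> X v' z) = A t + u"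
      unfolding b u_def by (simp add: scaleR_diff_right)
    then have d: "?diff = A t + u" using diff by (rule trans[rotated])
    \<comment> \<open>The tangential part \<open>A t\<close> is orthogonal to the rest, so
      discarding it can only shorten the displacement.\<close>
    have o: "A t \<bullet> u = 0"
      using orth[OF t] t by (simp add: u_def inner_add_right inner_diff_right inner_A)
    have "(norm (A t + u))\<^sup>2 = (norm (A t))\<^sup>2 + (norm u)\<^sup>2"
      by (rule norm_add_Pythagorean) (simp add: orthogonal_def o)
    then have "norm u \<le> norm (A t + u)" using power2_le_imp_le[of "norm u" "norm (A t + u)"] by simp
    \<comment> \<open>13/5 is the height factor 4 times 13/20, and \<epsilon> / 10 pays for the
      curvature of the sphere; together they leave 5/2 \<epsilon>.\<close>
    moreover have "13 / 5 * \<epsilon> - \<epsilon> / 10 \<le> norm u"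
    proof -
      have "13 / 20 \<le> norm (v i - b *\<^sub>R v' i)"
        using unit bump_range(1) by (intro unit_vectors_apart) (auto simp: b_def)
      then have "13 / 5 * \<epsilon> \<le> norm (h *\<^sub>R (v i - b *\<^sub>R v' i))" using \<epsilon> by simp
      \<comment> \<open>A chord of length l has radial component l^2 / (2 R); for l below 16
        \<epsilon> this is at most 128 \<epsilon>^2 / R, hence the requirement 1280 \<epsilon> \<le>
        R.\<close>
      moreover have "norm (c *\<^sub>R A i) \<le> \<epsilon> / 10"
      proof -
        have "(i - z) \<bullet> i = (dist i z)\<^sup>2 / 2"
          using i(2) z dot_square_norm[of i] dot_square_norm[of z] dot_square_norm[of "i - z"]
          by (simp add: dist_norm inner_diff_left inner_diff_right inner_commute)
        moreover have "(dist i z)\<^sup>2 \<le> (16 * \<epsilon>)\<^sup>2" using False by (intro power_mono) auto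
        ultimately have "\<bar>(i - z) \<bullet> i\<bar> \<le> (16 * \<epsilon>)\<^sup>2 / 2"
          using zero_le_power2[of "dist i z"] by (intro abs_leI; linarith)
        then have "\<bar>(i - z) \<bullet> i\<bar> / R\<^sup>2 * R \<le> ((16 * \<epsilon>)\<^sup>2 / 2) / R\<^sup>2 * R"
          using R by (intro mult_right_mono divide_right_mono) auto
        then have "norm (c *\<^sub>R A i) \<le> ((16 * \<epsilon>)\<^sup>2 / 2) / R\<^sup>2 * R"
          using i(2) A(2)[of i] by (simp add: c_def)
        also have "\<dots> = (1280 * \<epsilon>) * \<epsilon> / 10 / R" using R by (simp add: field_simps power2_eq_square)
        also have "\<dots> \<le> R * \<epsilon> / 10 / R" using \<epsilon> R by (intro divide_right_mono mult_right_mono) auto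
        also have "\<dots> = \<epsilon> / 10" using R by simp
        finally show ?thesis .
      qed
      ultimately show ?thesis
        unfolding u_def using norm_diff_ineq[of "h *\<^sub>R (v i - b *\<^sub>R v' i)" "c *\<^sub>R A i"] by (simp add: add.commute)
    qed
    ultimately show ?thesis unfolding dist_norm d by simp
  qed
qed

section \<open>Codes and normal frames\<close>

lemma sum_Pow_power_card:
  fixes x :: real
  assumes "finite K"
  shows "(\<Sum>W\<in>Pow K. x ^ card W) = (1 + x) ^ card K"
  using assms
proof induction
  case (insert a K)
  have "(\<Sum>W\<in>Pow (insert a K). x ^ card W) = (\<Sum>W\<in>Pow K. x ^ card W) + (\<Sum>W\<in>insert a ` Pow K. x ^ card W)"
    unfolding Pow_insert using insert by (intro sum.union_disjoint) auto
  also have "(\<Sum>W\<in>insert a ` Pow K. x ^ card W) = (\<Sum>W\<in>Pow K. x ^ card (insert a W))"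
    using insert(2) by (intro sum.reindex_cong[of "insert a"]) (auto simp: inj_on_def)
  also have "\<dots> = (\<Sum>W\<in>Pow K. x * x ^ card W)"
  proof (rule sum.cong)
    fix W assume "W \<in> Pow K"
    then have "finite W" "a \<notin> W" using insert(1,2) finite_subset by auto
    then show "x ^ card (insert a W) = x * x ^ card W" by simp
  qed simp
  finally show ?case using insert by (simp add: sum_distrib_left[symmetric] algebra_simps)
qed simp

text \<open>Gilbert--Varshamov: a maximal code of relative distance \<open>1/8\<close>; Hamming balls are
  counted by weighting a word of weight \<open>w\<close> with \<open>(1/4) ^ w\<close>.\<close>
lemma gilbert_varshamov_code:
  assumes K: "finite K" "K \<noteq> {}"
  obtains \<T> where "finite \<T>" "\<T> \<subseteq> Pow K" "exp (real (card K) / 4) \<le> real (card \<T>)"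
    "\<And>T T'. T \<in> \<T> \<Longrightarrow> T' \<in> \<T> \<Longrightarrow> T \<noteq> T' \<Longrightarrow> card K \<le> 8 * card (sym_diff T T')"
proof -
  define k where "k = card K"
  have k: "0 < k" using K by (simp add: k_def card_gt_0_iff)
  let ?far = "\<lambda>T T'. k \<le> 8 * card (sym_diff T T')"
  have bound: "card P \<le> card (Pow K)" if "P \<subseteq> Pow K" for P
    using that K(1) by (intro card_mono) auto
  obtain \<T> where T: "finite \<T>" "\<T> \<subseteq> Pow K" "pairwise ?far \<T>"
    and max: "\<And>U. U \<in> Pow K \<Longrightarrow> U \<in> \<T> \<or> (\<exists>T\<in>\<T>. \<not> ?far T U)"
    by (rule maximal_pairwise_subset[of ?far "Pow K" "card (Pow K)"]) (auto simp: Un_commute bound)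
  define W where "W = {U \<in> Pow K. 8 * card U < k}"
  have W: "finite W" using K(1) by (simp add: W_def)
  \<comment> \<open>Words in \<open>W\<close> have weight below k/8, so x^k is a lower bound for
    their terms in the weighted count, whose total over all words is (5/4)^k.\<close>
  define x where "x = (1 / 4 :: real) powr (1 / 8)"
  have x: "0 < x" by (simp add: x_def)
  have "Pow K \<subseteq> (\<Union>T\<in>\<T>. (\<lambda>V. sym_diff T V) ` W)"
  proof
    fix U assume U: "U \<in> Pow K"
    obtain T where T': "T \<in> \<T>" "\<not> ?far T U" using max[OF U] k by force
    then have "sym_diff T U \<in> W" using U T(2) by (auto simp: W_def)
    moreover have "U = sym_diff T (sym_diff T U)" by blast
    ultimately show "U \<in> (\<Union>T\<in>\<T>. (\<lambda>V. sym_diff T V) ` W)" using T'(1) by blast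
  qed
  then have "card (Pow K) \<le> card (\<Union>T\<in>\<T>. (\<lambda>V. sym_diff T V) ` W)"
    using T(1) W by (intro card_mono) auto
  also have "\<dots> \<le> (\<Sum>T\<in>\<T>. card ((\<lambda>V. sym_diff T V) ` W))" using T(1) by (rule card_UN_le)
  also have "\<dots> \<le> card \<T> * card W"
    using W by (intro sum_bounded_above[of \<T> _ "card W", simplified]) (auto intro: card_image_le)
  finally have "2 ^ k \<le> card \<T> * card W" using K(1) by (simp add: card_Pow k_def)
  then have count: "2 ^ k \<le> real (card \<T>) * real (card W)"
    by (metis of_nat_le_iff of_nat_mult of_nat_numeral of_nat_power)
  have "real (card W) * x ^ k \<le> (\<Sum>U\<in>W. (1 / 4) ^ card U)"
  proof -
    have "x ^ k \<le> (1 / 4) ^ card U" if "U \<in> W" for U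
    proof -
      have "x ^ k = (1 / 4) powr (real k / 8)" by (simp add: x_def powr_power)
      also have "\<dots> \<le> (1 / 4) powr real (card U)" using that by (intro powr_mono') (auto simp: W_def)
      finally show ?thesis by (simp add: powr_realpow)
    qed
    then show ?thesis using sum_mono[of W "\<lambda>_. x ^ k" "\<lambda>U. (1 / 4) ^ card U"] by simp
  qed
  also have "\<dots> \<le> (\<Sum>U\<in>Pow K. (1 / 4) ^ card U)"
    using K(1) by (intro sum_mono2) (auto simp: W_def)
  also have "\<dots> = (5 / 4) ^ k" using sum_Pow_power_card[OF K(1), of "1/4"] by (simp add: k_def)
  finally have "real (card \<T>) * (real (card W) * x ^ k) \<le> real (card \<T>) * (5 / 4) ^ k"
    by (intro mult_left_mono) auto
  moreover have "2 ^ k * x ^ k \<le> real (card \<T>) * real (card W) * x ^ k"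
    using count x by (intro mult_right_mono) auto
  ultimately have vol: "2 ^ k * x ^ k \<le> real (card \<T>) * (5 / 4) ^ k" by (simp add: mult.assoc)
  have "(8 / 5 * x) ^ k \<le> real (card \<T>)"
  proof -
    have "(8 / 5 * x) ^ k * (5 / 4) ^ k = 2 ^ k * x ^ k" by (simp only: power_mult_distrib[symmetric]) simp
    then have "(8 / 5 * x) ^ k * (5 / 4) ^ k \<le> real (card \<T>) * (5 / 4) ^ k" using vol by (simp only:)
    then show ?thesis by (rule mult_right_le_imp_le) simp
  qed
  moreover have "exp (real k / 4) \<le> (8 / 5 * x) ^ k"
  proof -
    have "x ^ 4 = 1 / 2"
    proof -
      have "x ^ 4 = (1 / 4) powr (1 / 2)" by (simp add: x_def powr_power)
      also have "\<dots> = 1 / 2" by (simp add: powr_half_sqrt real_sqrt_divide)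
      finally show ?thesis .
    qed
    \<comment> \<open>(8/5)^4 / 2 = 3.2768 exceeds 3, the bound used for
      \<open>exp 1\<close>.\<close>
    then have "exp (1 / 4) ^ 4 \<le> (8 / 5 * x) ^ 4"
      using exp_le by (simp add: exp_of_nat_mult[symmetric] power_mult_distrib power_divide)
    then have "exp (1 / 4) \<le> 8 / 5 * x"
      using x power_strict_mono[of "8 / 5 * x" "exp (1 / 4)" 4] by (force simp: not_le[symmetric])
    then have "exp (1 / 4) ^ k \<le> (8 / 5 * x) ^ k" by (intro power_mono) auto
    then show ?thesis by (simp add: exp_of_nat_mult[symmetric])
  qed
  ultimately have "exp (real k / 4) \<le> real (card \<T>)" by linarith
  then show ?thesis
    using that[of \<T>] T by (auto simp: k_def pairwise_def)
qed

text \<open>For an orthonormal family, a vertex of the cube inscribed in the unit sphere of its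
  span. Inner products are affine in the Hamming distance, so relative distance 1/8 of the codewords
  becomes inner product at most 3/4.\<close>

definition sign_vector :: "'i set \<Rightarrow> ('i \<Rightarrow> 'b::real_vector) \<Rightarrow> 'i set \<Rightarrow> 'b" where
  "sign_vector K u T = (1 / sqrt (real (card K))) *\<^sub>R (\<Sum>j\<in>K. (if j \<in> T then 1 else - 1) *\<^sub>R u j)"

lemma inner_sign_vector:
  fixes u :: "'i \<Rightarrow> 'b::real_inner"
  assumes K: "finite K" "K \<noteq> {}" and T: "T \<subseteq> K" "T' \<subseteq> K"
    and u: "\<And>j l. j \<in> K \<Longrightarrow> l \<in> K \<Longrightarrow> u j \<bullet> u l = (if j = l then 1 else 0)"
  shows "sign_vector K u T \<bullet> sign_vector K u T' = 1 - 2 * real (card (sym_diff T T')) / real (card K)"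
proof -
  let ?s = "\<lambda>T j. if j \<in> T then 1 else - 1 :: real"
  let ?k = "real (card K)"
  have k: "0 < ?k" using K by (simp add: card_gt_0_iff)
  have "(\<Sum>j\<in>K. ?s T j *\<^sub>R u j) \<bullet> (\<Sum>j\<in>K. ?s T' j *\<^sub>R u j) = (\<Sum>j\<in>K. \<Sum>l\<in>K. ?s T j * ?s T' l * (u j \<bullet> u l))"
    by (simp add: inner_sum_left inner_sum_right mult.assoc mult.left_commute sum_distrib_left del: if_distrib)
      (subst sum.swap, simp only: mult.left_commute)
  also have "\<dots> = (\<Sum>j\<in>K. \<Sum>l\<in>K. if l = j then ?s T j * ?s T' l else 0)"
    by (intro sum.cong refl) (simp add: u)
  also have "\<dots> = (\<Sum>j\<in>K. ?s T j * ?s T' j)" using K(1) by (simp add: sum.delta)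
  also have "\<dots> = (\<Sum>j\<in>K. 1 - 2 * (if j \<in> sym_diff T T' then 1 else 0))"
    by (intro sum.cong) auto
  also have "\<dots> = ?k - 2 * real (card (sym_diff T T'))"
  proof -
    have "K \<inter> {j. j \<in> sym_diff T T'} = sym_diff T T'" using T by auto
    then have "(\<Sum>j\<in>K. if j \<in> sym_diff T T' then 1 else 0 :: real) = real (card (sym_diff T T'))"
      using K(1) by (simp only: sum.If_cases) simp
    then show ?thesis by (simp only: sum_subtractf sum_distrib_left[symmetric]) simp
  qed
  finally show ?thesis
    unfolding sign_vector_def using k by (simp add: diff_divide_distrib power2_eq_square[symmetric])
qed

lemma normal_frames:
  assumes "CARD('d::finite) < CARD('n::finite)"
  obtains A :: "(real^'d) \<times> real \<Rightarrow> real^'n" and K :: "'n set" and u :: "(real^'d) \<times> real \<Rightarrow> 'n \<Rightarrow> real^'n"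
  where "linear A" "\<And>x. norm (A x) = norm x" "card K + CARD('d) = CARD('n)"
    "\<And>x j l. x \<noteq> 0 \<Longrightarrow> j \<in> K \<Longrightarrow> l \<in> K \<Longrightarrow> u x j \<bullet> u x l = (if j = l then 1 else 0)"
    "\<And>x w j. w \<bullet> x = 0 \<Longrightarrow> j \<in> K \<Longrightarrow> A w \<bullet> u x j = 0"
proof -
  obtain \<iota> :: "'d \<Rightarrow> 'n" where \<iota>: "inj \<iota>"
    using card_le_inj[of "UNIV :: 'd set" "UNIV :: 'n set"] assms by auto
  define K where "K = - range \<iota>"
  have cK: "card K + CARD('d) = CARD('n)"
    using card_image[OF \<iota>] assms by (simp add: K_def Compl_eq_Diff_UNIV card_Diff_subset)
  then have "K \<noteq> {}" using assms by force
  then obtain c where c: "c \<in> K" by auto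
  define A :: "(real^'d) \<times> real \<Rightarrow> real^'n" where
    "A y = (\<chi> j. if j \<in> range \<iota> then fst y $ inv \<iota> j else if j = c then snd y else 0)" for y
  have "linear A" by (rule linearI) (auto simp: A_def vec_eq_iff)
  have inner_A: "A y \<bullet> A z = y \<bullet> z" for y z
  proof -
    have "A y \<bullet> A z = (\<Sum>j\<in>UNIV. A y $ j * A z $ j)" by (simp add: inner_vec_def)
    also have "\<dots> = (\<Sum>j\<in>insert c (range \<iota>). A y $ j * A z $ j)"
      by (intro sum.mono_neutral_right) (auto simp: A_def)
    also have "\<dots> = A y $ c * A z $ c + (\<Sum>j\<in>range \<iota>. A y $ j * A z $ j)"
      using c by (intro sum.insert) (auto simp: K_def)
    also have "(\<Sum>j\<in>range \<iota>. A y $ j * A z $ j) = (\<Sum>i\<in>UNIV. fst y $ i * fst z $ i)"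
      using \<iota> by (intro sum.reindex_cong[of \<iota>]) (auto simp: A_def)
    finally have "A y \<bullet> A z = A y $ c * A z $ c + (\<Sum>i\<in>UNIV. fst y $ i * fst z $ i)" .
    moreover have "A y $ c = snd y" "A z $ c = snd z" using c by (auto simp: A_def K_def)
    ultimately show ?thesis by (cases y, cases z) (simp add: inner_vec_def)
  qed
  have A_K: "A y $ j = 0" if "j \<in> K" "j \<noteq> c" for y j using that by (auto simp: A_def K_def)
  \<comment> \<open>Only the vector in slot c depends on x; the other axes are orthogonal to the
    whole range of \<open>A\<close>.\<close>
  define u :: "(real^'d) \<times> real \<Rightarrow> 'n \<Rightarrow> real^'n" where
    "u x j = (if j = c then A x /\<^sub>R norm x else axis j 1)" for x j
  show ?thesis
  proof (rule that[of A K u])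
    show nA: "norm (A x) = norm x" for x by (simp add: norm_eq_sqrt_inner inner_A)
    show "u x j \<bullet> u x l = (if j = l then 1 else 0)" if "x \<noteq> 0" "j \<in> K" "l \<in> K" for x j l
      using that by (auto simp: u_def nA A_K inner_axis inner_axis' dot_square_norm power2_eq_square) (simp add: axis_def)
    show "A w \<bullet> u x j = 0" if "w \<bullet> x = 0" "j \<in> K" for w x j
      using that by (auto simp: u_def inner_A A_K inner_axis)
  qed fact+
qed

section \<open>Statistical query algorithms\<close>

text \<open>Both suprema are evaluated at the single point x, whose distance to \<open>K\<close>
  would have to be at most \<epsilon> and at least c - \<epsilon>. Distances are extended reals
  because \<open>K\<close>, an arbitrary output of an algorithm, may be empty.\<close>

lemma hausdorff_distance_incompatible:
  assumes x: "x \<in> M" and far: "\<And>y. y \<in> M' \<Longrightarrow> c \<le> dist y x" and c: "2 * \<epsilon> < c"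
  shows "\<not> (hausdorff_distance M K \<le> ereal \<epsilon> \<and> hausdorff_distance M' K \<le> ereal \<epsilon>)"
proof
  assume H: "hausdorff_distance M K \<le> ereal \<epsilon> \<and> hausdorff_distance M' K \<le> ereal \<epsilon>"
  have "einfdist x M \<le> 0" unfolding einfdist_def using x by (intro INF_lower2[of x]) auto
  moreover have "0 \<le> einfdist x M" unfolding einfdist_def by (intro INF_greatest) auto
  ultimately have M: "einfdist x M = 0" by simp
  have M': "ereal c \<le> einfdist x M'" unfolding einfdist_def using far by (intro INF_greatest) auto
  have "\<bar>einfdist x M - einfdist x K\<bar> \<le> hausdorff_distance M K"
    "\<bar>einfdist x M' - einfdist x K\<bar> \<le> hausdorff_distance M' K"
    unfolding hausdorff_distance_def by (intro SUP_upper UNIV_I)+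
  then have "\<bar>0 - einfdist x K\<bar> \<le> ereal \<epsilon>" "\<bar>einfdist x M' - einfdist x K\<bar> \<le> ereal \<epsilon>"
    using H M by (auto intro: order_trans)
  then show False
    using M' c by (cases "einfdist x K"; cases "einfdist x M'") auto
qed

text \<open>The values are the midpoints of consecutive intervals of length 2 \<tau> starting at -1;
  rounding 1/\<tau> up to an integer number of them gives the summand 1.\<close>

lemma oracle_grid:
  fixes \<tau> :: real
  assumes \<tau>: "0 < \<tau>"
  obtains V where "finite V" "real (card V) \<le> 1 + 1 / \<tau>" "\<And>x. \<bar>x\<bar> \<le> 1 \<Longrightarrow> \<exists>a\<in>V. \<bar>a - x\<bar> \<le> \<tau>"
proof -
  define m where "m = nat \<lceil>1 / \<tau>\<rceil>"
  have pos: "0 < 1 / \<tau>" using \<tau> by simp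
  have m: "1 / \<tau> \<le> real m" "real m \<le> 1 + 1 / \<tau>" "0 < m"
    using pos by (auto simp: m_def) linarith+
  define g where "g j = -1 + \<tau> * (2 * real j + 1)" for j
  have "\<exists>a\<in>g ` {..<m}. \<bar>a - x\<bar> \<le> \<tau>" if x: "\<bar>x\<bar> \<le> 1" for x
  proof -
    define y where "y = (x + 1) / (2 * \<tau>)"
    have xy: "x = 2 * \<tau> * y - 1" using \<tau> by (simp add: y_def)
    have y: "0 \<le> y" "y \<le> 1 / \<tau>" using x \<tau> by (auto simp: y_def field_simps abs_le_iff)
    have gx: "\<bar>g j - x\<bar> = \<tau> * \<bar>2 * real j + 1 - 2 * y\<bar>" for j
    proof -
      have "g j - x = \<tau> * (2 * real j + 1 - 2 * y)" by (simp add: g_def xy algebra_simps)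
      then show ?thesis using \<tau> by (simp add: abs_mult)
    qed
    \<comment> \<open>The cap matters only for y = m, the right end of the last interval, where
      rounding down would leave the grid.\<close>
    define j where "j = min (nat \<lfloor>y\<rfloor>) (m - 1)"
    have "\<bar>2 * real j + 1 - 2 * y\<bar> \<le> 1"
    proof (cases "nat \<lfloor>y\<rfloor> < m")
      case True
      then have "j = nat \<lfloor>y\<rfloor>" by (auto simp: j_def)
      then have "real j \<le> y" "y < real j + 1" using y(1) by auto
      then show ?thesis by (auto simp: abs_le_iff)
    next
      case False
      then have "real m \<le> y" using y(1) by (simp add: le_nat_floor not_less le_nat_iff le_floor_iff)
      then have "y = real m" using y m by linarith
      moreover have "real j = real m - 1" using False m(3) by (auto simp: j_def min_def of_nat_diff)
      ultimately show ?thesis by simp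
    qed
    then have "\<bar>g j - x\<bar> \<le> \<tau>" unfolding gx using \<tau> by (simp add: mult_left_le)
    moreover have "j < m" using m(3) by (auto simp: j_def)
    ultimately show ?thesis by blast
  qed
  moreover have "real (card (g ` {..<m})) \<le> 1 + 1 / \<tau>"
    using card_image_le[of "{..<m}" g] m(2) by simp
  ultimately show ?thesis using that[of "g ` {..<m}"] by simp
qed

lemma sq_run_answers:
  assumes "\<And>qs. orc qs \<in> V"
  shows "set (snd (sq_run Q orc i)) \<subseteq> V \<and> length (snd (sq_run Q orc i)) = i"
  by (induction i) (auto simp: Let_def assms split: prod.splits)

text \<open>An oracle that rounds to a grid of at most \<open>1 + 1/\<tau>\<close> values leaves each deterministic algorithm
  at most \<open>(1 + 1/\<tau>) ^ q\<close> outputs, and each output is correct for at most one distribution.\<close>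
lemma sq_packing_bound:
  fixes \<Omega> :: "'w measure" and Qs :: "'w \<Rightarrow> nat \<Rightarrow> real list \<Rightarrow> (real^'n::finite \<Rightarrow> real)"
    and Out :: "'w \<Rightarrow> real list \<Rightarrow> (real^'n) set" and Dm :: "'i \<Rightarrow> (real^'n) measure"
  assumes \<tau>: "0 < \<tau>" and \<Omega>: "prob_space \<Omega>" and I: "finite I"
    and D: "\<And>i. i \<in> I \<Longrightarrow> prob_space (Dm i)" "\<And>i. i \<in> I \<Longrightarrow> sets (Dm i) = sets borel"
    and sep: "\<And>i j K. i \<in> I \<Longrightarrow> j \<in> I \<Longrightarrow> i \<noteq> j \<Longrightarrow>
        \<not> (hausdorff_distance (support (Dm i)) K \<le> ereal \<epsilon> \<and> hausdorff_distance (support (Dm j)) K \<le> ereal \<epsilon>)"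
    and est: "\<And>i orc. i \<in> I \<Longrightarrow> stat_oracle \<tau> (Dm i) orc \<Longrightarrow>
        \<exists>E \<in> sets \<Omega>. measure \<Omega> E \<ge> 1 - \<alpha> \<and>
          (\<forall>\<omega>\<in>E. hausdorff_distance (support (Dm i)) (Out \<omega> (snd (sq_run (Qs \<omega>) orc q))) \<le> ereal \<epsilon>)"
  shows "real (card I) * (1 - \<alpha>) \<le> (1 + 1 / \<tau>) ^ q"
proof -
  interpret prob_space \<Omega> by (rule \<Omega>)
  obtain V where V: "finite V" "real (card V) \<le> 1 + 1 / \<tau>" "\<And>x. \<bar>x\<bar> \<le> 1 \<Longrightarrow> \<exists>a\<in>V. \<bar>a - x\<bar> \<le> \<tau>"
    using oracle_grid[OF \<tau>] by blast
  \<comment> \<open>Rounding is made total with values in \<open>V\<close>, so that every answer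
    lies in \<open>V\<close> whatever the query. The instance at 0 supplies an element of
    \<open>V\<close> for numbers outside the range.\<close>
  have "\<exists>a\<in>V. \<bar>x\<bar> \<le> 1 \<longrightarrow> \<bar>a - x\<bar> \<le> \<tau>" for x using V(3)[of x] V(3)[of 0] by (cases "\<bar>x\<bar> \<le> 1") auto
  then obtain rnd where rnd: "\<And>x. rnd x \<in> V" "\<And>x. \<bar>x\<bar> \<le> 1 \<Longrightarrow> \<bar>rnd x - x\<bar> \<le> \<tau>" by metis
  define orc where "orc i qs = rnd (integral\<^sup>L (Dm i) (last qs))" for i and qs :: "(real^'n \<Rightarrow> real) list"
  have "stat_oracle \<tau> (Dm i) (orc i)" if "i \<in> I" for i
    unfolding stat_oracle_def orc_def
  proof (intro allI impI)
    fix hs and r :: "real^'n \<Rightarrow> real" assume r: "r \<in> sq_queries"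
    interpret D: prob_space "Dm i" by (rule D(1)[OF that])
    have r': "r \<in> borel_measurable (Dm i)" "\<And>x. \<bar>r x\<bar> \<le> 1"
      using r D(2)[OF that] by (auto simp: sq_queries_def cong: measurable_cong_sets)
    have int: "integrable (Dm i) r" using r' by (intro D.integrable_const_bound[of _ 1]) auto
    have "\<bar>integral\<^sup>L (Dm i) r\<bar> \<le> integral\<^sup>L (Dm i) (\<lambda>x. \<bar>r x\<bar>)" by (rule integral_abs_bound)
    also have "\<dots> \<le> integral\<^sup>L (Dm i) (\<lambda>x. 1)" using int r'(2) by (intro integral_mono) auto
    also have "\<dots> = 1" by (simp add: D.prob_space)
    finally show "\<bar>rnd (integral\<^sup>L (Dm i) (last (hs @ [r]))) - integral\<^sup>L (Dm i) r\<bar> \<le> \<tau>" using rnd(2) by simp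
  qed
  then have "\<exists>E. \<forall>i\<in>I. E i \<in> sets \<Omega> \<and> measure \<Omega> (E i) \<ge> 1 - \<alpha> \<and>
      (\<forall>\<omega>\<in>E i. hausdorff_distance (support (Dm i)) (Out \<omega> (snd (sq_run (Qs \<omega>) (orc i) q))) \<le> ereal \<epsilon>)"
    using est by (intro bchoice) blast
  then obtain E where E: "\<And>i. i \<in> I \<Longrightarrow> E i \<in> sets \<Omega>" "\<And>i. i \<in> I \<Longrightarrow> measure \<Omega> (E i) \<ge> 1 - \<alpha>"
    "\<And>i \<omega>. i \<in> I \<Longrightarrow> \<omega> \<in> E i \<Longrightarrow> hausdorff_distance (support (Dm i)) (Out \<omega> (snd (sq_run (Qs \<omega>) (orc i) q))) \<le> ereal \<epsilon>"
    by blast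
  \<comment> \<open>For a fixed draw \<omega>, two indices with the same answers receive the same
    output, which cannot be close to both supports. Successful indices therefore inject into the
    words of length q over \<open>V\<close>.\<close>
  have count: "(\<Sum>i\<in>I. indicator (E i) \<omega> :: real) \<le> (1 + 1 / \<tau>) ^ q" for \<omega>
  proof -
    let ?J = "{i\<in>I. \<omega> \<in> E i}"
    have "inj_on (\<lambda>i. snd (sq_run (Qs \<omega>) (orc i) q)) ?J"
    proof (rule inj_onI, rule ccontr)
      fix i j assume ij: "i \<in> ?J" "j \<in> ?J" "snd (sq_run (Qs \<omega>) (orc i) q) = snd (sq_run (Qs \<omega>) (orc j) q)" "i \<noteq> j"
      then show False using sep[of i j "Out \<omega> (snd (sq_run (Qs \<omega>) (orc i) q))"] E(3)[of i \<omega>] E(3)[of j \<omega>] by simp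
    qed
    moreover have "(\<lambda>i. snd (sq_run (Qs \<omega>) (orc i) q)) ` ?J \<subseteq> {xs. set xs \<subseteq> V \<and> length xs = q}"
      using sq_run_answers[of "orc _" V "Qs \<omega>" q] rnd(1) by (fastforce simp: orc_def)
    ultimately have "card ?J \<le> card {xs. set xs \<subseteq> V \<and> length xs = q}"
      using finite_lists_length_eq[OF V(1)] by (intro card_inj_on_le)
    also have "\<dots> = card V ^ q" by (rule card_lists_length_eq[OF V(1)])
    finally have "real (card ?J) \<le> real (card V) ^ q" by (metis of_nat_le_iff of_nat_power)
    also have "\<dots> \<le> (1 + 1 / \<tau>) ^ q" using V(2) by (intro power_mono) auto
    finally show ?thesis using I by (simp add: indicator_def sum.If_cases Int_def)
  qed
  \<comment> \<open>Double counting: the success probabilities are summed over the indices, and the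
    pointwise count is integrated over the draw.\<close>
  have "real (card I) * (1 - \<alpha>) \<le> (\<Sum>i\<in>I. measure \<Omega> (E i))"
    using sum_mono[of I "\<lambda>_. 1 - \<alpha>" "\<lambda>i. measure \<Omega> (E i)"] E(2) by simp
  also have "\<dots> = (\<Sum>i\<in>I. integral\<^sup>L \<Omega> (indicator (E i)))"
    using E(1) by (intro sum.cong) auto
  also have "\<dots> = integral\<^sup>L \<Omega> (\<lambda>\<omega>. \<Sum>i\<in>I. indicator (E i) \<omega>)"
    using E(1) by (subst Bochner_Integration.integral_sum) (auto intro!: integrable_const_bound[of _ 1] simp: indicator_def)
  also have "\<dots> \<le> integral\<^sup>L \<Omega> (\<lambda>\<omega>. (1 + 1 / \<tau>) ^ q)"
    using E(1) count by (intro integral_mono Bochner_Integration.integrable_sum) (auto intro!: integrable_const_bound[of _ 1] simp: indicator_def)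
  also have "\<dots> = (1 + 1 / \<tau>) ^ q" by (simp add: prob_space)
  finally show ?thesis .
qed

section \<open>The packing\<close>

text \<open>\<open>sphere_volume\<close> is defined through \<open>measure\<close>, which sends an
  infinite value to 0. A finite net excludes this, and a single cap gives positivity.\<close>

lemma sphere_volume_pos_finite:
  shows "0 < sphere_volume TYPE('d::finite)"
    and "hausdorff_outer CARD('d) (sphere (0::(real^'d) \<times> real) 1) = ennreal (sphere_volume TYPE('d))"
proof -
  let ?S = "sphere (0::(real^'d) \<times> real) 1"
  have em: "emeasure (hausdorff_measure CARD('d)) ?S = hausdorff_outer CARD('d) ?S"
    by (intro emeasure_hausdorff_measure) (auto intro: borel_closed)
  obtain P :: "((real^'d) \<times> real) set" where
    "hausdorff_outer (DIM(real^'d)) ?S \<le> ennreal (real (card P) * (unit_ball_vol (DIM(real^'d)) * (9 / 4 * (1 / 20)) ^ DIM(real^'d)))"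
    by (rule sphere_net[of 1 "1/20", where 'a="real^'d"]) auto
  then have fin: "hausdorff_outer CARD('d) ?S \<noteq> top" by (auto simp: top_unique)
  then show eq: "hausdorff_outer CARD('d) ?S = ennreal (sphere_volume TYPE('d))"
    by (simp add: sphere_volume_def measure_def em less_top)
  have "(0::real^'d, 1::real) \<in> ?S" by (simp add: norm_Pair)
  then have "0 < hausdorff_outer (DIM(real^'d)) (?S \<inter> ball (0, 1) 1)"
    by (intro hausdorff_outer_sphere_cap_pos) auto
  also have "\<dots> \<le> hausdorff_outer (DIM(real^'d)) ?S" by (intro hausdorff_outer_mono) auto
  finally show "0 < sphere_volume TYPE('d)" by (simp add: eq)
qed

lemma power_32_ge: "1 \<le> d \<Longrightarrow> 16 * (1 + real d) \<le> 32 ^ d"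
  by (induction d rule: dec_induct) auto

text \<open>Since 1440 = 32 * 45, the net beats the target by 32^d, which must pay for 16 (1 + d): a
  factor 2 from the volume 1/(2 f), 2 from N - 1 \<ge> N / 2, 4 from the rate of the code, and 1 + d
  from replacing k + d by k.\<close>

lemma packing_count:
  fixes k d N :: nat and \<omega> f \<rho> e y :: real
  assumes d: "1 \<le> d" and k: "1 \<le> k" and N: "2 \<le> N"
    and pos: "0 < \<omega>" "0 < f" "0 < \<rho>" "0 < e" "0 \<le> y" and y: "y * (1440 * e) \<le> 1"
    and vol: "1 / (2 * f) \<le> real N * (\<omega> * (45 * e * \<rho>) ^ d)"
  shows "real (k + d) / (\<omega> * f * \<rho> ^ d) * y ^ d \<le> real (N - 1) * (real k / 4)"
proof -
  define Z where "Z = 1 / (f * \<omega> * \<rho> ^ d * (1440 * e) ^ d)"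
  have Z: "0 < Z" using pos by (simp add: Z_def)
  have "y ^ d * (1440 * e) ^ d \<le> 1"
    unfolding power_mult_distrib[symmetric] using y pos by (intro power_le_one) auto
  then have "y ^ d \<le> 1 / (1440 * e) ^ d" using pos by (simp add: pos_le_divide_eq)
  then have "1 / (\<omega> * f * \<rho> ^ d) * y ^ d \<le> 1 / (\<omega> * f * \<rho> ^ d) * (1 / (1440 * e) ^ d)"
    using pos by (intro mult_left_mono) auto
  also have "\<dots> = Z" by (simp add: Z_def ac_simps)
  finally have lhs: "1 / (\<omega> * f * \<rho> ^ d) * y ^ d \<le> Z" .
  have "32 ^ d * Z / 2 = (1 / (2 * f)) / (\<omega> * (45 * e * \<rho>) ^ d)"
  proof -
    have cancel: "c * (1 / (f * \<omega> * b * (c * a))) / 2 = (1 / (2 * f)) / (\<omega> * (a * b))"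
      if "0 < c" for a b c :: real using that by (simp add: field_simps)
    have "(1440 * e) ^ d = 32 ^ d * (45 * e) ^ d" by (simp only: power_mult_distrib[symmetric]) simp
    then show ?thesis unfolding Z_def power_mult_distrib[of "45 * e"] by (simp only:) (rule cancel, simp)
  qed
  also have "\<dots> \<le> real N" using vol pos by (subst pos_divide_le_eq) auto
  finally have "32 ^ d * Z / 2 \<le> real N" .
  moreover have "real N / 2 \<le> real (N - 1)" using N by (simp add: of_nat_diff)
  moreover have "16 * (1 + real d) * Z \<le> 32 ^ d * Z" using power_32_ge[OF d] Z by (intro mult_right_mono) auto
  ultimately have "4 * (1 + real d) * Z \<le> real (N - 1)" by linarith
  then have "4 * (1 + real d) * Z * (real k / 4) \<le> real (N - 1) * (real k / 4)" by (intro mult_right_mono) auto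
  moreover have "real (k + d) * Z \<le> (real k * (1 + real d)) * Z"
  proof (rule mult_right_mono)
    have "1 * real d \<le> real k * real d" using k by (intro mult_right_mono) auto
    then show "real (k + d) \<le> real k * (1 + real d)" by (simp add: algebra_simps)
  qed (use Z in auto)
  moreover have "real (k + d) / (\<omega> * f * \<rho> ^ d) * y ^ d \<le> real (k + d) * Z"
    using mult_left_mono[OF lhs, of "real (k + d)"] by simp
  moreover have "4 * (1 + real d) * Z * (real k / 4) = (real k * (1 + real d)) * Z" by simp
  ultimately show ?thesis by linarith
qed

lemma model_packing:
  fixes rchmin fmin fmax L \<epsilon> :: real
  assumes card: "CARD('d::finite) < CARD('n::finite)"
    and pos: "0 < rchmin" "0 < fmin" "fmin \<le> fmax / 4" "0 \<le> L" "0 < \<epsilon>"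
    and small: "\<epsilon> \<le> rchmin / (2 ^ 34 * real CARD('d) ^ 2)"
    and vol: "2 ^ (CARD('d) + 1) * sphere_volume TYPE('d) * fmin * rchmin ^ CARD('d) \<le> 1"
  obtains I :: "((real^'d::finite) \<times> real \<Rightarrow> 'n::finite set) set"
    and Dm :: "((real^'d::finite) \<times> real \<Rightarrow> 'n::finite set) \<Rightarrow> (real^'n::finite) measure"
  where "finite I" "\<And>i. i \<in> I \<Longrightarrow> Dm i \<in> fixed_point_model TYPE('d) rchmin fmin fmax L"
    "\<And>i j K. i \<in> I \<Longrightarrow> j \<in> I \<Longrightarrow> i \<noteq> j \<Longrightarrow>
        \<not> (hausdorff_distance (support (Dm i)) K \<le> ereal \<epsilon> \<and> hausdorff_distance (support (Dm j)) K \<le> ereal \<epsilon>)"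
    "exp (real CARD('n) / (ball_volume TYPE('d) * fmin * rchmin ^ CARD('d))
       * (rchmin / (2 ^ 21 * \<epsilon>)) powr (real CARD('d) / 2)) \<le> real (card I)"
proof -
  let ?d = "CARD('d)"
  let ?\<sigma> = "sphere_volume TYPE('d)"
  have d1: "1 \<le> ?d" by (simp add: Suc_le_eq)
  note \<sigma> = sphere_volume_pos_finite[where 'd='d]
  define R where "R = root ?d (1 / (2 * fmin * ?\<sigma>))"
  have Rd: "R ^ ?d = 1 / (2 * fmin * ?\<sigma>)" and R: "0 < R"
    using \<sigma>(1) pos by (auto simp: R_def real_root_pow_pos2 intro: real_root_gt_zero)
  have "(2 * rchmin) ^ ?d \<le> R ^ ?d"
    unfolding Rd using vol \<sigma>(1) pos by (simp add: power_mult_distrib field_simps)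
  then have R2: "2 * rchmin \<le> R" using R by (rule_tac power_le_imp_le_base[of _ "?d - 1"]) auto
  have volR: "hausdorff_outer ?d (sphere (0::(real^'d) \<times> real) R) = ennreal (1 / (2 * fmin))"
    using hausdorff_outer_sphere_scale[of ?d R, where 'a="(real^'d) \<times> real"] R pos \<sigma>
    by (simp add: Rd ennreal_mult'[symmetric])

  \<comment> \<open>The dimensionless size of the bumps: their width is 10 e \<open>rchmin\<close>
    and their slope 24/5 e, so smallness conditions become bounds on e and d e. The 2^34 of the
    hypothesis is the square of the 2^17 obtained here.\<close>
  define e where "e = sqrt (\<epsilon> / rchmin)"
  have e0: "0 < e" using pos by (simp add: e_def)
  have \<epsilon>e: "\<epsilon> = e\<^sup>2 * rchmin" using pos by (simp add: e_def)
  have ed: "real ?d * e \<le> 1 / 2 ^ 17"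
  proof -
    have "\<epsilon> / rchmin \<le> (1 / (2 ^ 17 * real ?d))\<^sup>2"
      using small pos d1 by (simp add: power_divide power_mult_distrib field_simps)
    then have "e \<le> 1 / (2 ^ 17 * real ?d)" unfolding e_def by (intro real_le_lsqrt) (use pos in auto)
    then show ?thesis using d1 by (simp add: field_simps)
  qed
  have e1: "e \<le> 1 / 2 ^ 17"
  proof -
    have "1 * e \<le> real ?d * e" using d1 e0 by (intro mult_right_mono) auto
    then show ?thesis using ed by simp
  qed
  \<comment> \<open>With height proportional to \<epsilon>, width proportional to its square root
    makes the curvature independent of \<epsilon>. This is the source of the exponent d/2 in the
    bound.\<close>
  define \<delta> where "\<delta> = 10 * e * rchmin"
  define h where "h = 4 * \<epsilon>"
  have \<delta>0: "0 < \<delta>" and h0: "0 < h" using e0 pos by (auto simp: \<delta>_def h_def)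
  have slope_eq: "12 * h / \<delta> = 24 / 5 * e"
    using e0 pos by (simp add: h_def \<delta>_def \<epsilon>e power2_eq_square field_simps)
  have curv: "6 * h / \<delta>\<^sup>2 = 6 / 25 / rchmin"
    using e0 pos by (simp add: h_def \<delta>_def \<epsilon>e power2_eq_square field_simps)

  have "e * rchmin \<le> 1 / 131072 * rchmin" using e1 pos by (intro mult_right_mono) auto
  then have s: "0 < 2 * \<delta>" "2 * \<delta> \<le> R / 20" using R2 \<delta>0 pos(1) unfolding \<delta>_def by linarith+
  obtain P :: "((real^'d) \<times> real) set" where P: "finite P" "P \<subseteq> sphere 0 R" "2 \<le> card P"
    "pairwise (\<lambda>x y. 2 * \<delta> \<le> dist x y) P"
    "hausdorff_outer (DIM(real^'d)) (sphere (0::(real^'d) \<times> real) R)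
       \<le> ennreal (real (card P) * (unit_ball_vol (DIM(real^'d)) * (9 / 4 * (2 * \<delta>)) ^ DIM(real^'d)))"
    using sphere_net[OF R s, where 'a="real^'d"] by blast
  have "P \<noteq> {}" using P(3) by auto
  then obtain p0 where p0: "p0 \<in> P" by blast
  define X where "X = P - {p0}"
  have X: "finite X" "card X = card P - 1" "\<And>i. i \<in> X \<Longrightarrow> norm i = R" "norm p0 = R"
    using P p0 by (auto simp: X_def)
  have Xsep: "2 * \<delta> \<le> dist x y" if "x \<in> X" "y \<in> X" "x \<noteq> y" for x y
    using P(4) that by (auto simp: X_def pairwise_def)
  have Xp0: "\<delta> \<le> dist p0 i" if "i \<in> X" for i
    using P(4) p0 that \<delta>0 by (fastforce simp: X_def pairwise_def)

  obtain A :: "(real^'d) \<times> real \<Rightarrow> real^'n" and K :: "'n set" and u where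
    A: "linear A" "\<And>x. norm (A x) = norm x" and K: "card K + ?d = CARD('n)"
    and u: "\<And>x j l. x \<noteq> 0 \<Longrightarrow> j \<in> K \<Longrightarrow> l \<in> K \<Longrightarrow> u x j \<bullet> u x l = (if j = l then 1 else 0)"
    and uA: "\<And>x w j. w \<bullet> x = 0 \<Longrightarrow> j \<in> K \<Longrightarrow> A w \<bullet> u x j = 0"
    using normal_frames[OF card] by metis
  have K0: "finite K" "K \<noteq> {}" "1 \<le> card K" using K card by auto
  obtain \<T> where \<T>: "finite \<T>" "\<T> \<subseteq> Pow K" "exp (real (card K) / 4) \<le> real (card \<T>)"
    "\<And>T T'. T \<in> \<T> \<Longrightarrow> T' \<in> \<T> \<Longrightarrow> T \<noteq> T' \<Longrightarrow> card K \<le> 8 * card (sym_diff T T')"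
    using gilbert_varshamov_code[OF K0(1,2)] by blast
  \<comment> \<open>The index set consists of extensional functions, so two different ones differ at
    an actual site.\<close>
  define I where "I = PiE X (\<lambda>_. \<T>)"
  define v where "v F i = sign_vector K (u i) (F i)" for F i
  have FT: "F i \<in> \<T>" "F i \<subseteq> K" "i \<noteq> 0" if "F \<in> I" "i \<in> X" for F i
    using that \<T>(2) X(3)[of i] R by (auto simp: I_def)
  have v_inner: "v F i \<bullet> v G i = 1 - 2 * real (card (sym_diff (F i) (G i))) / real (card K)"
    if "F \<in> I" "G \<in> I" "i \<in> X" for F G i
    unfolding v_def using that FT[of F i] FT[of G i] by (intro inner_sign_vector K0 u) auto
  have v1: "norm (v F i) = 1" if "F \<in> I" "i \<in> X" for F i
    using v_inner[OF that(1,1,2)] by (simp add: norm_eq_sqrt_inner)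
  have v_orth: "A w \<bullet> v F i = 0" if "w \<bullet> i = 0" for w F i
    unfolding v_def sign_vector_def using uA[OF that] by (simp add: inner_sum_right)
  have bs: "bumped_sphere h \<delta> X (v F) A R p0" if "F \<in> I" for F
  proof (intro bumped_sphere.intro separated_bumps.intro bumped_sphere_axioms.intro)
    show "real ?d * (12 * h / \<delta>) \<le> 1 / 2" unfolding slope_eq using ed by simp
  qed (use h0 \<delta>0 X Xsep Xp0 A R v1[OF that] in auto)
  define \<Phi> where "\<Phi> F x = A (x - p0) + bump_field h \<delta> X (v F) x" for F x
  have "\<exists>D \<in> fixed_point_model TYPE('d) rchmin fmin fmax L. support D = \<Phi> F ` sphere 0 R" if F: "F \<in> I" for F
  proof -
    interpret bumped_sphere h \<delta> X "v F" A R p0 by (rule bs[OF F])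
    have \<kappa>e: "\<kappa> = 24 / 5 * e" by (simp only: \<kappa>_def slope_eq)
    \<comment> \<open>The sphere uses (1 + \<kappa>) / 2 and the bumps 12/25; the remaining 1/50 has
      to cover 5 \<kappa> / 2, as the small e guarantees.\<close>
    have "2 * rchmin * ((1 + \<kappa>) / (2 * R) + 6 * h / \<delta>\<^sup>2) \<le> (1 - \<kappa>)\<^sup>2"
    proof -
      have "(1 + \<kappa>) / (2 * R) \<le> (1 + \<kappa>) / (4 * rchmin)"
        using R2 pos e0 by (intro divide_left_mono) (auto simp: \<kappa>e)
      then have "2 * rchmin * ((1 + \<kappa>) / (2 * R) + 6 * h / \<delta>\<^sup>2) \<le> 2 * rchmin * ((1 + \<kappa>) / (4 * rchmin) + 6 / 25 / rchmin)"
        unfolding curv using pos by (intro mult_left_mono add_right_mono) auto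
      also have "\<dots> = (1 + \<kappa>) / 2 + 12 / 25" using pos by (simp add: field_simps)
      also have "\<dots> \<le> 1 - 2 * \<kappa>" using e1 by (simp add: \<kappa>e field_simps)
      also have "\<dots> \<le> (1 - \<kappa>)\<^sup>2" by (simp add: power2_eq_square algebra_simps)
      finally show ?thesis .
    qed
    from uniform_distribution_in_model[OF this pos(2-4) volR]
    obtain D where "D \<in> fixed_point_model TYPE('d) rchmin fmin fmax L" "support D = M" by blast
    moreover have "M = \<Phi> F ` sphere 0 R" unfolding M_def by (simp add: \<Psi>_def[abs_def] \<Phi>_def[abs_def])
    ultimately show ?thesis by auto
  qed
  then obtain Dm where Dm: "\<And>F. F \<in> I \<Longrightarrow> Dm F \<in> fixed_point_model TYPE('d) rchmin fmin fmax L"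
    "\<And>F. F \<in> I \<Longrightarrow> support (Dm F) = \<Phi> F ` sphere 0 R" by metis
  have finI: "finite I" unfolding I_def using X(1) \<T>(1) by (intro finite_PiE) auto
  have sep: "\<not> (hausdorff_distance (support (Dm F)) C \<le> ereal \<epsilon> \<and> hausdorff_distance (support (Dm G)) C \<le> ereal \<epsilon>)"
    if FG: "F \<in> I" "G \<in> I" "F \<noteq> G" for F G C
  proof -
    obtain i where i: "i \<in> X" "F i \<noteq> G i" using FG unfolding I_def by (metis PiE_ext)
    have "card K \<le> 8 * card (sym_diff (F i) (G i))" using FT i FG by (intro \<T>(4)) auto
    then have "real (card K) \<le> 8 * real (card (sym_diff (F i) (G i)))" by linarith
    then have "1 / 4 \<le> 2 * real (card (sym_diff (F i) (G i))) / real (card K)"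
      using K0(3) by (subst pos_le_divide_eq) auto
    then have inner: "v F i \<bullet> v G i \<le> 3 / 4" unfolding v_inner[OF FG(1,2) i(1)] by linarith
    have sb: "separated_bumps h \<delta> X (v F)" "separated_bumps h \<delta> X (v G)"
      using bs FG by (auto simp: bumped_sphere_def)
    have "16 * \<epsilon> \<le> \<delta>" "1280 * \<epsilon> \<le> R"
    proof -
      have "e * e \<le> 1 / 2 ^ 17 * e" using e1 e0 by (intro mult_right_mono) auto
      then have ee: "e\<^sup>2 \<le> e / 2 ^ 17" by (simp add: power2_eq_square)
      then have "16 * e\<^sup>2 \<le> 10 * e" using e0 by simp
      then have "16 * e\<^sup>2 * rchmin \<le> 10 * e * rchmin" using pos by (intro mult_right_mono) auto
      then show "16 * \<epsilon> \<le> \<delta>" by (simp add: \<epsilon>e \<delta>_def)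
      have "1280 * e\<^sup>2 \<le> 2" using ee e1 by simp
      then have "1280 * e\<^sup>2 * rchmin \<le> 2 * rchmin" using pos by (intro mult_right_mono) auto
      then show "1280 * \<epsilon> \<le> R" using R2 unfolding \<epsilon>e mult.assoc by linarith
    qed
    then have apart: "5 / 2 * \<epsilon> \<le> dist (\<Phi> F i) (\<Phi> G z)" if "norm z = R" for z
      unfolding \<Phi>_def
      using sb A i X(3)[OF i(1)] that R v1 FG inner v_orth pos(5)
      by (intro bumped_spheres_apart[where R=R]) (auto simp: h_def)
    show ?thesis
      unfolding Dm(2)[OF FG(1)] Dm(2)[OF FG(2)]
    proof (rule hausdorff_distance_incompatible)
      show "\<Phi> F i \<in> \<Phi> F ` sphere 0 R" using X(3)[OF i(1)] by auto
      show "5 / 2 * \<epsilon> \<le> dist y (\<Phi> F i)" if "y \<in> \<Phi> G ` sphere 0 R" for y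
        using that apart by (auto simp: dist_commute)
    qed (use pos in simp)
  qed
  \<comment> \<open>Here y^d is the power in the bound, and y (1440 e) \<le> 1 because 1440^2 =
    2073600 is below 2^21 = 2097152.\<close>
  define y where "y = sqrt (rchmin / (2 ^ 21 * \<epsilon>))"
  have ypos: "0 < y" using pos by (simp add: y_def)
  have "y * (1440 * e) \<le> 1"
  proof -
    have "(y * (1440 * e))\<^sup>2 = rchmin / (2 ^ 21 * \<epsilon>) * 1440\<^sup>2 * (\<epsilon> / rchmin)"
      using pos by (simp add: y_def e_def power_mult_distrib)
    also have "\<dots> \<le> 1\<^sup>2" using pos by simp
    finally show ?thesis by (rule power2_le_imp_le) simp
  qed
  \<comment> \<open>45 e \<open>rchmin\<close> is 9/4 times the separation 2 \<delta> of the
    net.\<close>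
  moreover have "1 / (2 * fmin) \<le> real (card P) * (unit_ball_vol (real ?d) * (45 * e * rchmin) ^ ?d)"
  proof -
    have "ennreal (1 / (2 * fmin)) \<le> ennreal (real (card P) * (unit_ball_vol (real ?d) * (45 * e * rchmin) ^ ?d))"
      using P(5) volR by (simp add: \<delta>_def mult.assoc)
    then show ?thesis using e0 pos by (subst (asm) ennreal_le_iff) auto
  qed
  ultimately have "real (card K + ?d) / (unit_ball_vol (real ?d) * fmin * rchmin ^ ?d) * y ^ ?d \<le> real (card P - 1) * (real (card K) / 4)"
    using d1 K0(3) P(3) pos e0 ypos by (intro packing_count) auto
  moreover have "y ^ ?d = (rchmin / (2 ^ 21 * \<epsilon>)) powr (real ?d / 2)"
  proof -
    have "y = (rchmin / (2 ^ 21 * \<epsilon>)) powr (1 / 2)" using pos by (simp add: y_def powr_half_sqrt)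
    then show ?thesis using pos by (simp add: powr_power)
  qed
  moreover have "ball_volume TYPE('d) = unit_ball_vol (real ?d)"
    by (simp add: ball_volume_def content_ball)
  ultimately have "exp (real CARD('n) / (ball_volume TYPE('d) * fmin * rchmin ^ ?d)
       * (rchmin / (2 ^ 21 * \<epsilon>)) powr (real ?d / 2)) \<le> exp (real (card X) * (real (card K) / 4))"
    using K X(2) by simp
  also have "\<dots> = exp (real (card K) / 4) ^ card X" by (rule exp_of_nat_mult)
  also have "\<dots> \<le> real (card \<T>) ^ card X" using \<T>(3) by (intro power_mono) auto
  also have "\<dots> = real (card I)" using X(1) by (simp add: I_def card_PiE)
  finally have "exp (real CARD('n) / (ball_volume TYPE('d) * fmin * rchmin ^ ?d)
       * (rchmin / (2 ^ 21 * \<epsilon>)) powr (real ?d / 2)) \<le> real (card I)" .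
  then show ?thesis using that[of I Dm] finI Dm(1) sep by blast
qed

theorem theorem5p3:
  fixes rchmin fmin fmax L \<tau> \<alpha> \<epsilon> :: real
    and q :: nat
    and \<Omega> :: "'w measure"
    and Qs :: "'w \<Rightarrow> nat \<Rightarrow> real list \<Rightarrow> (real^'n::finite \<Rightarrow> real)"
    and Out :: "'w \<Rightarrow> real list \<Rightarrow> (real^'n) set"
  assumes "1 \<le> CARD('d::finite)" and "CARD('d) < CARD('n)"
    and "rchmin > 0" and "0 < fmin" and "fmin \<le> fmax / 4" and "L \<ge> 0"
    and "\<tau> > 0" and "\<alpha> < 1"
    and "0 < \<epsilon>" and "\<epsilon> \<le> rchmin / (2 ^ 34 * real (CARD('d)) ^ 2)"
    and "2 ^ (CARD('d) + 1) * sphere_volume TYPE('d) * fmin * rchmin ^ CARD('d) \<le> 1"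
    and "prob_space \<Omega>"
    and "\<forall>\<omega> i as. Qs \<omega> i as \<in> sq_queries"
    and "\<forall>D \<in> fixed_point_model TYPE('d) rchmin fmin fmax L. \<forall>orc. stat_oracle \<tau> D orc \<longrightarrow>
           (\<exists>E \<in> sets \<Omega>. measure \<Omega> E \<ge> 1 - \<alpha> \<and>
              (\<forall>\<omega>\<in>E. hausdorff_distance (support D) (Out \<omega> (snd (sq_run (Qs \<omega>) orc q))) \<le> ereal \<epsilon>))"
  shows "real q \<ge>
    (real CARD('n) / (ball_volume TYPE('d) * fmin * rchmin ^ CARD('d))
       * (rchmin / (2 ^ 21 * \<epsilon>)) powr (real CARD('d) / 2) + ln (1 - \<alpha>))
    / ln (1 + 1 / \<tau>)"
proof -
  let ?N = "real CARD('n) / (ball_volume TYPE('d) * fmin * rchmin ^ CARD('d)) * (rchmin / (2 ^ 21 * \<epsilon>)) powr (real CARD('d) / 2)"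
  obtain I :: "((real^'d) \<times> real \<Rightarrow> 'n set) set" and Dm :: "((real^'d) \<times> real \<Rightarrow> 'n set) \<Rightarrow> (real^'n) measure" where I: "finite I"
    "\<And>i. i \<in> I \<Longrightarrow> Dm i \<in> fixed_point_model TYPE('d) rchmin fmin fmax L"
    "\<And>i j K. i \<in> I \<Longrightarrow> j \<in> I \<Longrightarrow> i \<noteq> j \<Longrightarrow>
        \<not> (hausdorff_distance (support (Dm i)) K \<le> ereal \<epsilon> \<and> hausdorff_distance (support (Dm j)) K \<le> ereal \<epsilon>)"
    "exp ?N \<le> real (card I)"
    by (rule model_packing[OF assms(2-6,9-11)]) blast
  have "prob_space (Dm i)" "sets (Dm i) = sets borel" if "i \<in> I" for i
    using I(2)[OF that] by (simp_all add: fixed_point_model_def)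
  then have "real (card I) * (1 - \<alpha>) \<le> (1 + 1 / \<tau>) ^ q"
    using assms(14) I(1-3) by (intro sq_packing_bound[OF assms(7,12), where Dm=Dm and Qs=Qs and Out=Out and \<epsilon>=\<epsilon>]) auto
  moreover have "exp ?N * (1 - \<alpha>) \<le> real (card I) * (1 - \<alpha>)" using I(4) assms(8) by (intro mult_right_mono) auto
  ultimately have "exp ?N * (1 - \<alpha>) \<le> (1 + 1 / \<tau>) ^ q" by linarith
  then have "ln (exp ?N * (1 - \<alpha>)) \<le> ln ((1 + 1 / \<tau>) ^ q)"
    using assms(7,8) by (intro ln_mono) auto
  moreover have "ln (exp ?N * (1 - \<alpha>)) = ?N + ln (1 - \<alpha>)"
    using assms(8) by (subst ln_mult) auto
  moreover have "ln ((1 + 1 / \<tau>) ^ q) = real q * ln (1 + 1 / \<tau>)"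
    using assms(7) by (intro ln_realpow)
  ultimately have "?N + ln (1 - \<alpha>) \<le> real q * ln (1 + 1 / \<tau>)" by simp
  moreover have "0 < ln (1 + 1 / \<tau>)" using assms(7) by (intro ln_gt_zero) auto
  ultimately show ?thesis by (simp add: pos_divide_le_eq)
qed

end
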